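(* Let $n\ge1$ be an integer, $\beta>0$ and $a,b>-1$. Let $\alpha_k$, $0\le k\le 2n-2$, be independent random variables distributed as $$\alpha_k\sim\begin{cases}B\bigl(\tfrac{2n-k-2}{4}\beta+a+1,\ \tfrac{2n-k-2}{4}\beta+b+1\bigr)&k\text{ even},\\[2pt] B\bigl(\tfrac{2n-k-3}{4}\beta+a+b+2,\ \tfrac{2n-k-1}{4}\beta\bigr)&k\text{ odd}.\end{cases}$$ Let $\alpha_{2n-1}=\alpha_{-1}=-1$ and define, for $0\le k\le n-1$, $$b_{k+1}=(1-\alpha_{2k-1})\alpha_{2k}-(1+\alpha_{2k-1})\alpha_{2k-2},\qquad a_{k+1}=\bigl\{(1-\alpha_{2k-1})(1-\alpha_{2k}^2)(1+\alpha_{2k+1})\bigr\}^{1/2}$$ (for $k=0$ the term containing $\alpha_{-2}$ has coefficient $1+\alpha_{-1}=0$ and is read as $0$). Then the eigenvalues of the $n\times n$ symmetric tri-diagonal matrix $J$ with diagonal entries $b_1,\ldots,b_n$ and off-diagonal entries $J_{k,k+1}=J_{k+1,k}=a_k$ ($1\le k\le n-1$) are distributed according to the Jacobi ensemble, that is, according to the probability measure on $[-2,2]^n$ proportional to $$\bigl|\Delta(x_1,\ldots,x_n)\bigr|^\beta\prod_{j=1}^n(2-x_j)^a(2+x_j)^b\,dx_1\cdots dx_n .$$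
   Context: $\Delta(x_1,\ldots,x_n)=\prod_{1\le j<k\le n}(x_k-x_j)$ is the Vandermonde determinant. The statement about the (unordered) eigenvalues means that the expectation of every symmetric bounded measurable function of the eigenvalues equals its integral against the stated probability measure. For $s,t>0$, a real random variable $X$ is beta-distributed with parameters $s,t$, written $X\sim B(s,t)$, if $\mathbb{E}\{f(X)\}=\frac{2^{1-s-t}\Gamma(s+t)}{\Gamma(s)\Gamma(t)}\int_{-1}^1f(x)(1-x)^{s-1}(1+x)^{t-1}\,dx$. *)

theory Defs
  imports "HOL-Probability.Probability" "Jordan_Normal_Form.Char_Poly"
begin

text \<open>The beta distribution on \<open>[-1, 1]\<close> (not on \<open>[0, 1]\<close>).\<close>

definition beta_density :: "real \<Rightarrow> real \<Rightarrow> real \<Rightarrow> real" where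
  "beta_density s t x =
     2 powr (1 - s - t) * Gamma (s + t) / (Gamma s * Gamma t)
       * ((1 - x) powr (s - 1) * (1 + x) powr (t - 1)) * indicator {-1..1} x"

definition beta_distributed :: "'w measure \<Rightarrow> ('w \<Rightarrow> real) \<Rightarrow> real \<Rightarrow> real \<Rightarrow> bool" where
  "beta_distributed M X s t \<longleftrightarrow> distributed M lborel X (\<lambda>x. ennreal (beta_density s t x))"

text \<open>The first and second parameter of the law of \<open>\<alpha>\<^sub>k\<close>, \<open>0 \<le> k \<le> 2n - 2\<close>.\<close>

definition alpha_param1 :: "nat \<Rightarrow> real \<Rightarrow> real \<Rightarrow> real \<Rightarrow> nat \<Rightarrow> real" where
  "alpha_param1 n \<beta> a b k =
     (if even k then (2 * real n - real k - 2) / 4 * \<beta> + a + 1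
      else (2 * real n - real k - 3) / 4 * \<beta> + a + b + 2)"

definition alpha_param2 :: "nat \<Rightarrow> real \<Rightarrow> real \<Rightarrow> real \<Rightarrow> nat \<Rightarrow> real" where
  "alpha_param2 n \<beta> a b k =
     (if even k then (2 * real n - real k - 2) / 4 * \<beta> + b + 1
      else (2 * real n - real k - 1) / 4 * \<beta>)"

text \<open>
  Extension of \<open>\<alpha>\<^sub>0, \<dots>, \<alpha>\<^bsub>2n-2\<^esub>\<close> by the boundary values \<open>\<alpha>\<^bsub>-1\<^esub> = \<alpha>\<^bsub>2n-1\<^esub> = -1\<close>.
  The only other index that occurs below is \<open>-2\<close>, always with coefficient \<open>1 + \<alpha>\<^bsub>-1\<^esub> = 0\<close>,
  so the default value \<open>0\<close> is immaterial.
\<close>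

definition alpha_ext :: "nat \<Rightarrow> (nat \<Rightarrow> real) \<Rightarrow> int \<Rightarrow> real" where
  "alpha_ext n \<alpha> k =
     (if 0 \<le> k \<and> k \<le> 2 * int n - 2 then \<alpha> (nat k)
      else if k = -1 \<or> k = 2 * int n - 1 then -1
      else 0)"

text \<open>
  Indices are shifted by one: for \<open>0 \<le> k \<le> n - 1\<close>, \<open>jacobi_diag n \<alpha> k\<close> is \<open>b\<^bsub>k+1\<^esub>\<close> and
  \<open>jacobi_offdiag n \<alpha> k\<close> is \<open>a\<^bsub>k+1\<^esub>\<close>. The radicand is nonnegative when all
  \<open>\<alpha>\<^sub>k\<close> lie in \<open>[-1, 1]\<close>, which holds almost surely for beta-distributed \<open>\<alpha>\<^sub>k\<close>.
\<close>

definition jacobi_diag :: "nat \<Rightarrow> (nat \<Rightarrow> real) \<Rightarrow> nat \<Rightarrow> real" where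
  "jacobi_diag n \<alpha> k =
     (let A = alpha_ext n \<alpha>; k' = int k
      in (1 - A (2 * k' - 1)) * A (2 * k') - (1 + A (2 * k' - 1)) * A (2 * k' - 2))"

definition jacobi_offdiag :: "nat \<Rightarrow> (nat \<Rightarrow> real) \<Rightarrow> nat \<Rightarrow> real" where
  "jacobi_offdiag n \<alpha> k =
     (let A = alpha_ext n \<alpha>; k' = int k
      in sqrt ((1 - A (2 * k' - 1)) * (1 - (A (2 * k'))\<^sup>2) * (1 + A (2 * k' + 1))))"

definition jacobi_matrix :: "nat \<Rightarrow> (nat \<Rightarrow> real) \<Rightarrow> real mat" where
  "jacobi_matrix n \<alpha> = mat n n (\<lambda>(i, j).
     if i = j then jacobi_diag n \<alpha> i
     else if j = Suc i then jacobi_offdiag n \<alpha> i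
     else if i = Suc j then jacobi_offdiag n \<alpha> j
     else 0)"

text \<open>
  The eigenvalues with algebraic multiplicity, as a vector indexed by \<open>{..<n}\<close>. The increasing
  order only serves to pick one enumeration. The vector is meaningful for \<open>n \<times> n\<close> matrices
  whose characteristic polynomial splits over the reals, such as symmetric ones: then the
  multiset of its real roots has size \<open>n\<close>.
\<close>

definition eigenvalue_vector :: "nat \<Rightarrow> real mat \<Rightarrow> nat \<Rightarrow> real" where
  "eigenvalue_vector n A = (\<lambda>i\<in>{..<n}. sorted_list_of_multiset (proots (char_poly A)) ! i)"

definition vandermonde :: "nat \<Rightarrow> (nat \<Rightarrow> real) \<Rightarrow> real" where
  "vandermonde n x = (\<Prod>k<n. \<Prod>j<k. x k - x j)"

definition jacobi_weight :: "nat \<Rightarrow> real \<Rightarrow> real \<Rightarrow> real \<Rightarrow> (nat \<Rightarrow> real) \<Rightarrow> real" where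
  "jacobi_weight n \<beta> a b x =
     \<bar>vandermonde n x\<bar> powr \<beta> * (\<Prod>j<n. (2 - x j) powr a * (2 + x j) powr b)
       * indicator ({..<n} \<rightarrow>\<^sub>E {-2..2}) x"

text \<open>
  The weight normalised by its total mass. If that mass were \<open>0\<close> or \<open>\<infinity>\<close>, this would not be a
  probability measure.
\<close>

definition jacobi_ensemble :: "nat \<Rightarrow> real \<Rightarrow> real \<Rightarrow> real \<Rightarrow> (nat \<Rightarrow> real) measure" where
  "jacobi_ensemble n \<beta> a b =
     (let L = Pi\<^sub>M {..<n} (\<lambda>_. lborel);
          Z = (\<integral>\<^sup>+ x. ennreal (jacobi_weight n \<beta> a b x) \<partial>L)
      in density L (\<lambda>x. ennreal (jacobi_weight n \<beta> a b x) / Z))"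

definition symmetric_fun :: "nat \<Rightarrow> ((nat \<Rightarrow> real) \<Rightarrow> real) \<Rightarrow> bool" where
  "symmetric_fun n f \<longleftrightarrow>
     (\<forall>p x. p permutes {..<n} \<longrightarrow> x \<in> {..<n} \<rightarrow>\<^sub>E UNIV \<longrightarrow> f (x \<circ> p) = f x)"

end

theory Submission
  imports Defs
begin

text \<open>The proof follows two polynomials: the characteristic polynomial \<open>P\<close> of the Jacobi matrix \<open>J\<close> and the
  characteristic polynomial \<open>Q\<close> of \<open>J\<close> without its first row and column. The pair \<open>(P, Q)\<close> carries the
  same information as \<open>\<alpha>\<^sub>0, \<dots>, \<alpha>\<^bsub>2n-2\<^esub>\<close>, or as the eigenvalues \<open>x\<^sub>i\<close> together with the weights
  \<open>\<mu>\<^sub>i = Q(x\<^sub>i) / P'(x\<^sub>i)\<close> of the spectral measure of the first basis vector, but in terms of the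
  coefficients of \<open>P\<close> and \<open>Q\<close> every change of variables becomes affine, one coordinate at a time.

  If \<open>(p, q)\<close> belongs to the matrix of size \<open>n - 1\<close> built from \<open>\<alpha>\<^sub>2, \<alpha>\<^sub>3, \<dots>\<close>, then with
  \<open>u = (1 - \<alpha>\<^sub>1) / 2\<close> and \<open>c = \<alpha>\<^sub>0\<close> the three-term recurrence gives
  \<open>Q = u p + (1 - u) (X + 2c) q\<close> and \<open>P = (X - 2c) Q - 4 (1 - u) (1 - c\<^sup>2) q\<close>. Sign changes show that this
  step maps pairs with strictly interlacing roots in \<open>(-2, 2)\<close>, together with \<open>0 < u < 1\<close> and \<open>\<bar>c\<bar> < 1\<close>,
  bijectively onto such pairs one degree higher (\<open>step_admissible\<close>, \<open>step_admissible_rev\<close>). The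
  density \<open>\<bar>P(2)\<bar>\<^sup>a \<bar>P(-2)\<bar>\<^sup>b \<Prod>\<^sub>i \<bar>Q(x\<^sub>i)\<bar>\<^sup>\<kappa>\<close> with \<open>\<kappa> = \<beta> / 2 - 1\<close> is multiplied by a monomial in
  \<open>u, 1 - u, 1 - c, 1 + c\<close>, because the product is a resultant; together with the Jacobian of the step
  this monomial is the product of the two beta densities (\<open>pair_density_step\<close>). By induction the pair
  \<open>(P, Q)\<close> has this density, up to a constant (\<open>char_pair_law\<close>). The law of \<open>\<alpha>\<^bsub>2n-2-m\<^esub>\<close> does not
  depend on \<open>n\<close>, so the induction runs over the reversed sequence and adds two variables at its end.

  It remains to integrate out \<open>Q\<close> and to pass from coefficients to roots. For fixed \<open>P\<close>, Lagrange
  interpolation at the roots turns the coefficients of \<open>Q\<close> into the weights, with Jacobian \<open>\<bar>\<Delta>(x)\<bar>\<close>, and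
  \<open>\<Prod>\<^sub>i \<bar>P'(x\<^sub>i)\<bar> = \<Delta>(x)\<^sup>2\<close>; what is left is a Dirichlet integral that does not involve \<open>x\<close>, so the
  integral over \<open>Q\<close> is a constant times \<open>\<bar>\<Delta>(x)\<bar>\<close> to the power \<open>1 + 2\<kappa> = \<beta> - 1\<close> (\<open>nn_integral_second_poly\<close>).
  Finally the map from roots to coefficients is \<open>n!\<close> to one with Jacobian \<open>\<bar>\<Delta>(x)\<bar>\<close>
  (\<open>nn_integral_vieta\<close>), which supplies the missing factor. The constants need not be evaluated: the law of the
  \<open>\<alpha>\<^sub>k\<close> has total mass one, which identifies their product and shows that the Jacobi weight has a
  finite and positive integral.\<close>

section \<open>Interlacing polynomials and the coefficient step\<close>

hide_const (open) Module.smult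

text \<open>Coefficients are listed from the leading one \<open>s\<close> downwards. In this order multiplication by \<open>X - t\<close> is a
  lower triangular shear of the list followed by one new last entry, whatever the degree is.\<close>

primrec cpoly :: "real \<Rightarrow> nat \<Rightarrow> (nat \<Rightarrow> real) \<Rightarrow> real poly" where
  "cpoly s 0 c = [:s:]"
| "cpoly s (Suc n) c = pCons (c n) (cpoly s n c)"

lemma cpoly_cong: "(\<And>i. i < n \<Longrightarrow> c i = d i) \<Longrightarrow> cpoly s n c = cpoly s n d"
  by (induction n) auto

lemma coeff_cpoly: "coeff (cpoly s n c) i = (if i < n then c (n - 1 - i) else if i = n then s else 0)"
proof (induction n arbitrary: i)
  case 0
  then show ?case by (cases i) auto
next
  case (Suc n)
  then show ?case by (cases i) auto
qed

lemma degree_cpoly_le: "degree (cpoly s n c) \<le> n"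
  by (intro degree_le) (auto simp: coeff_cpoly)

lemma degree_cpoly: "s \<noteq> 0 \<Longrightarrow> degree (cpoly s n c) = n"
  by (intro antisym degree_cpoly_le le_degree) (auto simp: coeff_cpoly)

lemma cpoly_of_coeff: "degree p \<le> n \<Longrightarrow> cpoly (coeff p n) n (\<lambda>i. coeff p (n - 1 - i)) = p"
  by (intro poly_eqI) (auto simp: coeff_cpoly coeff_eq_0)

lemma cpoly_inj: "cpoly s n c = cpoly s n d \<Longrightarrow> i < n \<Longrightarrow> c i = d i"
proof -
  assume "cpoly s n c = cpoly s n d" "i < n"
  then have "coeff (cpoly s n c) (n - 1 - i) = coeff (cpoly s n d) (n - 1 - i)" by simp
  then show ?thesis using \<open>i < n\<close> by (simp add: coeff_cpoly split: if_splits)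
qed

text \<open>The coefficients of \<open>X - t\<close> times the polynomial: the entry before the first one is the leading
  coefficient \<open>s\<close>, and the entry after the last one is \<open>0\<close>.\<close>

definition mul_linear :: "real \<Rightarrow> nat \<Rightarrow> (nat \<Rightarrow> real) \<Rightarrow> real \<Rightarrow> nat \<Rightarrow> real" where
  "mul_linear s n c t i = (if i < n then c i else 0) - t * (if i = 0 then s else c (i - 1))"

lemma cpoly_mul_linear: "cpoly s (Suc n) (mul_linear s n c t) = [:- t, 1:] * cpoly s n c"
proof (rule poly_eqI)
  fix i
  show "coeff (cpoly s (Suc n) (mul_linear s n c t)) i = coeff ([:- t, 1:] * cpoly s n c) i"
    by (cases i) (auto simp: coeff_cpoly mul_linear_def coeff_pCons Suc_diff_Suc numeral_2_eq_2)
qed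

lemma cpoly_add: "cpoly s n c + cpoly s' n d = cpoly (s + s') n (\<lambda>i. c i + d i)"
  by (induction n) auto

lemma cpoly_smult: "smult k (cpoly s n c) = cpoly (k * s) n (\<lambda>i. k * c i)"
  by (induction n) auto

definition root_poly :: "nat \<Rightarrow> (nat \<Rightarrow> real) \<Rightarrow> real poly" where
  "root_poly n x = (\<Prod>i<n. [:- x i, 1:])"

lemma poly_root_poly: "poly (root_poly n x) t = (\<Prod>i<n. t - x i)"
  by (simp add: root_poly_def poly_prod)

lemma root_poly_Suc: "root_poly (Suc n) x = [:- x n, 1:] * root_poly n x"
  by (simp add: root_poly_def mult.commute)

lemma root_poly_cong: "(\<And>i. i < n \<Longrightarrow> x i = y i) \<Longrightarrow> root_poly n x = root_poly n y"
  by (simp add: root_poly_def)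

lemma root_poly_nz: "root_poly n x \<noteq> 0"
  by (simp add: root_poly_def)

lemma degree_root_poly: "degree (root_poly n x) = n"
  by (simp add: root_poly_def degree_prod_eq_sum_degree)

lemma coeff_root_poly: "coeff (root_poly n x) n = 1"
proof -
  have "lead_coeff (root_poly n x) = 1"
    by (simp add: root_poly_def lead_coeff_prod)
  then show ?thesis by (simp add: degree_root_poly)
qed

lemma poly_root_poly_root: "i < n \<Longrightarrow> poly (root_poly n x) (x i) = 0"
  by (auto simp: poly_root_poly)

text \<open>Exactly the factors that belong to the \<open>n - m\<close> roots to the right of \<open>t\<close> are negative.\<close>

lemma root_poly_sign:
  assumes "m \<le> n" "\<And>i. i < m \<Longrightarrow> x i < t" "\<And>i. m \<le> i \<Longrightarrow> i < n \<Longrightarrow> t < x i"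
  shows "0 < (-1) ^ (n - m) * poly (root_poly n x) t"
proof -
  have s: "{..<n} = {..<m} \<union> {m..<n}" using assms(1) by auto
  have "poly (root_poly n x) t = (\<Prod>i<m. t - x i) * (\<Prod>i\<in>{m..<n}. t - x i)"
    unfolding poly_root_poly s by (intro prod.union_disjoint) auto
  also have "(\<Prod>i\<in>{m..<n}. t - x i) = (\<Prod>i\<in>{m..<n}. (-1) * (x i - t))" by simp
  also have "\<dots> = (-1) ^ (n - m) * (\<Prod>i\<in>{m..<n}. x i - t)"
    by (subst prod.distrib) simp
  finally have e: "(-1) ^ (n - m) * poly (root_poly n x) t
      = ((-1) ^ (n - m) * (-1) ^ (n - m)) * ((\<Prod>i<m. t - x i) * (\<Prod>i\<in>{m..<n}. x i - t))"
    by (simp only: mult_ac)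
  have "((-1::real) ^ (n - m) * (-1) ^ (n - m)) = 1"
    by (simp add: power_add[symmetric] mult_2[symmetric])
  moreover have "0 < (\<Prod>i<m. t - x i) * (\<Prod>i\<in>{m..<n}. x i - t)"
    using assms by (intro mult_pos_pos prod_pos) auto
  ultimately show ?thesis using e by simp
qed

lemma strict_mono_on_of_Suc:
  fixes z :: "nat \<Rightarrow> real"
  assumes "\<And>i. i < d \<Longrightarrow> z i < z (Suc i)"
  shows "strict_mono_on {..d} z"
proof (rule strict_mono_onI)
  fix r s assume "r \<in> {..d}" "s \<in> {..d}" "r < s"
  then have "s \<le> d" "r < s" by auto
  then show "z r < z s"
  proof (induction s)
    case (Suc s)
    then show ?case using assms[of s] by (cases "r = s") auto
  qed simp
qed

text \<open>The intermediate value theorem finds a root in each of the \<open>d\<close> gaps, and the degree bound leaves no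
  room for others. All interlacing statements below come from this lemma.\<close>

lemma alternating_poly_roots:
  fixes f :: "real poly" and z :: "nat \<Rightarrow> real"
  assumes deg: "degree f \<le> d" and z: "\<And>i. i < d \<Longrightarrow> z i < z (Suc i)"
    and alt: "\<And>i. i \<le> d \<Longrightarrow> 0 < (-1) ^ (d - i) * poly f (z i)"
  obtains w where "\<And>i. i < d \<Longrightarrow> z i < w i \<and> w i < z (Suc i)" "f = smult (coeff f d) (root_poly d w)"
    "0 < coeff f d"
proof -
  have zm: "strict_mono_on {..d} z" by (rule strict_mono_on_of_Suc) (rule z)
  have "\<exists>w. z i < w \<and> w < z (Suc i) \<and> poly f w = 0" if "i < d" for i
  proof -
    have a: "0 < (-1) ^ (d - i) * poly f (z i)" "0 < (-1) ^ (d - Suc i) * poly f (z (Suc i))"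
      using alt that by auto
    have "d - i = Suc (d - Suc i)" using that by simp
    with a have "poly f (z i) * poly f (z (Suc i)) < 0"
      by (cases "even (d - Suc i)") (auto simp: mult_less_0_iff)
    then show ?thesis using poly_IVT[OF z[OF that], of f] by auto
  qed
  then obtain w where w: "\<And>i. i < d \<Longrightarrow> z i < w i \<and> w i < z (Suc i) \<and> poly f (w i) = 0" by metis
  have wlt: "w i < w j" if "i < j" "j < d" for i j
  proof -
    have "z (Suc i) \<le> z j"
      using strict_mono_on_leD[OF zm, of "Suc i" j] that by auto
    then show ?thesis using w[of i] w[of j] that by auto
  qed
  have inj: "inj_on w {..<d}"
    by (rule inj_onI) (metis lessThan_iff linorder_neq_iff order_less_irrefl wlt)
  let ?g = "f - smult (coeff f d) (root_poly d w)"
  have f: "?g = 0"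
  proof (rule ccontr)
    assume g: "?g \<noteq> 0"
    have c0: "coeff ?g d = 0" by (simp add: coeff_root_poly)
    have dg: "degree ?g \<le> d" using deg
      by (intro degree_diff_le) (auto simp: degree_root_poly intro: order_trans[OF degree_smult_le])
    have "degree ?g \<noteq> d" using g c0 leading_coeff_0_iff by metis
    with dg have dg: "degree ?g < d" by simp
    have sub: "w ` {..<d} \<subseteq> {x. poly ?g x = 0}" using w by (auto simp: poly_root_poly)
    have "card (w ` {..<d}) \<le> card {x. poly ?g x = 0}"
      by (intro card_mono sub poly_roots_finite g)
    also have "\<dots> \<le> degree ?g" by (rule card_poly_roots_bound[OF g])
    finally show False using dg by (simp add: card_image inj)
  qed
  have "0 < (-1) ^ (d - d) * poly (root_poly d w) (z d)"
  proof (rule root_poly_sign)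
    fix i assume i: "i < d"
    have "z (Suc i) \<le> z d" using strict_mono_on_leD[OF zm, of "Suc i" d] i by auto
    then show "w i < z d" using w[OF i] by auto
  qed auto
  then have r: "0 < poly (root_poly d w) (z d)" by simp
  have "0 < poly f (z d)" using alt[of d] by simp
  also have "poly f (z d) = coeff f d * poly (root_poly d w) (z d)"
    using f by (metis eq_iff_diff_eq_0 poly_smult)
  finally have "0 < coeff f d" using r by (simp add: zero_less_mult_iff)
  then show ?thesis using that[of w] w f by auto
qed

text \<open>The pairs that occur as characteristic polynomials of a Jacobi matrix with simple spectrum in
  \<open>(-2, 2)\<close> and of its first minor: \<open>Q\<close> changes sign between consecutive roots of \<open>P\<close>, that is, all
  weights \<open>Q(x\<^sub>i) / P'(x\<^sub>i)\<close> are positive.\<close>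

definition admissible :: "nat \<Rightarrow> real poly \<Rightarrow> real poly \<Rightarrow> (nat \<Rightarrow> real) \<Rightarrow> bool" where
  "admissible n P Q x \<longleftrightarrow> strict_mono_on {..n} x \<and> P = root_poly (Suc n) x
     \<and> (\<forall>i\<le>n. \<bar>x i\<bar> < 2 \<and> 0 < (-1) ^ (n - i) * poly Q (x i))"

text \<open>How the two characteristic polynomials change when two parameters are put in front of the sequence
  \<open>\<alpha>\<close>; here \<open>c\<close> is the new \<open>\<alpha>\<^sub>0\<close> and \<open>u = (1 - \<alpha>\<^sub>1) / 2\<close>.\<close>

definition stepQ :: "real \<Rightarrow> real \<Rightarrow> real poly \<Rightarrow> real poly \<Rightarrow> real poly" where
  "stepQ u c p q = smult u p + smult (1 - u) ([:2 * c, 1:] * q)"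

definition stepP :: "real \<Rightarrow> real \<Rightarrow> real poly \<Rightarrow> real poly \<Rightarrow> real poly" where
  "stepP u c p q = [:- 2 * c, 1:] * stepQ u c p q - smult (4 * (1 - u) * (1 - c\<^sup>2)) q"

lemma poly_stepP: "poly (stepP u c p q) x = u * (x - 2 * c) * poly p x + (1 - u) * (x\<^sup>2 - 4) * poly q x"
  by (simp add: stepP_def stepQ_def algebra_simps power2_eq_square)

lemma poly_stepQ: "poly (stepQ u c p q) x = u * poly p x + (1 - u) * (x + 2 * c) * poly q x"
  by (simp add: stepQ_def algebra_simps)

text \<open>At a root of \<open>P\<close> this gives the value of \<open>Q\<close> as a multiple of the value of \<open>p\<close>. In the same way
  \<open>poly_stepP\<close> gives the value of \<open>P\<close> at a root of \<open>p\<close> as a multiple of the value of \<open>q\<close>. These two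
  facts carry signs and resultants through the step.\<close>

lemma step_eliminate_q:
  "(x + 2 * c) * poly (stepP u c p q) x - (x\<^sup>2 - 4) * poly (stepQ u c p q) x = 4 * u * (1 - c\<^sup>2) * poly p x"
  by (simp add: poly_stepP poly_stepQ algebra_simps power2_eq_square)

lemma degree_step:
  assumes "degree p = Suc n" "degree q = n"
  shows "degree (stepQ u c p q) \<le> Suc n" "degree (stepP u c p q) \<le> Suc (Suc n)"
proof -
  have "degree ([:2 * c, 1:] * q) \<le> Suc n"
    using degree_mult_le[of "[:2 * c, 1:]" q] assms by simp
  then show 1: "degree (stepQ u c p q) \<le> Suc n" unfolding stepQ_def using assms
    by (intro degree_add_le) (auto intro: order_trans[OF degree_smult_le])
  have "degree ([:- 2 * c, 1:] * stepQ u c p q) \<le> Suc (Suc n)"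
    using degree_mult_le[of "[:- 2 * c, 1:]" "stepQ u c p q"] 1 by simp
  then show "degree (stepP u c p q) \<le> Suc (Suc n)" unfolding stepP_def using assms
    by (intro degree_diff_le) (auto intro: order_trans[OF degree_smult_le])
qed

lemma coeff_stepP:
  assumes "degree p = Suc n" "degree q = n" "coeff p (Suc n) = 1" "coeff q n = 1"
  shows "coeff (stepP u c p q) (Suc (Suc n)) = 1"
  using assms by (simp add: stepP_def stepQ_def coeff_eq_0)

lemma neg_one_pow_sq: "(-1::real) ^ k * (-1) ^ k = 1"
  by (simp add: power_add[symmetric] mult_2[symmetric])

text \<open>The signs of \<open>P\<close> at the roots of \<open>p\<close> are those of \<open>-q\<close>, and the signs of \<open>P\<close> at \<open>2\<close> and \<open>-2\<close> are those of
  a polynomial with all its roots in between. So \<open>P\<close> has a root in each of the intervals cut out by \<open>-2\<close>, the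
  roots of \<open>p\<close>, and \<open>2\<close>; at these roots \<open>Q\<close> has the sign of \<open>p\<close>.\<close>

lemma step_admissible:
  assumes u: "0 < u" "u < 1" and c: "\<bar>c\<bar> < 1" and adm: "admissible n p q y"
    and q: "degree q = n" "coeff q n = 1"
  obtains x where "admissible (Suc n) (stepP u c p q) (stepQ u c p q) x"
proof -
  have ym: "strict_mono_on {..n} y" and p: "p = root_poly (Suc n) y"
    and y2: "\<And>i. i \<le> n \<Longrightarrow> -2 < y i" "\<And>i. i \<le> n \<Longrightarrow> y i < 2"
    and qs: "\<And>i. i \<le> n \<Longrightarrow> 0 < (-1) ^ (n - i) * poly q (y i)"
    using adm by (auto simp: admissible_def abs_less_iff)
  have dp: "degree p = Suc n" "coeff p (Suc n) = 1" 
    by (simp_all only: p degree_root_poly coeff_root_poly)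
  let ?P = "stepP u c p q" and ?Q = "stepQ u c p q"
  have yP: "0 < (-1) ^ (Suc n - i) * poly ?P (y i)" if "i \<le> n" for i
  proof -
    have "poly p (y i) = 0" using that unfolding p by (intro poly_root_poly_root) simp
    then have "poly ?P (y i) = (1 - u) * ((y i)\<^sup>2 - 4) * poly q (y i)" by (simp add: poly_stepP)
    then have e: "poly ?P (y i) = (1 - u) * ((y i)\<^sup>2 - 4) * poly q (y i)" .
    have "(-1) ^ (Suc n - i) * poly ?P (y i) = (1 - u) * (4 - (y i)\<^sup>2) * ((-1) ^ (n - i) * poly q (y i))"
      unfolding e using that by (simp add: Suc_diff_le algebra_simps)
    moreover have "(y i)\<^sup>2 < 4" using y2[OF that] abs_square_less_1[of "y i / 2"] by (simp add: power_divide)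
    ultimately show ?thesis using qs[OF that] u by (simp del: power_Suc)
  qed
  \<comment> \<open>The points at which the signs of \<open>P\<close> alternate: \<open>-2\<close>, the roots of \<open>p\<close>, and \<open>2\<close>.\<close>
  define z where "z i = (if i = 0 then - 2 else if i \<le> Suc n then y (i - 1) else 2)" for i
  have z: "z i < z (Suc i)" if "i < Suc (Suc n)" for i
    using that y2 strict_mono_onD[OF ym, of "i - 1" i] by (auto simp: z_def)
  have alt: "0 < (-1) ^ (Suc (Suc n) - i) * poly ?P (z i)" if i: "i \<le> Suc (Suc n)" for i
  proof -
    consider "i = 0" | j where "i = Suc j" "j \<le> n" | "i = Suc (Suc n)"
      using i by (cases i) (auto simp: le_Suc_eq)
    then show ?thesis
    proof cases
      case 1
      have "0 < (-1) ^ (Suc n - 0) * poly p (-2)"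
        unfolding p by (rule root_poly_sign) (auto simp: y2)
      then have "0 < (u * (2 + 2 * c)) * ((-1) ^ (Suc n - 0) * poly p (-2))"
        by (rule mult_pos_pos[rotated]) (use u c in \<open>auto intro!: mult_pos_pos\<close>)
      then show ?thesis using 1 by (simp add: z_def poly_stepP algebra_simps)
    next
      case 2
      then show ?thesis using yP[of j] by (simp add: z_def)
    next
      case 3
      have "0 < (-1) ^ (Suc n - Suc n) * poly p 2"
        unfolding p by (rule root_poly_sign) (auto simp: y2)
      then show ?thesis using 3 u c by (simp add: z_def poly_stepP)
    qed
  qed
  have dP: "degree ?P \<le> Suc (Suc n)" using degree_step[OF dp(1) q(1)] by blast
  obtain x where x: "\<And>i. i < Suc (Suc n) \<Longrightarrow> z i < x i \<and> x i < z (Suc i)"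
    and P: "?P = smult (coeff ?P (Suc (Suc n))) (root_poly (Suc (Suc n)) x)"
    using alternating_poly_roots[OF dP z alt] by metis
  have P: "?P = root_poly (Suc (Suc n)) x" 
    using P by (simp only: coeff_stepP[OF dp(1) q(1) dp(2) q(2)] smult_1_left)
  have zm: "strict_mono_on {..Suc (Suc n)} z" by (rule strict_mono_on_of_Suc) (rule z)
  have xm: "strict_mono_on {..Suc n} x" 
  proof (rule strict_mono_on_of_Suc)
    fix i assume "i < Suc n" then show "x i < x (Suc i)" using x[of i] x[of "Suc i"] by auto
  qed
  have x2: "\<bar>x i\<bar> < 2" if "i \<le> Suc n" for i
  proof -
    have "z 0 \<le> z i" "z (Suc i) \<le> z (Suc (Suc n))" 
      using strict_mono_on_leD[OF zm, of 0 i] strict_mono_on_leD[OF zm, of "Suc i" "Suc (Suc n)"] that by auto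
    then show ?thesis using x[of i] that by (auto simp: z_def)
  qed
  have Qx: "0 < (-1) ^ (Suc n - i) * poly ?Q (x i)" if i: "i \<le> Suc n" for i
  proof -
    have "poly ?P (x i) = 0" using i unfolding P by (intro poly_root_poly_root) simp
    then have e: "(4 - (x i)\<^sup>2) * poly ?Q (x i) = 4 * u * (1 - c\<^sup>2) * poly p (x i)"
      using step_eliminate_q[of "x i" c u p q] by (simp add: algebra_simps)
    have "0 < (-1) ^ (Suc n - i) * poly p (x i)" unfolding p
    proof (rule root_poly_sign[OF i])
      fix j assume "j < i"
      have "z (Suc j) \<le> z i" using strict_mono_on_leD[OF zm, of "Suc j" i] \<open>j < i\<close> i by auto
      then show "y j < x i" using x[of i] i \<open>j < i\<close> by (auto simp: z_def)
    next
      fix j assume "i \<le> j" "j < Suc n"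
      have "z (Suc i) \<le> z (Suc j)" using strict_mono_on_leD[OF zm, of "Suc i" "Suc j"] \<open>i \<le> j\<close> \<open>j < Suc n\<close> by auto
      then show "x i < y j" using x[of i] i \<open>j < Suc n\<close> by (auto simp: z_def)
    qed
    moreover have "0 < 4 * u * (1 - c\<^sup>2)" using c u by (simp add: abs_square_less_1)
    ultimately have "0 < (4 * u * (1 - c\<^sup>2)) * ((-1) ^ (Suc n - i) * poly p (x i))"
      by (metis mult_pos_pos)
    also have "\<dots> = (4 - (x i)\<^sup>2) * ((-1) ^ (Suc n - i) * poly ?Q (x i))"
      using e by (metis mult.left_commute)
    finally have "0 < (4 - (x i)\<^sup>2) * ((-1) ^ (Suc n - i) * poly ?Q (x i))" .
    moreover have "(x i)\<^sup>2 < 4" using x2[OF i] abs_square_less_1[of "x i / 2"] by (simp add: power_divide)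
    ultimately show ?thesis by (simp add: zero_less_mult_iff del: power_Suc)
  qed
  show ?thesis by (rule that[of x]) (use xm P x2 Qx in \<open>auto simp only: admissible_def atMost_iff\<close>)
qed

text \<open>The polynomial \<open>4u(1 - c\<^sup>2) p\<close> is a combination of \<open>P\<close> and \<open>Q\<close> that alternates along the roots of \<open>P\<close>.
  Hence it has a positive leading coefficient and real roots, and comparing its signs at \<open>2\<close> and \<open>-2\<close> with those
  of \<open>P\<close> forces \<open>\<bar>c\<bar> < 1\<close> and then \<open>0 < u\<close>. Next \<open>4(1 - u)(1 - c\<^sup>2) q\<close> alternates along the roots of \<open>p\<close>, which
  gives \<open>u < 1\<close>.\<close>

lemma step_admissible_rev:
  assumes adm: "admissible (Suc n) (stepP u c p q) (stepQ u c p q) x"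
    and p: "degree p = Suc n" "coeff p (Suc n) = 1" and q: "degree q = n" "coeff q n = 1"
  shows "\<bar>c\<bar> < 1" "0 < u" "u < 1" "\<exists>y. admissible n p q y"
proof -
  let ?P = "stepP u c p q" and ?Q = "stepQ u c p q"
  define k where "k = 4 * u * (1 - c\<^sup>2)"
  define l where "l = 4 * (1 - u) * (1 - c\<^sup>2)"
  have xm: "strict_mono_on {..Suc n} x" and P: "?P = root_poly (Suc (Suc n)) x"
    and x2: "\<And>i. i \<le> Suc n \<Longrightarrow> \<bar>x i\<bar> < 2"
    and Qs: "\<And>i. i \<le> Suc n \<Longrightarrow> 0 < (-1) ^ (Suc n - i) * poly ?Q (x i)"
    using adm unfolding admissible_def by blast+
  have sq4: "t\<^sup>2 < 4" if "\<bar>t\<bar> < 2" for t :: real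
    using that abs_square_less_1[of "t / 2"] by (simp add: power_divide)
  have xlt: "x i < x (Suc i)" if "i < Suc n" for i
    using strict_mono_onD[OF xm, of i "Suc i"] that by auto
  have alt: "0 < (-1) ^ (Suc n - i) * poly (smult k p) (x i)" if i: "i \<le> Suc n" for i
  proof -
    have "poly ?P (x i) = 0" using i unfolding P by (intro poly_root_poly_root) simp
    then have e: "(4 - (x i)\<^sup>2) * poly ?Q (x i) = poly (smult k p) (x i)"
      using step_eliminate_q[of "x i" c u p q] by (simp add: algebra_simps k_def)
    have "0 < (4 - (x i)\<^sup>2) * ((-1) ^ (Suc n - i) * poly ?Q (x i))"
      by (rule mult_pos_pos) (use Qs[OF i] sq4[OF x2[OF i]] in simp_all)
    also have "\<dots> = (-1) ^ (Suc n - i) * poly (smult k p) (x i)" using e by (simp only: mult.left_commute)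
    finally show ?thesis .
  qed
  have "degree (smult k p) \<le> Suc n" using p degree_smult_le[of k p] by simp
  then obtain y where y: "\<And>i. i < Suc n \<Longrightarrow> x i < y i \<and> y i < x (Suc i)"
    and kp: "smult k p = smult (coeff (smult k p) (Suc n)) (root_poly (Suc n) y)" and k0: "0 < coeff (smult k p) (Suc n)"
    using alternating_poly_roots[OF _ xlt alt] by metis
  have ck: "coeff (smult k p) (Suc n) = k" by (simp add: p)
  have k: "0 < k" and py: "p = root_poly (Suc n) y" 
  proof -
    show k: "0 < k" using k0 unfolding ck .
    have "smult (inverse k) (smult k p) = smult (inverse k) (smult k (root_poly (Suc n) y))"
      using kp unfolding ck by (rule arg_cong)
    then show "p = root_poly (Suc n) y" using k by simp
  qed
  have y2: "-2 < y i" "y i < 2" if "i \<le> n" for i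
    using y[of i] x2[of i] x2[of "Suc i"] that by auto
  have ym: "strict_mono_on {..n} y"
  proof (rule strict_mono_on_of_Suc)
    fix i assume "i < n" then show "y i < y (Suc i)" using y[of i] y[of "Suc i"] by auto
  qed
  have "0 < (-1) ^ (Suc (Suc n) - Suc (Suc n)) * poly ?P 2"
    unfolding P by (rule root_poly_sign) (use x2 in \<open>auto simp: less_Suc_eq_le abs_less_iff\<close>)
  then have P2: "0 < poly ?P 2" by simp
  have "0 < (-1) ^ (Suc n - Suc n) * poly p 2"
    unfolding py by (rule root_poly_sign) (use y2 in auto)
  then have p2: "0 < poly p 2" by simp
  have Pm2: "0 < (-1) ^ (Suc (Suc n) - 0) * poly ?P (-2)"
    unfolding P by (rule root_poly_sign) (use x2 in \<open>auto simp: less_Suc_eq_le abs_less_iff minus_less_iff\<close>)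
  have pm2: "0 < (-1) ^ (Suc n - 0) * poly p (-2)"
    unfolding py by (rule root_poly_sign) (use y2 in auto)
  have "(2 + 2 * c) * poly ?P 2 = k * poly p 2"
    using step_eliminate_q[of 2 c u p q] by (simp add: k_def)
  then have "0 < (2 + 2 * c) * poly ?P 2" using k p2 by simp
  then have c1: "-1 < c" using P2 by (simp add: zero_less_mult_iff)
  have "(2 - 2 * c) * ((-1) ^ (Suc (Suc n) - 0) * poly ?P (-2)) = k * ((-1) ^ (Suc n - 0) * poly p (-2))"
  proof -
    have "(2 * c - 2) * poly ?P (-2) = k * poly p (-2)"
      using step_eliminate_q[of "-2" c u p q] by (simp add: k_def)
    then have "(-1) ^ Suc n * ((2 * c - 2) * poly ?P (-2)) = (-1) ^ Suc n * (k * poly p (-2))" by simp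
    then show ?thesis by (simp add: algebra_simps)
  qed
  moreover have "0 < k * ((-1) ^ (Suc n - 0) * poly p (-2))" using k pm2 by (rule mult_pos_pos)
  ultimately have "0 < (2 - 2 * c) * ((-1) ^ (Suc (Suc n) - 0) * poly ?P (-2))" by simp
  then have "0 < 2 - 2 * c" by (rule zero_less_mult_pos2[OF _ Pm2])
  then have c2: "c < 1" by simp
  show c: "\<bar>c\<bar> < 1" using c1 c2 by simp
  then have cc: "0 < 1 - c\<^sup>2" using abs_square_less_1[of c] by simp
  show u: "0 < u" using k cc by (simp add: k_def zero_less_mult_iff)
  have ylt: "y i < y (Suc i)" if "i < n" for i
    using strict_mono_onD[OF ym, of i "Suc i"] that by auto
  have altq: "0 < (-1) ^ (n - i) * poly (smult l q) (y i)" if i: "i \<le> n" for i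
  proof -
    have "poly p (y i) = 0" using i unfolding py by (intro poly_root_poly_root) simp
    then have e: "4 * (1 - c\<^sup>2) * poly ?P (y i) = ((y i)\<^sup>2 - 4) * poly (smult l q) (y i)"
      by (simp add: poly_stepP l_def algebra_simps)
    have "0 < (-1) ^ (Suc (Suc n) - Suc i) * poly ?P (y i)"
      unfolding P
    proof (rule root_poly_sign)
      fix j assume "j < Suc i"
      then have "x j \<le> x i" using strict_mono_on_leD[OF xm, of j i] i by auto
      then show "x j < y i" using y[of i] i by auto
    next
      fix j assume "Suc i \<le> j" "j < Suc (Suc n)"
      then have "x (Suc i) \<le> x j" using strict_mono_on_leD[OF xm, of "Suc i" j] i by auto
      then show "y i < x j" using y[of i] i by auto
    qed (use i in auto)
    then have "0 < 4 * (1 - c\<^sup>2) * ((-1) ^ (Suc (Suc n) - Suc i) * poly ?P (y i))"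
      by (rule mult_pos_pos[rotated]) (use cc in simp)
    also have "\<dots> = (-1) ^ (Suc (Suc n) - Suc i) * (((y i)\<^sup>2 - 4) * poly (smult l q) (y i))"
      unfolding e[symmetric] by (simp only: mult_ac)
    also have "\<dots> = (4 - (y i)\<^sup>2) * ((-1) ^ (n - i) * poly (smult l q) (y i))"
      using i by (simp add: Suc_diff_le algebra_simps)
    finally show ?thesis using sq4[of "y i"] y2[OF i]
      by (simp add: zero_less_mult_iff abs_less_iff)
  qed
  have "degree (smult l q) \<le> n" using q degree_smult_le[of l q] by simp
  then have "0 < coeff (smult l q) n"
    using alternating_poly_roots[OF _ ylt altq] by metis
  then have l: "0 < l" by (simp add: q)
  then show "u < 1" using cc by (simp add: l_def zero_less_mult_iff)
  have "0 < (-1) ^ (n - i) * poly q (y i)" if "i \<le> n" for i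
    using altq[OF that] l by (simp add: mult.left_commute zero_less_mult_iff)
  then show "\<exists>y. admissible n p q y"
    using ym py y2 by (auto simp: admissible_def abs_less_iff minus_less_iff intro!: exI[of _ y])
qed

text \<open>The product is the resultant of \<open>P\<close> and \<open>Q\<close>. At the roots of \<open>P\<close> one replaces \<open>Q\<close> by \<open>p\<close>; the product of
  \<open>\<bar>p(x\<^sub>i)\<bar>\<close> over the roots of \<open>P\<close> equals the product of \<open>\<bar>P(y\<^sub>j)\<bar>\<close> over the roots of \<open>p\<close>; and there one
  replaces \<open>P\<close> by \<open>q\<close>. The factors \<open>4 - x\<^sub>i\<^sup>2\<close> and \<open>4 - y\<^sub>j\<^sup>2\<close> are collected into values at \<open>2\<close> and \<open>-2\<close>.\<close>

lemma step_weight: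
  assumes u: "0 < u" "u < 1" and c: "\<bar>c\<bar> < 1" and y: "admissible n p q y"
    and x: "admissible (Suc n) (stepP u c p q) (stepQ u c p q) x"
  shows "(\<Prod>i<Suc (Suc n). \<bar>poly (stepQ u c p q) (x i)\<bar>)
    = 4 ^ Suc n * u ^ n * ((1 - u) * (1 - c\<^sup>2)) ^ Suc n * (\<Prod>i<Suc n. \<bar>poly q (y i)\<bar>)"
proof -
  let ?P = "stepP u c p q" and ?Q = "stepQ u c p q"
  have p: "p = root_poly (Suc n) y" and P: "?P = root_poly (Suc (Suc n)) x"
    and x2: "\<And>i. i < Suc (Suc n) \<Longrightarrow> \<bar>x i\<bar> < 2" and y2: "\<And>i. i < Suc n \<Longrightarrow> \<bar>y i\<bar> < 2"
    using x y unfolding admissible_def less_Suc_eq_le by blast+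
  have sq4: "t\<^sup>2 < 4" if "\<bar>t\<bar> < 2" for t :: real
    using that abs_square_less_1[of "t / 2"] by (simp add: power_divide)
  have cc: "0 < 1 - c\<^sup>2" using c abs_square_less_1[of c] by simp
  have pair4: "\<bar>2 - t\<bar> * \<bar>- 2 - t\<bar> = 4 - t\<^sup>2" if "\<bar>t\<bar> < 2" for t :: real
  proof -
    have "\<bar>2 - t\<bar> * \<bar>- 2 - t\<bar> = (2 - t) * (2 + t)" using that by (simp add: abs_less_iff)
    then show ?thesis by (simp add: algebra_simps power2_eq_square)
  qed
  define A where "A = (\<Prod>i<Suc (Suc n). \<bar>poly p (x i)\<bar>)"
  have P4: "\<bar>poly ?P 2 * poly ?P (-2)\<bar> = (\<Prod>i<Suc (Suc n). 4 - (x i)\<^sup>2)"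
    unfolding P poly_root_poly abs_mult abs_prod prod.distrib[symmetric]
    by (intro prod.cong refl pair4 x2) simp
  have p4: "\<bar>poly p 2 * poly p (-2)\<bar> = (\<Prod>i<Suc n. 4 - (y i)\<^sup>2)"
    unfolding p poly_root_poly abs_mult abs_prod prod.distrib[symmetric]
    by (intro prod.cong refl pair4 y2) simp
  have p4pos: "0 < \<bar>poly p 2 * poly p (-2)\<bar>" unfolding p4 using sq4 y2 by (intro prod_pos) auto
  have Pp: "\<bar>poly ?P 2 * poly ?P (-2)\<bar> = 4 * u\<^sup>2 * (1 - c\<^sup>2) * \<bar>poly p 2 * poly p (-2)\<bar>"
  proof -
    have "poly ?P 2 * poly ?P (-2) = - (4 * u\<^sup>2 * (1 - c\<^sup>2)) * (poly p 2 * poly p (-2))"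
      by (simp add: poly_stepP algebra_simps power2_eq_square)
    then show ?thesis using cc by (simp add: abs_mult)
  qed
  have "(\<Prod>i<Suc (Suc n). 4 - (x i)\<^sup>2) * (\<Prod>i<Suc (Suc n). \<bar>poly ?Q (x i)\<bar>)
      = (\<Prod>i<Suc (Suc n). 4 * u * (1 - c\<^sup>2) * \<bar>poly p (x i)\<bar>)"
    unfolding prod.distrib[symmetric]
  proof (intro prod.cong refl)
    fix i assume i: "i \<in> {..<Suc (Suc n)}"
    then have "poly ?P (x i) = 0" unfolding P by (intro poly_root_poly_root) simp
    then have "(4 - (x i)\<^sup>2) * poly ?Q (x i) = 4 * u * (1 - c\<^sup>2) * poly p (x i)"
      using step_eliminate_q[of "x i" c u p q] by (simp add: algebra_simps)
    then have "\<bar>(4 - (x i)\<^sup>2) * poly ?Q (x i)\<bar> = \<bar>4 * u * (1 - c\<^sup>2) * poly p (x i)\<bar>" by simp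
    then show "(4 - (x i)\<^sup>2) * \<bar>poly ?Q (x i)\<bar> = 4 * u * (1 - c\<^sup>2) * \<bar>poly p (x i)\<bar>"
      using u cc sq4[OF x2[of i]] i by (simp add: abs_mult)
  qed
  then have e1: "\<bar>poly ?P 2 * poly ?P (-2)\<bar> * (\<Prod>i<Suc (Suc n). \<bar>poly ?Q (x i)\<bar>)
      = (4 * u * (1 - c\<^sup>2)) ^ Suc (Suc n) * A"
    by (simp add: P4 A_def prod.distrib del: prod.lessThan_Suc power_Suc)
  have "A = (\<Prod>i<Suc (Suc n). \<Prod>j<Suc n. \<bar>x i - y j\<bar>)"
    by (simp add: A_def p poly_root_poly abs_prod del: prod.lessThan_Suc)
  also have "\<dots> = (\<Prod>j<Suc n. \<Prod>i<Suc (Suc n). \<bar>x i - y j\<bar>)" by (rule prod.swap)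
  also have "\<dots> = (\<Prod>j<Suc n. \<bar>poly ?P (y j)\<bar>)"
    by (simp add: P poly_root_poly abs_prod abs_minus_commute del: prod.lessThan_Suc)
  also have "\<dots> = (\<Prod>j<Suc n. (1 - u) * (4 - (y j)\<^sup>2) * \<bar>poly q (y j)\<bar>)"
  proof (intro prod.cong refl)
    fix j assume j: "j \<in> {..<Suc n}"
    then have "poly p (y j) = 0" unfolding p by (intro poly_root_poly_root) simp
    then have "\<bar>poly ?P (y j)\<bar> = (1 - u) * \<bar>(y j)\<^sup>2 - 4\<bar> * \<bar>poly q (y j)\<bar>"
      using u by (simp add: poly_stepP abs_mult)
    also have "\<bar>(y j)\<^sup>2 - 4\<bar> = 4 - (y j)\<^sup>2" using sq4[OF y2[of j]] j by auto
    finally show "\<bar>poly ?P (y j)\<bar> = (1 - u) * (4 - (y j)\<^sup>2) * \<bar>poly q (y j)\<bar>" .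
  qed
  also have "\<dots> = (1 - u) ^ Suc n * \<bar>poly p 2 * poly p (-2)\<bar> * (\<Prod>j<Suc n. \<bar>poly q (y j)\<bar>)"
    by (simp add: prod.distrib p4 del: prod.lessThan_Suc power_Suc)
  finally have A: "A = (1 - u) ^ Suc n * \<bar>poly p 2 * poly p (-2)\<bar> * (\<Prod>j<Suc n. \<bar>poly q (y j)\<bar>)" .
  have "(4 * u\<^sup>2 * (1 - c\<^sup>2) * \<bar>poly p 2 * poly p (-2)\<bar>) * (\<Prod>i<Suc (Suc n). \<bar>poly ?Q (x i)\<bar>)
    = (4 * u\<^sup>2 * (1 - c\<^sup>2) * \<bar>poly p 2 * poly p (-2)\<bar>) * (4 ^ Suc n * u ^ n * ((1 - u) * (1 - c\<^sup>2)) ^ Suc n * (\<Prod>i<Suc n. \<bar>poly q (y i)\<bar>))"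
  proof -
    have "(4 * u * X) ^ Suc (Suc n) * ((1 - u) ^ Suc n * d * r)
        = (4 * u\<^sup>2 * X * d) * (4 ^ Suc n * u ^ n * ((1 - u) * X) ^ Suc n * r)" for X d r :: real
      by (simp add: power_mult_distrib power2_eq_square mult_ac)
    then show ?thesis unfolding Pp[symmetric] e1 unfolding A Pp .
  qed
  moreover have "4 * u\<^sup>2 * (1 - c\<^sup>2) * \<bar>poly p 2 * poly p (-2)\<bar> \<noteq> 0"
    using p4pos u cc by auto
  ultimately show ?thesis by (metis mult_left_cancel)
qed

section \<open>Changes of variables in coordinate space\<close>

text \<open>Translates the change of variables theorem for absolutely integrable functions into a
  statement about \<open>[0, \<infinity>]\<close>-valued integrals.\<close>

lemma absolutely_integrable_iff_nn_integral:
  fixes g :: "real \<Rightarrow> real"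
  assumes [measurable]: "T \<in> sets borel" "g \<in> borel_measurable borel" and g: "\<And>x. x \<in> T \<Longrightarrow> 0 \<le> g x"
  shows "g absolutely_integrable_on T \<and> integral T g = r \<longleftrightarrow>
    (\<integral>\<^sup>+x. ennreal (g x) * indicator T x \<partial>lborel) = ennreal r \<and> 0 \<le> r"
proof
  assume a: "g absolutely_integrable_on T \<and> integral T g = r"
  then have h: "(g has_integral r) T"
    by (auto simp: absolutely_integrable_on_def has_integral_iff)
  show "(\<integral>\<^sup>+x. ennreal (g x) * indicator T x \<partial>lborel) = ennreal r \<and> 0 \<le> r"
    using nn_integral_has_integral_lebesgue'[OF g h] has_integral_nonneg[OF h g] by auto
next
  assume a: "(\<integral>\<^sup>+x. ennreal (g x) * indicator T x \<partial>lborel) = ennreal r \<and> 0 \<le> r"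
  have "((\<lambda>x. if x \<in> T then g x else 0) has_integral r) UNIV"
  proof (rule nn_integral_has_integral)
    have "(\<integral>\<^sup>+x. ennreal (if x \<in> T then g x else 0) \<partial>lborel) = (\<integral>\<^sup>+x. ennreal (g x) * indicator T x \<partial>lborel)"
      by (intro nn_integral_cong) auto
    then show "(\<integral>\<^sup>+x. ennreal (if x \<in> T then g x else 0) \<partial>lborel) = ennreal r"
      using a by simp
  qed (use a g in auto)
  then have h: "(g has_integral r) T" by (simp add: has_integral_restrict_UNIV)
  then show "g absolutely_integrable_on T \<and> integral T g = r"
    using g by (auto intro!: nonnegative_absolutely_integrable_1 simp: has_integral_iff)
qed

text \<open>It suffices to compare two measures on Borel sets, that is, to treat \<open>\<phi> = 1\<close> on a smaller set. There the
  theorem for absolutely integrable functions says that one side is a given real number if and only if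
  the other is, so both are infinite together.\<close>

lemma nn_integral_substitution_inj:
  fixes h h' :: "real \<Rightarrow> real" and \<phi> :: "real \<Rightarrow> ennreal"
  assumes S[measurable]: "S \<in> sets borel" and hS[measurable]: "h ` S \<in> sets borel"
    and der: "\<And>t. (h has_field_derivative h' t) (at t)" and h'[measurable]: "h' \<in> borel_measurable borel"
    and inj: "inj_on h S" and \<phi>[measurable]: "\<phi> \<in> borel_measurable borel"
  shows "(\<integral>\<^sup>+t. \<phi> (h t) * ennreal \<bar>h' t\<bar> * indicator S t \<partial>lborel) = (\<integral>\<^sup>+y. \<phi> y * indicator (h ` S) y \<partial>lborel)"
proof -
  have "continuous_on UNIV h"
    using der by (intro DERIV_continuous_on) (auto intro: has_field_derivative_at_within)
  then have [measurable]: "h \<in> borel_measurable borel" by (rule borel_measurable_continuous_onI)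
  let ?D = "density lborel (\<lambda>t. ennreal \<bar>h' t\<bar> * indicator S t)"
  have eq: "distr ?D borel h = density lborel (indicator (h ` S))"
  proof (rule measure_eqI)
    fix A assume "A \<in> sets (distr ?D borel h)"
    then have A[measurable]: "A \<in> sets borel" by simp
    let ?T = "S \<inter> h -` A"
    have vA: "h -` A \<in> sets borel" using measurable_sets[of h borel borel A] by simp
    have T[measurable]: "?T \<in> sets borel" using vA by (rule sets.Int[OF S])
    have hT: "h ` ?T = h ` S \<inter> A" by auto
    have T'[measurable]: "h ` ?T \<in> sets borel" unfolding hT by measurable
    have "emeasure (distr ?D borel h) A = (\<integral>\<^sup>+t. ennreal \<bar>h' t\<bar> * indicator S t * indicator (h -` A) t \<partial>lborel)"
      using vA by (simp add: emeasure_distr emeasure_density)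
    also have "\<dots> = (\<integral>\<^sup>+t. ennreal \<bar>h' t\<bar> * indicator ?T t \<partial>lborel)"
      by (intro nn_integral_cong) (auto simp: indicator_def)
    finally have 1: "emeasure (distr ?D borel h) A = (\<integral>\<^sup>+t. ennreal \<bar>h' t\<bar> * indicator ?T t \<partial>lborel)" .
    have "emeasure (density lborel (indicator (h ` S))) A = (\<integral>\<^sup>+t. ennreal 1 * indicator (h ` ?T) t \<partial>lborel)"
      unfolding hT by (subst emeasure_density) (auto intro!: nn_integral_cong simp: indicator_def)
    then have 2: "emeasure (density lborel (indicator (h ` S))) A = (\<integral>\<^sup>+t. ennreal 1 * indicator (h ` ?T) t \<partial>lborel)" .
    have cv: "(\<lambda>x. \<bar>h' x\<bar> * 1) absolutely_integrable_on ?T \<and> integral ?T (\<lambda>x. \<bar>h' x\<bar> * 1) = r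
        \<longleftrightarrow> (\<lambda>_. 1::real) absolutely_integrable_on (h ` ?T) \<and> integral (h ` ?T) (\<lambda>_. 1::real) = r" for r
    proof (rule has_absolute_integral_change_of_variables_1')
      show "?T \<in> sets lebesgue" using T by simp
      show "inj_on h ?T" using inj by (rule inj_on_subset) simp
    qed (rule has_field_derivative_at_within[OF der])
    have iff: "(\<integral>\<^sup>+t. ennreal \<bar>h' t\<bar> * indicator ?T t \<partial>lborel) = ennreal r
        \<longleftrightarrow> (\<integral>\<^sup>+t. ennreal 1 * indicator (h ` ?T) t \<partial>lborel) = ennreal r" if "0 \<le> r" for r
    proof -
      have "(\<lambda>x. \<bar>h' x\<bar> * 1) absolutely_integrable_on ?T \<and> integral ?T (\<lambda>x. \<bar>h' x\<bar> * 1) = r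
         \<longleftrightarrow> (\<integral>\<^sup>+t. ennreal (\<bar>h' t\<bar> * 1) * indicator ?T t \<partial>lborel) = ennreal r \<and> 0 \<le> r"
        by (rule absolutely_integrable_iff_nn_integral) auto
      moreover have "(\<lambda>_. 1::real) absolutely_integrable_on (h ` ?T) \<and> integral (h ` ?T) (\<lambda>_. 1::real) = r
         \<longleftrightarrow> (\<integral>\<^sup>+t. ennreal 1 * indicator (h ` ?T) t \<partial>lborel) = ennreal r \<and> 0 \<le> r"
        by (rule absolutely_integrable_iff_nn_integral) (use T' in auto)
      ultimately show ?thesis using that cv by simp
    qed
    show "emeasure (distr ?D borel h) A = emeasure (density lborel (indicator (h ` S))) A"
      unfolding 1 2
    proof (cases "\<integral>\<^sup>+t. ennreal \<bar>h' t\<bar> * indicator ?T t \<partial>lborel" rule: ennreal_cases)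
      case (real r)
      then show "(\<integral>\<^sup>+t. ennreal \<bar>h' t\<bar> * indicator ?T t \<partial>lborel) = (\<integral>\<^sup>+t. ennreal 1 * indicator (h ` ?T) t \<partial>lborel)"
        using iff[of r] by simp
    next
      case top
      show "(\<integral>\<^sup>+t. ennreal \<bar>h' t\<bar> * indicator ?T t \<partial>lborel) = (\<integral>\<^sup>+t. ennreal 1 * indicator (h ` ?T) t \<partial>lborel)"
      proof (cases "\<integral>\<^sup>+t. ennreal 1 * indicator (h ` ?T) t \<partial>lborel" rule: ennreal_cases)
        case (real r)
        then show ?thesis using iff[of r] by simp
      qed (use top in simp)
    qed
  qed simp
  have "(\<integral>\<^sup>+t. \<phi> (h t) * ennreal \<bar>h' t\<bar> * indicator S t \<partial>lborel) = (\<integral>\<^sup>+y. \<phi> y \<partial>distr ?D borel h)"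
    by (simp add: nn_integral_distr nn_integral_density mult_ac)
  also have "\<dots> = (\<integral>\<^sup>+y. \<phi> y * indicator (h ` S) y \<partial>lborel)"
    unfolding eq by (simp add: nn_integral_density mult.commute)
  finally show ?thesis .
qed

interpretation lborel_product: product_sigma_finite "\<lambda>_::nat. lborel :: real measure"
  by standard

abbreviation coords :: "nat \<Rightarrow> (nat \<Rightarrow> real) measure" where
  "coords n \<equiv> Pi\<^sub>M {..<n} (\<lambda>_. lborel)"

lemma sigma_finite_coords: "sigma_finite_measure (coords n)"
  by (rule lborel_product.sigma_finite) simp

lemma nn_integral_coords_swap:
  assumes "case_prod f \<in> borel_measurable (M1 \<Otimes>\<^sub>M M2)" "sigma_finite_measure M1" "sigma_finite_measure M2"
  shows "(\<integral>\<^sup>+y. (\<integral>\<^sup>+x. f x y \<partial>M1) \<partial>M2) = (\<integral>\<^sup>+x. (\<integral>\<^sup>+y. f x y \<partial>M2) \<partial>M1)"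
  using assms by (intro pair_sigma_finite.Fubini' pair_sigma_finite.intro)

lemma measurable_upd_coord [measurable (raw)]:
  assumes "f \<in> N \<rightarrow>\<^sub>M coords n" "h \<in> borel_measurable N"
  shows "(\<lambda>x. (f x)(n := h x)) \<in> N \<rightarrow>\<^sub>M coords (Suc n)"
  using assms by (intro measurable_fun_upd[where J="{..<n}"]) (auto simp: lessThan_Suc)

lemma measurable_coord_app:
  "f \<in> N \<rightarrow>\<^sub>M coords n \<Longrightarrow> i < n \<Longrightarrow> (\<lambda>x. f x i) \<in> borel_measurable N"
  by (drule measurable_compose[OF _ measurable_component_singleton[of i "{..<n}" "\<lambda>_. lborel"]]) simp_all

lemma nn_integral_coords_0: "(\<integral>\<^sup>+x. f x \<partial>coords 0) = f (\<lambda>_. undefined)"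
  by (simp add: PiM_empty nn_integral_count_space_finite max.absorb2)

lemma nn_integral_coords_Suc:
  assumes "f \<in> borel_measurable (coords (Suc n))"
  shows "(\<integral>\<^sup>+x. f x \<partial>coords (Suc n)) = (\<integral>\<^sup>+x. (\<integral>\<^sup>+y. f (x(n := y)) \<partial>lborel) \<partial>coords n)"
  using assms unfolding lessThan_Suc by (intro lborel_product.product_nn_integral_insert) auto

lemma nn_integral_coords_Suc_rev:
  assumes "f \<in> borel_measurable (coords (Suc n))"
  shows "(\<integral>\<^sup>+x. f x \<partial>coords (Suc n)) = (\<integral>\<^sup>+y. (\<integral>\<^sup>+x. f (x(n := y)) \<partial>coords n) \<partial>lborel)"
  using assms unfolding lessThan_Suc by (intro lborel_product.product_nn_integral_insert_rev) auto

lemma measurable_pred_coord: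
  "i < n \<Longrightarrow> (\<lambda>x. if i = 0 then s else x (i - 1)) \<in> borel_measurable (coords n)"
  by (cases i) auto

lemma nn_integral_coords_affine:
  assumes "f \<in> borel_measurable (coords n)" "s \<noteq> 0"
  shows "ennreal (\<bar>s\<bar> ^ n) * (\<integral>\<^sup>+c. f (\<lambda>i\<in>{..<n}. e i + s * c i) \<partial>coords n) = (\<integral>\<^sup>+c. f c \<partial>coords n)"
  using assms(1)
proof (induction n arbitrary: f)
  case 0
  have "(\<lambda>i\<in>{..<0::nat}. e i + s * undefined) = (\<lambda>_. undefined)" by auto
  then show ?case unfolding nn_integral_coords_0 by simp
next
  case (Suc n)
  note [measurable] = Suc.prems
  define g where "g x = (\<integral>\<^sup>+y. f (x(n := y)) \<partial>lborel)" for x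
  have gm[measurable]: "g \<in> borel_measurable (coords n)" unfolding g_def by measurable
  have "(\<integral>\<^sup>+c. f (\<lambda>i\<in>{..<Suc n}. e i + s * c i) \<partial>coords (Suc n))
    = (\<integral>\<^sup>+x. (\<integral>\<^sup>+y. f (\<lambda>i\<in>{..<Suc n}. e i + s * (x(n := y)) i) \<partial>lborel) \<partial>coords n)"
    by (rule nn_integral_coords_Suc) measurable
  also have "\<dots> = (\<integral>\<^sup>+x. (\<integral>\<^sup>+y. f ((\<lambda>i\<in>{..<n}. e i + s * x i)(n := e n + s * y)) \<partial>lborel) \<partial>coords n)"
    by (intro nn_integral_cong arg_cong[where f=f]) auto
  finally have 1: "(\<integral>\<^sup>+c. f (\<lambda>i\<in>{..<Suc n}. e i + s * c i) \<partial>coords (Suc n))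
    = (\<integral>\<^sup>+x. (\<integral>\<^sup>+y. f ((\<lambda>i\<in>{..<n}. e i + s * x i)(n := e n + s * y)) \<partial>lborel) \<partial>coords n)" .
  have 2: "ennreal \<bar>s\<bar> * (\<integral>\<^sup>+y. f (z(n := e n + s * y)) \<partial>lborel) = g z" if "z \<in> space (coords n)" for z
    unfolding g_def using that by (intro nn_integral_real_affine[symmetric] assms) measurable
  have "ennreal \<bar>s\<bar> * (\<integral>\<^sup>+c. f (\<lambda>i\<in>{..<Suc n}. e i + s * c i) \<partial>coords (Suc n))
    = (\<integral>\<^sup>+x. ennreal \<bar>s\<bar> * (\<integral>\<^sup>+y. f ((\<lambda>i\<in>{..<n}. e i + s * x i)(n := e n + s * y)) \<partial>lborel) \<partial>coords n)"
    unfolding 1 by (subst nn_integral_cmult) measurable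
  also have "\<dots> = (\<integral>\<^sup>+x. g (\<lambda>i\<in>{..<n}. e i + s * x i) \<partial>coords n)"
    by (intro nn_integral_cong 2) (simp add: space_PiM)
  finally have 3: "ennreal (\<bar>s\<bar> ^ n) * (ennreal \<bar>s\<bar> * (\<integral>\<^sup>+c. f (\<lambda>i\<in>{..<Suc n}. e i + s * c i) \<partial>coords (Suc n))) = (\<integral>\<^sup>+c. g c \<partial>coords n)"
    by (simp only: Suc.IH[OF gm])
  have "ennreal (\<bar>s\<bar> ^ Suc n) = ennreal (\<bar>s\<bar> ^ n) * ennreal \<bar>s\<bar>"
    by (simp add: ennreal_mult[symmetric] mult.commute)
  then show ?case
    unfolding nn_integral_coords_Suc[OF Suc.prems] using 3 unfolding g_def by (simp only: mult.assoc)
qed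

text \<open>Every coordinate is translated by an amount that depends on earlier coordinates only, so
  Lebesgue measure is preserved, by integrating the last coordinate first.\<close>

lemma nn_integral_coords_shear:
  assumes "f \<in> borel_measurable (coords n)"
  shows "(\<integral>\<^sup>+c. f (\<lambda>i\<in>{..<n}. c i - t * (if i = 0 then s else c (i - 1)) + e i) \<partial>coords n) = (\<integral>\<^sup>+c. f c \<partial>coords n)"
  using assms(1)
proof (induction n arbitrary: f)
  case 0
  have "(\<lambda>i\<in>{..<0::nat}. undefined - t * (if i = 0 then s else undefined) + e i) = (\<lambda>_. undefined)" by auto
  then show ?case unfolding nn_integral_coords_0 by simp
next
  case (Suc n)
  note [measurable] = Suc.prems
  note [measurable] = measurable_pred_coord
  define g where "g x = (\<integral>\<^sup>+y. f (x(n := y)) \<partial>lborel)" for x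
  have gm[measurable]: "g \<in> borel_measurable (coords n)" unfolding g_def by measurable
  have m: "(\<lambda>c. \<lambda>i\<in>{..<Suc n}. c i - t * (if i = 0 then s else c (i - 1)) + e i) \<in> coords (Suc n) \<rightarrow>\<^sub>M coords (Suc n)"
    by (rule measurable_restrict) (simp; measurable)
  have "(\<integral>\<^sup>+c. f (\<lambda>i\<in>{..<Suc n}. c i - t * (if i = 0 then s else c (i - 1)) + e i) \<partial>coords (Suc n))
    = (\<integral>\<^sup>+x. (\<integral>\<^sup>+y. f (\<lambda>i\<in>{..<Suc n}. (x(n := y)) i - t * (if i = 0 then s else (x(n := y)) (i - 1)) + e i) \<partial>lborel) \<partial>coords n)"
    by (rule nn_integral_coords_Suc) (rule measurable_compose[OF m Suc.prems])
  also have "\<dots> = (\<integral>\<^sup>+x. g (\<lambda>i\<in>{..<n}. x i - t * (if i = 0 then s else x (i - 1)) + e i) \<partial>coords n)"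
  proof (intro nn_integral_cong)
    fix x assume x: "x \<in> space (coords n)"
    define z where "z = (\<lambda>i\<in>{..<n}. x i - t * (if i = 0 then s else x (i - 1)) + e i)"
    define a where "a = e n - t * (if n = 0 then s else x (n - 1))"
    have z: "z \<in> space (coords n)" by (simp add: z_def space_PiM)
    have "(\<integral>\<^sup>+y. f (\<lambda>i\<in>{..<Suc n}. (x(n := y)) i - t * (if i = 0 then s else (x(n := y)) (i - 1)) + e i) \<partial>lborel)
       = (\<integral>\<^sup>+y. f (z(n := a + 1 * y)) \<partial>lborel)"
      by (intro nn_integral_cong arg_cong[where f=f]) (auto simp: z_def a_def fun_eq_iff)
    also have "\<dots> = g z"
      unfolding g_def using nn_integral_real_affine[of "\<lambda>y. f (z(n := y))" 1 a] z by simp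
    finally show "(\<integral>\<^sup>+y. f (\<lambda>i\<in>{..<Suc n}. (x(n := y)) i - t * (if i = 0 then s else (x(n := y)) (i - 1)) + e i) \<partial>lborel) = g z" .
  qed
  also have "\<dots> = (\<integral>\<^sup>+c. g c \<partial>coords n)" by (rule Suc.IH[OF gm])
  also have "\<dots> = (\<integral>\<^sup>+c. f c \<partial>coords (Suc n))" unfolding g_def by (rule nn_integral_coords_Suc[OF Suc.prems, symmetric])
  finally show ?case .
qed

text \<open>A step adds new leading coefficients, which stand in front, whereas product measures are
  split at the last coordinate; prepending a coordinate is therefore treated separately.\<close>

definition cons_coord :: "nat \<Rightarrow> real \<Rightarrow> (nat \<Rightarrow> real) \<Rightarrow> nat \<Rightarrow> real" where
  "cons_coord n y x = (\<lambda>i\<in>{..<Suc n}. if i = 0 then y else x (i - 1))"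

lemma measurable_cons_coord [measurable (raw)]:
  assumes [measurable]: "h \<in> borel_measurable N" "f \<in> N \<rightarrow>\<^sub>M coords n"
  shows "(\<lambda>x. cons_coord n (h x) (f x)) \<in> N \<rightarrow>\<^sub>M coords (Suc n)"
  unfolding cons_coord_def
proof (rule measurable_restrict)
  fix i assume "i \<in> {..<Suc n}"
  then show "(\<lambda>x. if i = 0 then h x else f x (i - 1)) \<in> N \<rightarrow>\<^sub>M lborel"
    using measurable_coord_app[OF assms(2), of "i - 1"] assms(1) by (cases i) auto
qed

lemma nn_integral_coords_cons:
  assumes "f \<in> borel_measurable (coords (Suc n))"
  shows "(\<integral>\<^sup>+c. f c \<partial>coords (Suc n)) = (\<integral>\<^sup>+y. (\<integral>\<^sup>+x. f (cons_coord n y x) \<partial>coords n) \<partial>lborel)"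
  using assms
proof (induction n arbitrary: f)
  case 0
  have "(\<lambda>_. undefined)(0 := y) = cons_coord 0 y (\<lambda>_. undefined)" for y
    by (auto simp: cons_coord_def)
  then show ?case unfolding nn_integral_coords_Suc[OF 0] nn_integral_coords_0 by simp
next
  case (Suc n)
  note [measurable] = Suc.prems
  have "(\<integral>\<^sup>+c. f c \<partial>coords (Suc (Suc n))) = (\<integral>\<^sup>+x. (\<integral>\<^sup>+z. f (x(Suc n := z)) \<partial>lborel) \<partial>coords (Suc n))"
    by (rule nn_integral_coords_Suc[OF Suc.prems])
  also have "\<dots> = (\<integral>\<^sup>+y. (\<integral>\<^sup>+x. (\<integral>\<^sup>+z. f ((cons_coord n y x)(Suc n := z)) \<partial>lborel) \<partial>coords n) \<partial>lborel)"
    by (rule Suc.IH) measurable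
  also have "\<dots> = (\<integral>\<^sup>+y. (\<integral>\<^sup>+x. (\<integral>\<^sup>+z. f (cons_coord (Suc n) y (x(n := z))) \<partial>lborel) \<partial>coords n) \<partial>lborel)"
    by (intro nn_integral_cong arg_cong[where f=f]) (auto simp: cons_coord_def fun_eq_iff)
  also have "\<dots> = (\<integral>\<^sup>+y. (\<integral>\<^sup>+x. f (cons_coord (Suc n) y x) \<partial>coords (Suc n)) \<partial>lborel)"
    by (intro nn_integral_cong nn_integral_coords_Suc[symmetric]) measurable
  finally show ?case .
qed

section \<open>Measurability of sorted roots\<close>

definition sorted_root :: "real poly \<Rightarrow> nat \<Rightarrow> real" where
  "sorted_root p i = sorted_list_of_multiset (proots p) ! i"

lemma proots_root_poly: "proots (root_poly n x) = mset (map x [0..<n])"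
proof (induction n)
  case 0
  then show ?case by (simp add: root_poly_def)
next
  case (Suc n)
  have "proots (root_poly (Suc n) x) = proots [:- x n, 1:] + proots (root_poly n x)"
    unfolding root_poly_Suc by (rule proots_mult) (auto simp: root_poly_nz)
  then show ?case using Suc by simp
qed

lemma root_poly_eq_prod_list: "root_poly (length xs) (\<lambda>i. xs ! i) = (\<Prod>x\<leftarrow>xs. [:- x, 1:])"
proof (induction xs rule: rev_induct)
  case Nil
  then show ?case by (simp add: root_poly_def)
next
  case (snoc y xs)
  have "root_poly (length (xs @ [y])) (\<lambda>i. (xs @ [y]) ! i) = [:- y, 1:] * root_poly (length xs) (\<lambda>i. (xs @ [y]) ! i)"
    by (simp add: root_poly_Suc)
  also have "root_poly (length xs) (\<lambda>i. (xs @ [y]) ! i) = root_poly (length xs) (\<lambda>i. xs ! i)"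
    by (rule root_poly_cong) (simp add: nth_append)
  finally show ?case using snoc by (simp add: mult.commute)
qed

lemma sorted_root_root_poly:
  assumes "strict_mono_on {..<n} x" "i < n"
  shows "sorted_root (root_poly n x) i = x i"
proof -
  have "sorted (map x [0..<n])"
    unfolding sorted_map by (rule sorted_wrt_mono_rel[of _ "(<)"])
      (use strict_mono_onD[OF assms(1)] in \<open>auto simp: less_imp_le\<close>)
  then have "sort (map x [0..<n]) = map x [0..<n]" by (rule sorted_sort_id)
  then show ?thesis using assms(2)
    unfolding sorted_root_def proots_root_poly sorted_list_of_multiset_mset by simp
qed

lemma prod_linear_dvd_of_subset_proots:
  fixes p :: "real poly"
  assumes "p \<noteq> 0" "A \<subseteq># proots p"
  shows "(\<Prod>x\<in>#A. [:- x, 1:]) dvd p"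
  using assms
proof (induction A arbitrary: p)
  case (add a A)
  have "a \<in># proots p" using add.prems by (meson insert_subset_eq_iff)
  then have "poly p a = 0" using add.prems by simp
  then obtain q where q: "p = [:- a, 1:] * q" by (auto simp: poly_eq_0_iff_dvd)
  with add.prems have q0: "q \<noteq> 0" by auto
  have "proots p = proots [:- a, 1:] + proots q" unfolding q using q0 by (intro proots_mult) auto
  then have "A \<subseteq># proots q" using add.prems by simp
  then have "(\<Prod>x\<in>#A. [:- x, 1:]) dvd q" using add.IH q0 by blast
  then show ?case unfolding q by (simp only: image_mset_add_mset prod_mset.add_mset) (rule mult_dvd_mono[OF dvd_refl])
qed simp

text \<open>The order statistics of the real roots are expressed by divisibility, which can be written as a
  continuous image of a closed set of roots and cofactors.\<close>

lemma sorted_nth_le_iff_root_poly_dvd: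
  fixes p :: "real poly"
  assumes "p \<noteq> 0"
  shows "i < size (proots p) \<and> sorted_root p i \<le> t \<longleftrightarrow> (\<exists>x. (\<forall>j<Suc i. x j \<le> t) \<and> root_poly (Suc i) x dvd p)"
proof
  let ?l = "sorted_list_of_multiset (proots p)"
  have len: "length ?l = size (proots p)" by (metis mset_sorted_list_of_multiset size_mset)
  {
    assume a: "i < size (proots p) \<and> sorted_root p i \<le> t"
    let ?x = "\<lambda>j. take (Suc i) ?l ! j"
    have lt: "length (take (Suc i) ?l) = Suc i" using a len by simp
    have "mset (take (Suc i) ?l) \<subseteq># mset (take (Suc i) ?l @ drop (Suc i) ?l)"
      unfolding mset_append by simp
    then have "mset (take (Suc i) ?l) \<subseteq># proots p" by simp
    then have "(\<Prod>x\<in>#mset (take (Suc i) ?l). [:- x, 1:]) dvd p"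
      using assms by (intro prod_linear_dvd_of_subset_proots)
    then have "root_poly (Suc i) ?x dvd p"
      using root_poly_eq_prod_list[of "take (Suc i) ?l"] unfolding lt
      by (metis mset_map prod_mset_prod_list)
    moreover have "?x j \<le> t" if "j < Suc i" for j
    proof -
      have "?l ! j \<le> ?l ! i" using that a len by (intro sorted_nth_mono) auto
      then show ?thesis using that a by (simp add: sorted_root_def)
    qed
    ultimately show "\<exists>x. (\<forall>j<Suc i. x j \<le> t) \<and> root_poly (Suc i) x dvd p" by blast
  }
  {
    assume "\<exists>x. (\<forall>j<Suc i. x j \<le> t) \<and> root_poly (Suc i) x dvd p"
    then obtain x where x: "\<And>j. j < Suc i \<Longrightarrow> x j \<le> t" and d: "root_poly (Suc i) x dvd p" by blast
    from d obtain q where q: "p = root_poly (Suc i) x * q" by (elim dvdE)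
    have "proots p = proots (root_poly (Suc i) x) + proots q" unfolding q
      using assms q by (intro proots_mult) auto
    then have pr: "proots p = mset (map x [0..<Suc i]) + proots q" by (simp only: proots_root_poly)
    have s: "i < size (proots p)" unfolding pr by simp
    have "filter_mset (\<lambda>y. y \<le> t) (mset (map x [0..<Suc i])) = mset (map x [0..<Suc i])"
      unfolding filter_mset_eq_conv using x by auto
    then have "size (filter_mset (\<lambda>y. y \<le> t) (mset (map x [0..<Suc i]))) = Suc i" by (simp only: size_mset) simp
    then have c: "Suc i \<le> size (filter_mset (\<lambda>y. y \<le> t) (proots p))"
      unfolding pr filter_union_mset size_union by linarith
    have "sorted_root p i \<le> t"
    proof (rule ccontr)
      assume n: "\<not> sorted_root p i \<le> t"
      have "filter (\<lambda>y. y \<le> t) (drop i ?l) = []"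
      proof (rule filter_False, rule ballI)
        fix y assume "y \<in> set (drop i ?l)"
        then obtain j where "j < length ?l - i" "y = ?l ! (i + j)" by (auto simp: in_set_conv_nth)
        moreover have "?l ! i \<le> ?l ! (i + j)" if "j < length ?l - i" for j using that by (intro sorted_nth_mono) auto
        ultimately show "\<not> y \<le> t" using n by (force simp: sorted_root_def)
      qed
      then have "filter (\<lambda>y. y \<le> t) (take i ?l @ drop i ?l) = filter (\<lambda>y. y \<le> t) (take i ?l)"
        unfolding filter_append by simp
      then have "length (filter (\<lambda>y. y \<le> t) ?l) \<le> i"
        by (simp add: le_trans[OF length_filter_le])
      moreover have "size (filter_mset (\<lambda>y. y \<le> t) (proots p)) = length (filter (\<lambda>y. y \<le> t) ?l)"
        by (metis mset_filter mset_sorted_list_of_multiset size_mset)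
      ultimately show False using c by simp
    qed
    with s show "i < size (proots p) \<and> sorted_root p i \<le> t" by simp
  }
qed

lemma continuous_on_coeff_mult:
  fixes p q :: "'a::topological_space \<Rightarrow> real poly"
  assumes "\<And>j. continuous_on S (\<lambda>z. coeff (p z) j)" "\<And>j. continuous_on S (\<lambda>z. coeff (q z) j)"
  shows "continuous_on S (\<lambda>z. coeff (p z * q z) j)"
  unfolding coeff_mult by (intro continuous_intros assms)

lemma continuous_on_coeff_root_poly:
  "continuous_on UNIV (\<lambda>z::nat \<Rightarrow> real. coeff (root_poly k z) j)"
proof (induction k arbitrary: j)
  case 0
  then show ?case by (simp add: root_poly_def)
next
  case (Suc k)
  have "continuous_on UNIV (\<lambda>z::nat \<Rightarrow> real. coeff [:- z k, 1:] j)" for j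
    unfolding coeff_pCons by (cases j) (auto split: nat.splits intro!: continuous_intros)
  then show ?case unfolding root_poly_Suc by (intro continuous_on_coeff_mult Suc)
qed

lemma compact_box: "compact {z::nat \<Rightarrow> real. \<forall>i. a i \<le> z i \<and> z i \<le> b i}"
proof -
  have e: "{z::nat \<Rightarrow> real. \<forall>i. a i \<le> z i \<and> z i \<le> b i} = (\<Pi>\<^sub>E i\<in>UNIV. {a i..b i})"
    by (auto simp: PiE_def Pi_def)
  have "compactin (product_topology (\<lambda>i::nat. euclidean :: real topology) UNIV) (\<Pi>\<^sub>E i\<in>UNIV. {a i..b i})"
    unfolding compactin_PiE by auto
  then show ?thesis unfolding e by (simp add: euclidean_product_topology)
qed

lemma coordsI: "(\<And>i. i < n \<Longrightarrow> (\<lambda>x. f x i) \<in> borel_measurable N) \<Longrightarrow> (\<And>x. x \<in> space N \<Longrightarrow> f x \<in> extensional {..<n}) \<Longrightarrow> f \<in> N \<rightarrow>\<^sub>M coords n"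
  by (rule measurable_PiM_single') (auto simp: PiE_def)

text \<open>The set is a countable union of sets \<open>\<Phi> ` K m\<close>, where \<open>\<Phi>\<close> multiplies \<open>k\<close> linear factors with a monic cofactor
  and \<open>K m\<close> is a compact box of roots and coefficients; continuous images of compact sets are closed.\<close>

lemma sets_root_poly_dvd:
  assumes "k \<le> n"
  shows "{c \<in> space (coords n). \<exists>x. (\<forall>j<k. x j \<le> t) \<and> root_poly k x dvd cpoly 1 n c} \<in> sets (coords n)"
proof -
  define \<Phi> where "\<Phi> z j = (if j < n then coeff (root_poly k z * cpoly 1 (n - k) (\<lambda>i. z (k + i))) (n - 1 - j) else 0)"
    for z :: "nat \<Rightarrow> real" and j
  define \<iota> where "\<iota> c j = (if j < n then c j else 0 :: real)" for c :: "nat \<Rightarrow> real" and j :: nat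
  \<comment> \<open>The first \<open>k\<close> entries of \<open>z\<close> are roots, the following ones are coefficients of the cofactor.\<close>
  define K where "K m = {z::nat \<Rightarrow> real. \<forall>i. - real m \<le> z i \<and> z i \<le> (if i < k then t else real m)}" for m
  have cont: "continuous_on UNIV \<Phi>"
  proof (rule continuous_on_coordinatewise_then_product)
    fix j
    have "continuous_on UNIV (\<lambda>z::nat \<Rightarrow> real. coeff (cpoly 1 (n - k) (\<lambda>i. z (k + i))) j)" for j
      unfolding coeff_cpoly by (cases "j < n - k"; cases "j = n - k") auto
    then have "continuous_on UNIV (\<lambda>z::nat \<Rightarrow> real. coeff (root_poly k z * cpoly 1 (n - k) (\<lambda>i. z (k + i))) (n - 1 - j))"
      by (intro continuous_on_coeff_mult continuous_on_coeff_root_poly)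
    then show "continuous_on UNIV (\<lambda>z. \<Phi> z j)" unfolding \<Phi>_def by (cases "j < n") auto
  qed
  have "closed (\<Phi> ` K m)" for m
    unfolding K_def by (intro compact_imp_closed compact_continuous_image continuous_on_subset[OF cont] compact_box) auto
  then have B: "\<Phi> ` K m \<in> sets borel" for m by (rule borel_closed)
  have i[measurable]: "\<iota> \<in> borel_measurable (coords n)"
  proof (rule measurable_coordinatewise_then_product)
    fix j show "(\<lambda>c. \<iota> c j) \<in> borel_measurable (coords n)" unfolding \<iota>_def by (cases "j < n") auto
  qed
  have "{c \<in> space (coords n). \<exists>x. (\<forall>j<k. x j \<le> t) \<and> root_poly k x dvd cpoly 1 n c}
      = (\<Union>m. \<iota> -` (\<Phi> ` K m) \<inter> space (coords n))"
  proof safe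
    fix c x assume c: "c \<in> space (coords n)" and x: "\<forall>j<k. x j \<le> t" and d: "root_poly k x dvd cpoly 1 n c"
    then obtain q where q: "cpoly 1 n c = root_poly k x * q" by (auto elim: dvdE)
    have "q \<noteq> 0" using q degree_cpoly[of 1 n c] by (auto simp: coeff_cpoly dest!: arg_cong[where f="\<lambda>p. coeff p n"])
    then have "degree (cpoly 1 n c) = k + degree q" unfolding q
      by (simp add: degree_mult_eq root_poly_nz degree_root_poly)
    then have dq: "degree q = n - k" using degree_cpoly[of 1 n c] by auto
    have "lead_coeff (cpoly 1 n c) = lead_coeff (root_poly k x) * lead_coeff q" unfolding q by (rule lead_coeff_mult)
    then have "coeff q (n - k) = 1"
      by (simp add: degree_cpoly coeff_cpoly degree_root_poly coeff_root_poly dq)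
    then have q': "cpoly 1 (n - k) (\<lambda>i. coeff q (n - k - 1 - i)) = q"
      using cpoly_of_coeff[of q "n - k"] dq by simp
    define z where "z i = (if i < k then x i else if i < n then coeff q (n - k - 1 - (i - k)) else 0)" for i
    obtain m where m: "\<forall>i\<in>{..<n}. \<bar>z i\<bar> \<le> real m"
    proof -
      obtain m where "Max (insert 0 ((\<lambda>i. \<bar>z i\<bar>) ` {..<n})) \<le> real m" using real_arch_simple by blast
      then show ?thesis by (intro that[of m]) (auto simp: Max_le_iff)
    qed
    have "\<bar>z i\<bar> \<le> real m" for i using m assms by (cases "i < n") (auto simp: z_def)
    then have "- real m \<le> z i \<and> z i \<le> real m" for i by (simp add: abs_le_iff minus_le_iff)
    then have zK: "z \<in> K m" using x by (auto simp: K_def) (auto simp: z_def)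
    have "root_poly k z = root_poly k x" by (rule root_poly_cong) (simp add: z_def)
    moreover have "cpoly 1 (n - k) (\<lambda>i. z (k + i)) = q"
      by (subst q'[symmetric], rule cpoly_cong) (auto simp: z_def)
    ultimately have "\<iota> c = \<Phi> z"
      by (auto simp: \<iota>_def \<Phi>_def q[symmetric] coeff_cpoly fun_eq_iff)
    then show "c \<in> (\<Union>m. \<iota> -` (\<Phi> ` K m) \<inter> space (coords n))" using c zK by auto
  next
    fix c m z assume c: "c \<in> space (coords n)" and e: "\<iota> c = \<Phi> z" and z: "z \<in> K m"
    let ?p = "root_poly k z * cpoly 1 (n - k) (\<lambda>i. z (k + i))"
    have dp: "degree ?p \<le> n"
      using degree_mult_le[of "root_poly k z" "cpoly 1 (n - k) (\<lambda>i. z (k + i))"] degree_cpoly_le[of 1 "n - k" "\<lambda>i. z (k + i)"] assms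
      by (simp add: degree_root_poly)
    have "coeff ?p (degree (root_poly k z) + degree (cpoly 1 (n - k) (\<lambda>i. z (k + i)))) = 1"
      unfolding coeff_mult_degree_sum by (simp add: degree_root_poly degree_cpoly coeff_root_poly coeff_cpoly)
    then have lp: "coeff ?p n = 1" using assms by (simp add: degree_root_poly degree_cpoly)
    have "cpoly 1 n c = cpoly 1 n (\<lambda>i. coeff ?p (n - 1 - i))"
    proof (rule cpoly_cong)
      fix i assume "i < n"
      then show "c i = coeff ?p (n - 1 - i)" using fun_cong[OF e, of i] by (simp add: \<iota>_def \<Phi>_def)
    qed
    also have "\<dots> = ?p" using cpoly_of_coeff[OF dp] lp by simp
    finally have "root_poly k z dvd cpoly 1 n c" by simp
    moreover have "z j \<le> t" if "j < k" for j 
    proof -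
      have "\<forall>i. - real m \<le> z i \<and> z i \<le> (if i < k then t else real m)" using z by (simp add: K_def)
      from this[rule_format, of j] show ?thesis using that by simp
    qed
    ultimately show "\<exists>x. (\<forall>j<k. x j \<le> t) \<and> root_poly k x dvd cpoly 1 n c" by blast
  qed
  also have "\<dots> \<in> sets (coords n)" by (intro sets.countable_UN image_subsetI measurable_sets[OF i B])
  finally show ?thesis .
qed

lemma cpoly_nz: "cpoly 1 n c \<noteq> 0"
  using coeff_cpoly[of 1 n c n] by (metis coeff_0 less_irrefl zero_neq_one)

lemma measurable_root_index:
  "{c \<in> space (coords n). i < size (proots (cpoly 1 n c)) \<and> sorted_root (cpoly 1 n c) i \<le> t} \<in> sets (coords n)"
proof (cases "i < n")
  case True
  then show ?thesis
    unfolding sorted_nth_le_iff_root_poly_dvd[OF cpoly_nz] by (intro sets_root_poly_dvd) simp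
next
  case False
  then have "\<not> i < size (proots (cpoly 1 n c))" for c
    using size_proots_le[of "cpoly 1 n c"] degree_cpoly_le[of 1 n c] by linarith
  then show ?thesis by simp
qed

lemma measurable_size_proots:
  "{c \<in> space (coords n). i < size (proots (cpoly 1 n c))} \<in> sets (coords n)"
proof -
  have "{c \<in> space (coords n). i < size (proots (cpoly 1 n c))}
    = (\<Union>m::nat. {c \<in> space (coords n). i < size (proots (cpoly 1 n c)) \<and> sorted_root (cpoly 1 n c) i \<le> real m})"
    by (auto intro: real_arch_simple)
  also have "\<dots> \<in> sets (coords n)" using measurable_root_index by blast
  finally show ?thesis .
qed

lemma measurable_size_proots' [measurable]:
  "(\<lambda>c. size (proots (cpoly 1 n c))) \<in> coords n \<rightarrow>\<^sub>M count_space UNIV"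
proof -
  have p[measurable]: "Measurable.pred (coords n) (\<lambda>c. i < size (proots (cpoly 1 n c)))" for i
    using measurable_size_proots[of n i] by (simp add: pred_def)
  show ?thesis
    unfolding measurable_count_space_eq2_countable
  proof (intro conjI ballI)
    fix a :: nat
    have "s = a \<longleftrightarrow> \<not> a < s \<and> (\<forall>i<a. i < s)" for s
      by (cases s a rule: linorder_cases) auto
    then have "(\<lambda>c. size (proots (cpoly 1 n c))) -` {a} \<inter> space (coords n)
      = {c \<in> space (coords n). \<not> a < size (proots (cpoly 1 n c)) \<and> (\<forall>i<a. i < size (proots (cpoly 1 n c)))}"
      unfolding vimage_def Int_def by blast
    also have "\<dots> \<in> sets (coords n)" by measurable
    finally show "(\<lambda>c. size (proots (cpoly 1 n c))) -` {a} \<inter> space (coords n) \<in> sets (coords n)" .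
  qed simp
qed

text \<open>The index may exceed the number of real roots. Reading past the end of a list yields a value that
  depends only on the excess, so such a value is a measurable function of the number of roots.\<close>

lemma measurable_sorted_root [measurable]:
  "(\<lambda>c. sorted_root (cpoly 1 n c) i) \<in> borel_measurable (coords n)"
proof (rule borel_measurableI_le)
  fix t
  \<comment> \<open>The unspecified values that list access past the end returns.\<close>
  define u :: "nat \<Rightarrow> real" where "u k = [] ! k" for k
  have nth_beyond: "xs ! i = u (i - length xs)" if "length xs \<le> i" for xs i
    using that by (induction xs arbitrary: i) (auto simp: u_def nth_Cons' Suc_le_eq)
  let ?s = "\<lambda>c. size (proots (cpoly 1 n c))"
  have u: "sorted_root (cpoly 1 n c) i = u (i - ?s c)" if "\<not> i < ?s c" for c
    unfolding sorted_root_def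
    by (subst nth_beyond) (use that in \<open>metis mset_sorted_list_of_multiset size_mset not_less\<close>,
      metis mset_sorted_list_of_multiset size_mset)
  have [measurable]: "Measurable.pred (coords n) (\<lambda>c. i < ?s c \<and> sorted_root (cpoly 1 n c) i \<le> t)"
    using measurable_root_index[of n i t] by (simp add: pred_def)
  have "sorted_root (cpoly 1 n c) i \<le> t \<longleftrightarrow>
      (i < ?s c \<and> sorted_root (cpoly 1 n c) i \<le> t) \<or> (\<not> i < ?s c \<and> u (i - ?s c) \<le> t)" for c
    by (cases "i < ?s c") (simp_all add: u)
  then have "{c \<in> space (coords n). sorted_root (cpoly 1 n c) i \<le> t}
    = {c \<in> space (coords n). (i < ?s c \<and> sorted_root (cpoly 1 n c) i \<le> t) \<or> (\<not> i < ?s c \<and> u (i - ?s c) \<le> t)}"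
    by blast
  also have "\<dots> \<in> sets (coords n)" by measurable
  finally show "{c \<in> space (coords n). sorted_root (cpoly 1 n c) i \<le> t} \<in> sets (coords n)" .
qed

definition real_split :: "nat \<Rightarrow> real poly \<Rightarrow> bool" where
  "real_split n p \<longleftrightarrow> (\<exists>x. strict_mono_on {..<n} x \<and> p = root_poly n x)"

lemma real_splitD:
  assumes "real_split n p"
  shows "strict_mono_on {..<n} (sorted_root p)" "p = root_poly n (sorted_root p)"
proof -
  obtain x where x: "strict_mono_on {..<n} x" "p = root_poly n x" using assms by (auto simp: real_split_def)
  then have e: "sorted_root p i = x i" if "i < n" for i using sorted_root_root_poly that by blast
  show "p = root_poly n (sorted_root p)" using e by (subst x(2)) (intro root_poly_cong, simp)
  show "strict_mono_on {..<n} (sorted_root p)" using x(1) e by (auto simp: strict_mono_on_def)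
qed

text \<open>The right-hand side is a condition on finitely many measurable functions of the coefficients.\<close>

lemma real_split_iff:
  "real_split n (cpoly 1 n c) \<longleftrightarrow> size (proots (cpoly 1 n c)) = n \<and>
     (\<forall>i<n. \<forall>j<i. sorted_root (cpoly 1 n c) j < sorted_root (cpoly 1 n c) i)"
    (is "?L \<longleftrightarrow> ?R")
proof
  assume ?L
  note r = real_splitD[OF this]
  have "size (proots (cpoly 1 n c)) = n" by (subst r(2)) (simp add: proots_root_poly)
  then show ?R using strict_mono_onD[OF r(1)] by auto
next
  let ?p = "cpoly 1 n c" let ?l = "sorted_list_of_multiset (proots ?p)"
  assume R: ?R
  have len: "length ?l = n" using R by (metis mset_sorted_list_of_multiset size_mset)
  have "(\<Prod>x\<in>#mset ?l. [:- x, 1:]) dvd ?p"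
    using cpoly_nz by (intro prod_linear_dvd_of_subset_proots) auto
  then have "root_poly n (sorted_root ?p) dvd ?p"
    using root_poly_eq_prod_list[of ?l] unfolding len sorted_root_def
    by (metis mset_map prod_mset_prod_list)
  then obtain q where q: "?p = root_poly n (sorted_root ?p) * q" by (auto elim: dvdE)
  then have "q \<noteq> 0" using cpoly_nz[of n c] by auto
  then have "degree ?p = n + degree q"
    using degree_mult_eq[of "root_poly n (sorted_root ?p)" q] unfolding q[symmetric] by (simp add: root_poly_nz degree_root_poly)
  then have dq: "degree q = 0" by (simp add: degree_cpoly)
  have "lead_coeff ?p = lead_coeff (root_poly n (sorted_root ?p)) * lead_coeff q"
    using lead_coeff_mult[of "root_poly n (sorted_root ?p)" q] unfolding q[symmetric] .
  then have "coeff q 0 = 1" by (simp add: dq degree_cpoly coeff_cpoly degree_root_poly coeff_root_poly)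
  then have "q = 1" using dq by (metis degree_0_id of_nat_1 one_pCons)
  then have "?p = root_poly n (sorted_root ?p)" using q by simp
  moreover have "strict_mono_on {..<n} (sorted_root ?p)" using R by (auto simp: strict_mono_on_def)
  ultimately show ?L unfolding real_split_def by blast
qed

lemma measurable_real_split [measurable]: "Measurable.pred (coords n) (\<lambda>c. real_split n (cpoly 1 n c))"
  unfolding real_split_iff by measurable

lemma measurable_poly_cpoly [measurable (raw)]:
  assumes "f \<in> N \<rightarrow>\<^sub>M coords n" and [measurable]: "h \<in> borel_measurable N" "g \<in> borel_measurable N"
  shows "(\<lambda>x. poly (cpoly (h x) n (f x)) (g x)) \<in> borel_measurable N"
proof -
  have "k \<le> n \<Longrightarrow> (\<lambda>x. poly (cpoly (h x) k (f x)) (g x)) \<in> borel_measurable N" for k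
  proof (induction k)
    case (Suc k)
    have [measurable]: "(\<lambda>x. f x k) \<in> borel_measurable N"
      using measurable_compose[OF assms(1) measurable_component_singleton[of k]] Suc.prems by simp
    show ?case using Suc by simp
  qed simp
  then show ?thesis by simp
qed

section \<open>The Jacobian of the Vieta map\<close>

lemma borel_measurable_coeff_mult:
  fixes p q :: "'a \<Rightarrow> real poly"
  assumes "\<And>j. (\<lambda>z. coeff (p z) j) \<in> borel_measurable N" "\<And>j. (\<lambda>z. coeff (q z) j) \<in> borel_measurable N"
  shows "(\<lambda>z. coeff (p z * q z) j) \<in> borel_measurable N"
  unfolding coeff_mult by (intro borel_measurable_sum borel_measurable_times assms)

lemma borel_measurable_coeff_linear:
  fixes f :: "'a \<Rightarrow> real"
  assumes [measurable]: "f \<in> borel_measurable N"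
  shows "(\<lambda>z. coeff [:- f z, 1:] j) \<in> borel_measurable N"
  unfolding coeff_pCons by (cases j) (auto intro: borel_measurable_uminus assms)

lemma borel_measurable_coeff_root_poly:
  assumes "f \<in> N \<rightarrow>\<^sub>M coords n"
  shows "(\<lambda>z. coeff (root_poly n (f z)) j) \<in> borel_measurable N"
proof -
  have "k \<le> n \<Longrightarrow> (\<lambda>z. coeff (root_poly k (f z)) j) \<in> borel_measurable N" for k
  proof (induction k arbitrary: j)
    case 0
    then show ?case by (simp add: root_poly_def)
  next
    case (Suc k)
    then show ?case unfolding root_poly_Suc
      by (intro borel_measurable_coeff_mult borel_measurable_coeff_linear measurable_coord_app[OF assms]) auto
  qed
  then show ?thesis by simp
qed

definition vieta :: "nat \<Rightarrow> (nat \<Rightarrow> real) \<Rightarrow> nat \<Rightarrow> real" where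
  "vieta n x = (\<lambda>i\<in>{..<n}. coeff (root_poly n x) (n - 1 - i))"

lemma cpoly_vieta: "cpoly 1 n (vieta n x) = root_poly n x"
proof -
  have "cpoly 1 n (vieta n x) = cpoly 1 n (\<lambda>i. coeff (root_poly n x) (n - 1 - i))"
    by (rule cpoly_cong) (simp add: vieta_def)
  then show ?thesis using cpoly_of_coeff[of "root_poly n x" n] by (simp add: degree_root_poly coeff_root_poly)
qed

lemma measurable_vieta [measurable (raw)]:
  assumes "f \<in> N \<rightarrow>\<^sub>M coords n" shows "(\<lambda>x. vieta n (f x)) \<in> N \<rightarrow>\<^sub>M coords n"
  by (rule coordsI) (auto simp: vieta_def intro: borel_measurable_coeff_root_poly assms)

definition add_root :: "nat \<Rightarrow> (nat \<Rightarrow> real) \<Rightarrow> real \<Rightarrow> nat \<Rightarrow> real" where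
  "add_root n c t = (\<lambda>i\<in>{..<Suc n}. mul_linear 1 n c t i)"

lemma cpoly_add_root: "cpoly 1 (Suc n) (add_root n c t) = [:- t, 1:] * cpoly 1 n c"
  unfolding cpoly_mul_linear[symmetric] by (rule cpoly_cong) (simp add: add_root_def)

lemma coords_eqI:
  assumes "c \<in> extensional {..<n}" "d \<in> extensional {..<n}" "cpoly s n c = cpoly s n d"
  shows "c = d"
  using assms cpoly_inj[of s n c d] by (auto intro: extensionalityI)

lemma measurable_add_root [measurable (raw)]:
  assumes f: "f \<in> N \<rightarrow>\<^sub>M coords n" and h[measurable]: "h \<in> borel_measurable N"
  shows "(\<lambda>x. add_root n (f x) (h x)) \<in> N \<rightarrow>\<^sub>M coords (Suc n)"
proof (rule coordsI)
  fix i assume i: "i < Suc n"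
  have 1[measurable]: "(\<lambda>x. if i < n then f x i else 0) \<in> borel_measurable N"
    using measurable_coord_app[OF f, of i] by (cases "i < n") auto
  have 2[measurable]: "(\<lambda>x. if i = 0 then 1 else f x (i - 1)) \<in> borel_measurable N"
    using measurable_coord_app[OF f, of "i - 1"] i by (cases "i = 0") auto
  have "(\<lambda>x. mul_linear 1 n (f x) (h x) i) \<in> borel_measurable N"
    unfolding mul_linear_def by measurable
  then show "(\<lambda>x. add_root n (f x) (h x) i) \<in> borel_measurable N" using i by (simp add: add_root_def)
qed (simp add: add_root_def)

lemma vieta_Suc: "vieta (Suc n) (x(n := t)) = add_root n (vieta n x) t"
proof (rule coords_eqI)
  have "root_poly n (x(n := t)) = root_poly n x" by (rule root_poly_cong) simp
  then show "cpoly 1 (Suc n) (vieta (Suc n) (x(n := t))) = cpoly 1 (Suc n) (add_root n (vieta n x) t)"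
    unfolding cpoly_add_root cpoly_vieta root_poly_Suc by simp
qed (auto simp: vieta_def add_root_def)

lemma vandermonde_Suc: "vandermonde (Suc n) x = vandermonde n x * poly (root_poly n x) (x n)"
  by (simp add: vandermonde_def poly_root_poly)

lemma vandermonde_cong: "(\<And>i. i < n \<Longrightarrow> x i = y i) \<Longrightarrow> vandermonde n x = vandermonde n y"
  unfolding vandermonde_def by (intro prod.cong refl) auto

lemma measurable_vandermonde [measurable (raw)]:
  assumes "f \<in> N \<rightarrow>\<^sub>M coords n" shows "(\<lambda>x. vandermonde n (f x)) \<in> borel_measurable N"
  unfolding vandermonde_def
  by (intro borel_measurable_prod borel_measurable_diff measurable_coord_app[OF assms]) auto

lemma real_split_iff_proots:
  assumes "degree p = n" "coeff p n = 1"
  shows "real_split n p \<longleftrightarrow> size (proots p) = n \<and> (\<forall>a. count (proots p) a \<le> 1)"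
proof
  assume "real_split n p"
  then obtain x where x: "strict_mono_on {..<n} x" "p = root_poly n x" by (auto simp: real_split_def)
  have inj: "inj_on x {0..<n}" using strict_mono_on_imp_inj_on[OF x(1)] by (simp add: atLeast0LessThan)
  have "proots p = mset_set (x ` {0..<n})"
    unfolding x(2) proots_root_poly using image_mset_mset_set[OF inj] by simp
  moreover have "card (x ` {0..<n}) = n" using inj by (simp add: card_image)
  ultimately show "size (proots p) = n \<and> (\<forall>a. count (proots p) a \<le> 1)" by (simp add: count_mset_set')
next
  assume a: "size (proots p) = n \<and> (\<forall>a. count (proots p) a \<le> 1)"
  have p: "cpoly 1 n (\<lambda>i. coeff p (n - 1 - i)) = p" using cpoly_of_coeff[of p n] assms by simp
  let ?l = "sorted_list_of_multiset (proots p)"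
  have len: "length ?l = n" using a by (metis mset_sorted_list_of_multiset size_mset)
  have "count (mset ?l) y = (if y \<in> set ?l then 1 else 0)" for y
  proof (cases "y \<in> set ?l")
    case True
    then have "0 < count (mset ?l) y" by (simp only: count_greater_zero_iff set_mset_mset)
    moreover have "count (mset ?l) y \<le> 1" using a by (simp only: mset_sorted_list_of_multiset)
    ultimately have "count (mset ?l) y = 1" by linarith
    with True show ?thesis by (simp only: if_True)
  next
    case False
    then have "count (mset ?l) y = 0" by (simp only: count_mset_0_iff not_False_eq_True)
    with False show ?thesis by (simp only: if_False)
  qed
  then have "distinct ?l" unfolding distinct_count_atmost_1 by blast
  then have "sorted_wrt (<) ?l" using sorted_sorted_list_of_multiset strict_sorted_iff by blast
  then have "\<forall>i<n. \<forall>j<i. sorted_root p j < sorted_root p i"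
    unfolding sorted_root_def using len by (auto simp: sorted_wrt_nth_less)
  then show "real_split n p" using real_split_iff[of n "\<lambda>i. coeff p (n - 1 - i)"] a unfolding p by blast
qed

lemma real_split_linear_mult:
  assumes "degree p = n" "coeff p n = 1" "poly p t \<noteq> 0"
  shows "real_split (Suc n) ([:- t, 1:] * p) \<longleftrightarrow> real_split n p"
proof -
  have p0: "p \<noteq> 0" using assms by auto
  have d: "degree ([:- t, 1:] * p) = Suc n" using assms p0 by (subst degree_mult_eq) auto
  have c: "coeff ([:- t, 1:] * p) (Suc n) = 1"
    using assms by (simp add: coeff_eq_0)
  have pr: "proots ([:- t, 1:] * p) = add_mset t (proots p)"
    using p0 by (subst proots_mult) auto
  have *: "size (add_mset t A) = Suc n \<and> (\<forall>a. count (add_mset t A) a \<le> 1) \<longleftrightarrow> size A = n \<and> (\<forall>a. count A a \<le> 1)"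
    if A: "count A t = 0" for A
  proof -
    have "count (add_mset t A) a \<le> 1 \<longleftrightarrow> count A a \<le> 1" for a
      using A by (cases "a = t") simp_all
    then show ?thesis by simp
  qed
  have "count (proots p) t = 0" using assms p0 by (simp add: order_root)
  then show ?thesis
    unfolding real_split_iff_proots[OF d c] real_split_iff_proots[OF assms(1,2)] pr
    by (rule *)
qed

text \<open>For given higher coefficients \<open>d\<close>, the constant coefficient that makes \<open>t\<close> a root. This function of \<open>t\<close> is,
  up to sign, the polynomial without constant term.\<close>

definition const_of_root :: "nat \<Rightarrow> (nat \<Rightarrow> real) \<Rightarrow> real \<Rightarrow> real" where
  "const_of_root n d t = - (t * poly (cpoly 1 n d) t)"

lemma poly_cpoly_upd: "poly (cpoly s (Suc n) (d(n := y))) t = t * poly (cpoly s n d) t + y"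
  using cpoly_cong[of n "d(n := y)" d s] by simp

text \<open>Let \<open>T i\<close> be the set of those \<open>t\<close> that become the \<open>i\<close>-th root of a polynomial with simple real roots. On \<open>T i\<close> the
  substitution \<open>t \<mapsto> y\<close> is injective, since \<open>y\<close> determines the polynomial and hence its \<open>i\<close>-th root, and its image
  is the set of all \<open>y\<close> for which the polynomial splits, whatever \<open>i\<close> is. The \<open>n + 1\<close> indices give the factor.\<close>

lemma nn_integral_const_of_root:
  assumes d: "d \<in> space (coords n)" and H[measurable]: "H \<in> borel_measurable (coords (Suc n))"
    and H0: "\<And>c. \<not> real_split (Suc n) (cpoly 1 (Suc n) c) \<Longrightarrow> H c = 0"
  shows "(\<integral>\<^sup>+t. H (d(n := const_of_root n d t)) * ennreal \<bar>poly (pderiv ([:0, 1:] * cpoly 1 n d)) t\<bar> \<partial>lborel)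
    = of_nat (Suc n) * (\<integral>\<^sup>+y. H (d(n := y)) \<partial>lborel)"
proof -
  let ?h = "const_of_root n d"
  let ?q = "[:0, 1:] * cpoly 1 n d"
  let ?h' = "\<lambda>t. - poly (pderiv ?q) t"
  let ?p = "\<lambda>y. cpoly 1 (Suc n) (d(n := y))"
  define T where "T i = {t. real_split (Suc n) (?p (?h t)) \<and> sorted_root (?p (?h t)) i = t}" for i
  define Y where "Y = {y. real_split (Suc n) (?p y)}"
  let ?f = "\<lambda>i t. H (d(n := ?h t)) * ennreal \<bar>?h' t\<bar> * indicator (T i) t"
  have hq: "?h = (\<lambda>t. - poly ?q t)" by (simp add: const_of_root_def fun_eq_iff)
  have der: "(?h has_field_derivative ?h' t) (at t)" for t
    unfolding hq by (intro DERIV_minus poly_DERIV)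
  have [measurable]: "?h \<in> borel_measurable borel"
    unfolding hq by (intro borel_measurable_continuous_onI continuous_intros)
  have h'm[measurable]: "?h' \<in> borel_measurable borel"
    by (intro borel_measurable_continuous_onI continuous_intros)
  have dup[measurable]: "(\<lambda>y. d(n := y)) \<in> borel \<rightarrow>\<^sub>M coords (Suc n)"
    using d by measurable
  have Y[measurable]: "Y \<in> sets borel"
  proof -
    have "Measurable.pred borel (\<lambda>y. real_split (Suc n) (?p y))"
      using measurable_compose[OF dup measurable_real_split] .
    then show ?thesis by (simp add: Y_def pred_def)
  qed
  have T[measurable]: "T i \<in> sets borel" for i
  proof -
    have m: "(\<lambda>t. d(n := ?h t)) \<in> borel \<rightarrow>\<^sub>M coords (Suc n)" by measurable
    have [measurable]: "Measurable.pred borel (\<lambda>t. real_split (Suc n) (?p (?h t)))"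
      using measurable_compose[OF m measurable_real_split] .
    have [measurable]: "(\<lambda>t. sorted_root (?p (?h t)) i) \<in> borel_measurable borel"
      using measurable_compose[OF m measurable_sorted_root] .
    have "Measurable.pred borel (\<lambda>t. real_split (Suc n) (?p (?h t)) \<and> sorted_root (?p (?h t)) i = t)" by measurable
    then show ?thesis by (simp add: T_def pred_def)
  qed
  have root: "poly (?p (?h t)) t = 0" for t
    unfolding poly_cpoly_upd by (simp add: const_of_root_def)
  have img: "?h ` T i = Y" if i: "i < Suc n" for i
  proof
    show "?h ` T i \<subseteq> Y" by (auto simp: T_def Y_def)
    show "Y \<subseteq> ?h ` T i"
    proof
      fix y assume y: "y \<in> Y"
      let ?t = "sorted_root (?p y) i"
      have rs: "real_split (Suc n) (?p y)" using y by (simp add: Y_def)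
      have "poly (root_poly (Suc n) (sorted_root (?p y))) ?t = 0" using i by (rule poly_root_poly_root)
      then have "poly (?p y) ?t = 0" using real_splitD(2)[OF rs] by simp
      then have "?h ?t = y" unfolding poly_cpoly_upd by (simp add: const_of_root_def)
      then show "y \<in> ?h ` T i" using rs by (intro image_eqI[of _ _ ?t]) (auto simp: T_def)
    qed
  qed
  have inj: "inj_on ?h (T i)" for i
  proof (rule inj_onI)
    fix s t assume s: "s \<in> T i" and t: "t \<in> T i" and e: "?h s = ?h t"
    have "s = sorted_root (?p (?h s)) i" "t = sorted_root (?p (?h t)) i" using s t unfolding T_def by auto
    then show "s = t" unfolding e by simp
  qed
  have part: "H (d(n := ?h t)) = (\<Sum>i<Suc n. H (d(n := ?h t)) * indicator (T i) t)" for t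
  proof (cases "real_split (Suc n) (?p (?h t))")
    case False
    then show ?thesis using H0 by simp
  next
    case True
    let ?r = "sorted_root (?p (?h t))"
    have "poly (root_poly (Suc n) ?r) t = 0" using real_splitD(2)[OF True] root[of t] by simp
    then obtain k where k: "k < Suc n" "t = ?r k" by (auto simp: poly_root_poly simp del: prod.lessThan_Suc)
    have uniq: "?r i = t \<longleftrightarrow> i = k" if "i < Suc n" for i
    proof -
      have "?r i = ?r k \<longleftrightarrow> i = k"
        by (rule inj_on_eq_iff[OF strict_mono_on_imp_inj_on[OF real_splitD(1)[OF True]]]) (use that k(1) in auto)
      then show ?thesis by (simp only: k(2)[symmetric])
    qed
    have "(\<Sum>i<Suc n. H (d(n := ?h t)) * indicator (T i) t) = (\<Sum>i<Suc n. if i = k then H (d(n := ?h t)) else 0)"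
      by (rule sum.cong) (use uniq True in \<open>auto simp: T_def indicator_def\<close>)
    also have "\<dots> = H (d(n := ?h t))" using k(1) by (simp del: sum.lessThan_Suc)
    finally show ?thesis by simp
  qed
  have [measurable]: "(\<lambda>y. H (d(n := y))) \<in> borel_measurable borel" by measurable
  have "(\<integral>\<^sup>+t. H (d(n := ?h t)) * ennreal \<bar>?h' t\<bar> \<partial>lborel)
    = (\<integral>\<^sup>+t. (\<Sum>i<Suc n. ?f i t) \<partial>lborel)"
    by (intro nn_integral_cong, subst part, unfold sum_distrib_right) (simp only: mult_ac)
  also have "\<dots> = (\<Sum>i<Suc n. (\<integral>\<^sup>+t. ?f i t \<partial>lborel))"
    by (rule nn_integral_sum) measurable
  also have "\<dots> = (\<Sum>i<Suc n. (\<integral>\<^sup>+y. H (d(n := y)) \<partial>lborel))"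
  proof (intro sum.cong refl)
    fix i assume i: "i \<in> {..<Suc n}"
    have "(\<integral>\<^sup>+t. ?f i t \<partial>lborel)
      = (\<integral>\<^sup>+y. H (d(n := y)) * indicator (?h ` T i) y \<partial>lborel)"
    proof (rule nn_integral_substitution_inj[OF T _ der h'm inj])
      show "?h ` T i \<in> sets borel" using i img Y by simp
    qed measurable
    also have "\<dots> = (\<integral>\<^sup>+y. H (d(n := y)) \<partial>lborel)"
      using i img H0 by (intro nn_integral_cong) (auto simp: Y_def indicator_def simp del: cpoly.simps)
    finally show "(\<integral>\<^sup>+t. ?f i t \<partial>lborel) = (\<integral>\<^sup>+y. H (d(n := y)) \<partial>lborel)" .
  qed
  finally show ?thesis by simp
qed

text \<open>Adding a root \<open>t\<close> shears the given coefficients, and the new constant coefficient is then determined by \<open>t\<close> being a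
  root.\<close>

lemma add_root_eq_upd:
  "add_root n c t = (\<lambda>i\<in>{..<n}. c i - t * (if i = 0 then 1 else c (i - 1)) + 0)
     (n := const_of_root n (\<lambda>i\<in>{..<n}. c i - t * (if i = 0 then 1 else c (i - 1)) + 0) t)"
  (is "_ = ?d(n := _)")
proof -
  have e: "add_root n c t = ?d(n := add_root n c t n)"
    by (auto simp: add_root_def mul_linear_def fun_eq_iff)
  have "poly (cpoly 1 (Suc n) (add_root n c t)) t = 0"
    unfolding cpoly_add_root by simp
  then have "t * poly (cpoly 1 n ?d) t + add_root n c t n = 0"
    by (subst (asm) e) (simp only: poly_cpoly_upd)
  then have "add_root n c t n = const_of_root n ?d t" by (simp add: const_of_root_def add_eq_0_iff)
  then show ?thesis using e by simp
qed

text \<open>The derivative of \<open>(X - t) C\<close> at \<open>t\<close> is \<open>C(t)\<close>: the Jacobian of the one-dimensional substitution is the factor by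
  which the new root enlarges the Vandermonde product.\<close>

lemma poly_deriv_add_root:
  "poly (pderiv ([:0, 1:] * cpoly 1 n (\<lambda>i\<in>{..<n}. c i - t * (if i = 0 then 1 else c (i - 1)) + 0))) t = poly (cpoly 1 n c) t"
  (is "poly (pderiv ([:0, 1:] * cpoly 1 n ?d)) t = _")
proof -
  have "[:- t, 1:] * cpoly 1 n c = cpoly 1 (Suc n) (?d(n := const_of_root n ?d t))"
    by (metis add_root_eq_upd cpoly_add_root)
  also have "\<dots> = [:0, 1:] * cpoly 1 n ?d + [:const_of_root n ?d t:]"
    using cpoly_cong[of n "?d(n := const_of_root n ?d t)" ?d 1] by (simp add: pCons_one)
  finally have "pderiv ([:- t, 1:] * cpoly 1 n c) = pderiv ([:0, 1:] * cpoly 1 n ?d + [:const_of_root n ?d t:])" by simp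
  then have e: "pderiv ([:0, 1:] * cpoly 1 n ?d) = pderiv ([:- t, 1:] * cpoly 1 n c)"
    by (simp only: pderiv_add) (simp add: pderiv_pCons)
  show ?thesis unfolding e unfolding pderiv_mult by (simp add: pderiv_pCons)
qed

text \<open>Induction on the number of roots. The last root \<open>t\<close> is kept fixed while the others are replaced by the
  coefficients of their polynomial; adding \<open>t\<close> is a shear in all but the last coefficient, and the last coefficient is
  then exchanged for \<open>t\<close>. Points with a repeated root have Vandermonde product \<open>0\<close>.\<close>

theorem nn_integral_vieta:
  assumes "G \<in> borel_measurable (coords n)"
  shows "(\<integral>\<^sup>+x. G (vieta n x) * ennreal \<bar>vandermonde n x\<bar> \<partial>coords n)
    = of_nat (fact n) * (\<integral>\<^sup>+c. G c * indicator {c. real_split n (cpoly 1 n c)} c \<partial>coords n)"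
  using assms
proof (induction n arbitrary: G)
  case 0
  have "real_split 0 1" by (auto simp: real_split_def root_poly_def strict_mono_on_def)
  then show ?case unfolding nn_integral_coords_0 by (simp add: vandermonde_def vieta_def one_pCons restrict_def)
next
  case (Suc n)
  note [measurable] = Suc.prems
  let ?d = "\<lambda>t c. \<lambda>i\<in>{..<n}. c i - t * (if i = 0 then 1 else c (i - 1)) + 0"
  define H where "H c = G c * indicator {c. real_split (Suc n) (cpoly 1 (Suc n) c)} c" for c
  let ?K = "\<lambda>d t. H (d(n := const_of_root n d t)) * ennreal \<bar>poly (pderiv ([:0, 1:] * cpoly 1 n d)) t\<bar>"
  let ?S = "\<lambda>c. indicator {c. real_split n (cpoly 1 n c)} c :: ennreal" and ?e = "\<lambda>c t. ennreal \<bar>poly (cpoly 1 n c) t\<bar>"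
  have [measurable]: "{c \<in> space (coords n). real_split n (cpoly 1 n c)} \<in> sets (coords n)" for n
    using measurable_real_split[of n] by (simp only: pred_def)
  have Hm[measurable]: "H \<in> borel_measurable (coords (Suc n))" unfolding H_def
    by measurable
  have h1[measurable]: "(\<lambda>(t, d). const_of_root n d t) \<in> borel_measurable (lborel \<Otimes>\<^sub>M coords n)"
    unfolding const_of_root_def by measurable
  have pdm: "(\<lambda>(t, d). poly (pderiv ([:0, 1:] * cpoly 1 n d)) t) \<in> borel_measurable (lborel \<Otimes>\<^sub>M coords n)"
  proof -
    have "k \<le> n \<Longrightarrow> (\<lambda>(t, d). poly (pderiv (cpoly 1 k d)) t) \<in> borel_measurable (lborel \<Otimes>\<^sub>M coords n)" for k
    proof (induction k)
      case (Suc k)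
      have 1: "(\<lambda>z. poly (cpoly 1 k (restrict (snd z) {..<k})) (fst z)) \<in> borel_measurable (lborel \<Otimes>\<^sub>M coords n)"
      proof (rule measurable_poly_cpoly)
        show "(\<lambda>z. restrict (snd z) {..<k}) \<in> lborel \<Otimes>\<^sub>M coords n \<rightarrow>\<^sub>M coords k"
          using Suc.prems by (intro measurable_restrict measurable_coord_app[OF measurable_snd]) auto
      qed auto
      have "(\<lambda>z. poly (cpoly 1 k (snd z)) (fst z)) \<in> borel_measurable (lborel \<Otimes>\<^sub>M coords n)"
      proof -
        have "cpoly 1 k (restrict (snd z) {..<k}) = cpoly 1 k (snd z)" for z :: "real \<times> (nat \<Rightarrow> real)"
          by (rule cpoly_cong) simp
        then show ?thesis using 1 by simp
      qed
      then show ?case using Suc by (auto simp: pderiv_pCons case_prod_unfold)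
    qed simp
    from this[of n] have [measurable]: "(\<lambda>(t, d). poly (pderiv (cpoly 1 n d)) t) \<in> borel_measurable (lborel \<Otimes>\<^sub>M coords n)" by simp
    have "(\<lambda>(t, d). poly (cpoly 1 n d) t + t * poly (pderiv (cpoly 1 n d)) t) \<in> borel_measurable (lborel \<Otimes>\<^sub>M coords n)"
      by measurable
    then show ?thesis by (simp add: pderiv_pCons case_prod_unfold)
  qed
  note [measurable] = pdm
  have "(\<integral>\<^sup>+x. G (vieta (Suc n) x) * ennreal \<bar>vandermonde (Suc n) x\<bar> \<partial>coords (Suc n))
    = (\<integral>\<^sup>+t. (\<integral>\<^sup>+x. G (vieta (Suc n) (x(n := t))) * ennreal \<bar>vandermonde (Suc n) (x(n := t))\<bar> \<partial>coords n) \<partial>lborel)"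
    by (rule nn_integral_coords_Suc_rev) measurable
  also have "\<dots> = (\<integral>\<^sup>+t. (of_nat (fact n) * (\<integral>\<^sup>+d. ?K d t \<partial>coords n)) \<partial>lborel)"
  proof (intro nn_integral_cong)
    fix t :: real
    have 1: "vandermonde (Suc n) (x(n := t)) = vandermonde n x * poly (cpoly 1 n (vieta n x)) t" for x
      using vandermonde_cong[of n "x(n := t)" x] root_poly_cong[of n "x(n := t)" x]
      by (simp add: vandermonde_Suc cpoly_vieta)
    have "(\<integral>\<^sup>+x. G (vieta (Suc n) (x(n := t))) * ennreal \<bar>vandermonde (Suc n) (x(n := t))\<bar> \<partial>coords n)
      = (\<integral>\<^sup>+x. (G (add_root n (vieta n x) t) * ennreal \<bar>poly (cpoly 1 n (vieta n x)) t\<bar>) * ennreal \<bar>vandermonde n x\<bar> \<partial>coords n)"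
      by (simp add: vieta_Suc 1 abs_mult ennreal_mult mult_ac)
    also have "\<dots> = of_nat (fact n) * (\<integral>\<^sup>+c. (G (add_root n c t) * ?e c t) * ?S c \<partial>coords n)"
      by (rule Suc.IH) measurable
    also have "(\<integral>\<^sup>+c. (G (add_root n c t) * ?e c t) * ?S c \<partial>coords n)
      = (\<integral>\<^sup>+c. H (add_root n c t) * ?e c t \<partial>coords n)"
    proof (intro nn_integral_cong)
      fix c
      have "poly (cpoly 1 n c) t \<noteq> 0 \<Longrightarrow> real_split (Suc n) (cpoly 1 (Suc n) (add_root n c t)) \<longleftrightarrow> real_split n (cpoly 1 n c)"
        unfolding cpoly_add_root by (rule real_split_linear_mult) (auto simp: degree_cpoly coeff_cpoly)
      then show "(G (add_root n c t) * ?e c t) * ?S c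
        = H (add_root n c t) * ?e c t"
        by (cases "poly (cpoly 1 n c) t = 0") (auto simp: H_def indicator_def simp del: cpoly.simps)
    qed
    also have "\<dots> = (\<integral>\<^sup>+c. (\<lambda>d. ?K d t) (?d t c) \<partial>coords n)"
      unfolding poly_deriv_add_root by (subst add_root_eq_upd) (rule refl)
    also have "\<dots> = (\<integral>\<^sup>+d. ?K d t \<partial>coords n)"
      by (rule nn_integral_coords_shear) measurable
    finally show "(\<integral>\<^sup>+x. G (vieta (Suc n) (x(n := t))) * ennreal \<bar>vandermonde (Suc n) (x(n := t))\<bar> \<partial>coords n)
      = of_nat (fact n) * (\<integral>\<^sup>+d. ?K d t \<partial>coords n)" .
  qed
  also have "\<dots> = of_nat (fact n) * (\<integral>\<^sup>+t. (\<integral>\<^sup>+d. ?K d t \<partial>coords n) \<partial>lborel)"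
    by (rule nn_integral_cmult) (intro sigma_finite_measure.borel_measurable_nn_integral sigma_finite_coords, measurable)
  also have "(\<integral>\<^sup>+t. (\<integral>\<^sup>+d. ?K d t \<partial>coords n) \<partial>lborel)
    = (\<integral>\<^sup>+d. (\<integral>\<^sup>+t. ?K d t \<partial>lborel) \<partial>coords n)"
    by (intro nn_integral_coords_swap[symmetric] sigma_finite_coords sigma_finite_lborel) measurable
  also have "\<dots> = (\<integral>\<^sup>+d. of_nat (Suc n) * (\<integral>\<^sup>+y. H (d(n := y)) \<partial>lborel) \<partial>coords n)"
    by (intro nn_integral_cong nn_integral_const_of_root Hm) (auto simp: H_def)
  also have "\<dots> = of_nat (Suc n) * (\<integral>\<^sup>+d. (\<integral>\<^sup>+y. H (d(n := y)) \<partial>lborel) \<partial>coords n)"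
    by (rule nn_integral_cmult) measurable
  also have "(\<integral>\<^sup>+d. (\<integral>\<^sup>+y. H (d(n := y)) \<partial>lborel) \<partial>coords n) = (\<integral>\<^sup>+c. H c \<partial>coords (Suc n))"
    by (rule nn_integral_coords_Suc[OF Hm, symmetric])
  also have "of_nat (fact n) * (of_nat (Suc n) * (\<integral>\<^sup>+c. H c \<partial>coords (Suc n)))
    = of_nat (fact (Suc n)) * (\<integral>\<^sup>+c. H c \<partial>coords (Suc n))"
    by (simp only: fact_Suc of_nat_mult of_nat_id mult_ac)
  finally show ?case unfolding H_def .
qed

section \<open>Lagrange interpolation and the Dirichlet integral\<close>

text \<open>The polynomial \<open>\<Sum>\<^sub>i m\<^sub>i \<Prod>\<^bsub>j \<noteq> i\<^esub> (X - x\<^sub>j)\<close> over the nodes \<open>x\<^sub>0, \<dots>, x\<^sub>d\<close>, with the mass at \<open>x\<^sub>0\<close> chosen so that the total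
  mass, which is the leading coefficient, equals \<open>s\<close>. The recursion splits off the last node, which lets
  the Jacobian be computed one coordinate at a time.\<close>

primrec lagrange_poly :: "real \<Rightarrow> (nat \<Rightarrow> real) \<Rightarrow> nat \<Rightarrow> (nat \<Rightarrow> real) \<Rightarrow> real poly" where
  "lagrange_poly s x 0 m = [:s:]"
| "lagrange_poly s x (Suc d) m =
     [:- x (Suc d), 1:] * lagrange_poly (s - m d) x d m + smult (m d) (root_poly (Suc d) x)"

definition mass :: "real \<Rightarrow> nat \<Rightarrow> (nat \<Rightarrow> real) \<Rightarrow> nat \<Rightarrow> real" where
  "mass s d m i = (if i = 0 then s - (\<Sum>j<d. m j) else m (i - 1))"

lemma poly_lagrange_poly:
  "i \<le> d \<Longrightarrow> poly (lagrange_poly s x d m) (x i) = mass s d m i * (\<Prod>j\<in>{..<Suc d} - {i}. x i - x j)"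
proof (induction d arbitrary: s)
  case 0
  then show ?case by (simp add: mass_def)
next
  case (Suc d)
  show ?case
  proof (cases "i = Suc d")
    case True
    have "{..<Suc (Suc d)} - {i} = {..<Suc d}" using True by auto
    then show ?thesis using True by (simp add: mass_def poly_root_poly del: prod.lessThan_Suc)
  next
    case False
    then have i: "i \<le> d" using Suc.prems by simp
    have s: "{..<Suc (Suc d)} - {i} = insert (Suc d) ({..<Suc d} - {i})" using i by auto
    have e: "(\<Prod>j\<in>{..<Suc (Suc d)} - {i}. x i - x j) = (x i - x (Suc d)) * (\<Prod>j\<in>{..<Suc d} - {i}. x i - x j)"
      unfolding s by (subst prod.insert) auto
    have "poly (root_poly (Suc d) x) (x i) = 0" using i by (intro poly_root_poly_root) simp
    moreover have "mass (s - m d) d m i = mass s (Suc d) m i" by (simp add: mass_def)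
    ultimately show ?thesis using Suc.IH[OF i, of "s - m d"] unfolding e by (simp add: algebra_simps del: prod.lessThan_Suc)
  qed
qed

lemma lagrange_poly_cong: "(\<And>i. i < d \<Longrightarrow> m i = m' i) \<Longrightarrow> lagrange_poly s x d m = lagrange_poly s x d m'"
  by (induction d arbitrary: s) auto

lemma coeff_lagrange_poly: "coeff (lagrange_poly s x d m) d = s \<and> degree (lagrange_poly s x d m) \<le> d"
proof (induction d arbitrary: s)
  case (Suc d)
  let ?q = "lagrange_poly (s - m d) x d m"
  have q: "coeff ?q d = s - m d" "degree ?q \<le> d" using Suc.IH by auto
  have "coeff ?q (Suc d) = 0" using q by (intro coeff_eq_0) simp
  then have 1: "coeff (lagrange_poly s x (Suc d) m) (Suc d) = s"
    by (simp add: q coeff_root_poly)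
  have "degree ([:- x (Suc d), 1:] * ?q) \<le> Suc d"
    using degree_mult_le[of "[:- x (Suc d), 1:]" ?q] q by simp
  then have "degree (lagrange_poly s x (Suc d) m) \<le> Suc d"
    unfolding lagrange_poly.simps
    by (intro degree_add_le) (auto intro: order_trans[OF degree_smult_le] simp: degree_root_poly)
  with 1 show ?case by blast
qed simp

definition lagrange_coord :: "real \<Rightarrow> (nat \<Rightarrow> real) \<Rightarrow> nat \<Rightarrow> (nat \<Rightarrow> real) \<Rightarrow> nat \<Rightarrow> real" where
  "lagrange_coord s x d m = (\<lambda>i\<in>{..<d}. coeff (lagrange_poly s x d m) (d - 1 - i))"

lemma cpoly_lagrange_coord: "cpoly s d (lagrange_coord s x d m) = lagrange_poly s x d m"
proof -
  have "cpoly s d (lagrange_coord s x d m) = cpoly s d (\<lambda>i. coeff (lagrange_poly s x d m) (d - 1 - i))"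
    by (rule cpoly_cong) (simp add: lagrange_coord_def)
  then show ?thesis using cpoly_of_coeff[of "lagrange_poly s x d m" d] coeff_lagrange_poly[of s x d m] by simp
qed

lemma measurable_lagrange_coord [measurable (raw)]:
  assumes f: "f \<in> N \<rightarrow>\<^sub>M coords d" and g: "g \<in> borel_measurable N"
  shows "(\<lambda>z. lagrange_coord (g z) x d (f z)) \<in> N \<rightarrow>\<^sub>M coords d"
proof -
  have "k \<le> d \<Longrightarrow> g' \<in> borel_measurable N \<Longrightarrow> (\<lambda>z. coeff (lagrange_poly (g' z) x k (f z)) j) \<in> borel_measurable N" for k j g'
  proof (induction k arbitrary: j g')
    case 0
    then show ?case by (cases j) (auto simp: coeff_pCons)
  next
    case (Suc k)
    have fk[measurable]: "(\<lambda>z. f z k) \<in> borel_measurable N" using Suc.prems by (intro measurable_coord_app[OF f]) simp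
    have [measurable]: "(\<lambda>z. coeff ([:- x (Suc k), 1:] * lagrange_poly (g' z - f z k) x k (f z)) j) \<in> borel_measurable N"
      using Suc.prems fk by (intro borel_measurable_coeff_mult Suc.IH borel_measurable_diff) auto
    show ?case unfolding lagrange_poly.simps coeff_add coeff_smult by measurable
  qed
  then show ?thesis using g by (intro coordsI) (auto simp: lagrange_coord_def)
qed

lemma lagrange_coord_Suc:
  fixes x :: "nat \<Rightarrow> real" and \<mu> s :: real and d :: nat
  defines "t \<equiv> x (Suc d)"
  defines "D \<equiv> (\<lambda>r. \<lambda>i\<in>{..<d}. r i - t * (if i = 0 then s - \<mu> else r (i - 1)) + \<mu> * vieta (Suc d) x i)"
  shows "lagrange_coord s x (Suc d) (m(d := \<mu>)) =
    (let r = D (lagrange_coord (s - \<mu>) x d m)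
     in r(d := - (t * poly (cpoly s d r) t) + poly (root_poly (Suc d) x) t * \<mu>))"
proof -
  define r where "r = lagrange_coord (s - \<mu>) x d m"
  define L where "L = lagrange_coord s x (Suc d) (m(d := \<mu>))"
  have "lagrange_poly (s - \<mu>) x d (m(d := \<mu>)) = lagrange_poly (s - \<mu>) x d m"
    by (rule lagrange_poly_cong) simp
  then have L: "cpoly s (Suc d) L = [:- t, 1:] * cpoly (s - \<mu>) d r + smult \<mu> (root_poly (Suc d) x)"
    unfolding L_def r_def cpoly_lagrange_coord t_def lagrange_poly.simps(2) by simp
  also have "\<dots> = cpoly s (Suc d) (\<lambda>i. mul_linear (s - \<mu>) d r t i + \<mu> * vieta (Suc d) x i)"
    unfolding cpoly_mul_linear[symmetric] cpoly_vieta[symmetric] cpoly_smult cpoly_add by simp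
  finally have e: "L i = mul_linear (s - \<mu>) d r t i + \<mu> * vieta (Suc d) x i" if "i < Suc d" for i
    using cpoly_inj that by blast
  have "L i = ((D r)(d := L d)) i" for i
    using e[of i] by (auto simp: D_def mul_linear_def L_def lagrange_coord_def)
  then have Lu: "L = (D r)(d := L d)" by blast
  have "poly (cpoly s (Suc d) L) t = \<mu> * poly (root_poly (Suc d) x) t"
    unfolding L by simp
  then have "t * poly (cpoly s d (D r)) t + L d = \<mu> * poly (root_poly (Suc d) x) t"
    by (subst (asm) Lu) (simp only: poly_cpoly_upd)
  then have "L d = - (t * poly (cpoly s d (D r)) t) + poly (root_poly (Suc d) x) t * \<mu>" by (simp add: algebra_simps)
  then show ?thesis using Lu unfolding Let_def r_def[symmetric] L_def[symmetric] by simp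
qed

text \<open>As for the Vieta map: for fixed mass \<open>\<mu>\<close> at the last node the other masses enter through a shear, with total
  mass \<open>s - \<mu>\<close>, and the last coefficient is an affine function of \<open>\<mu>\<close> whose slope is the value at the last node of the
  polynomial of the preceding ones.\<close>

theorem nn_integral_lagrange:
  assumes "G \<in> borel_measurable (coords d)" and "vandermonde (Suc d) x \<noteq> 0"
  shows "ennreal \<bar>vandermonde (Suc d) x\<bar> * (\<integral>\<^sup>+m. G (lagrange_coord s x d m) \<partial>coords d) = (\<integral>\<^sup>+r. G r \<partial>coords d)"
  using assms
proof (induction d arbitrary: s G)
  case 0
  have "lagrange_coord s x 0 (\<lambda>_. undefined) = (\<lambda>_. undefined)" by (auto simp: lagrange_coord_def)
  then show ?case unfolding nn_integral_coords_0 by (simp add: vandermonde_def)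
next
  case (Suc d)
  note [measurable] = Suc.prems(1)
  define t where "t = x (Suc d)"
  define \<rho> where "\<rho> = poly (root_poly (Suc d) x) t"
  have v: "vandermonde (Suc (Suc d)) x = vandermonde (Suc d) x * \<rho>" by (simp add: vandermonde_Suc \<rho>_def t_def)
  have v0: "vandermonde (Suc d) x \<noteq> 0" and \<rho>0: "\<rho> \<noteq> 0" using Suc.prems(2) v by auto
  let ?V = "ennreal \<bar>vandermonde (Suc d) x\<bar>" and ?I = "\<lambda>\<mu>. \<integral>\<^sup>+m. G (lagrange_coord s x (Suc d) (m(d := \<mu>))) \<partial>coords d"
  let ?U = "\<lambda>\<mu> r. r(d := - (t * poly (cpoly s d r) t) + \<rho> * \<mu>)"
  let ?D = "\<lambda>\<mu> r. \<lambda>i\<in>{..<d}. r i - t * (if i = 0 then s - \<mu> else r (i - 1)) + \<mu> * vieta (Suc d) x i"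
  have U: "lagrange_coord s x (Suc d) (m(d := \<mu>)) = ?U \<mu> (?D \<mu> (lagrange_coord (s - \<mu>) x d m))" for m \<mu>
    unfolding lagrange_coord_Suc Let_def t_def \<rho>_def ..
  have Dm: "?D \<mu> \<in> coords d \<rightarrow>\<^sub>M coords d" for \<mu>
  proof (rule coordsI)
    fix i assume i: "i < d"
    have [measurable]: "(\<lambda>r. r i) \<in> borel_measurable (coords d)"
      "(\<lambda>r. if i = 0 then s - \<mu> else r (i - 1)) \<in> borel_measurable (coords d)"
      using i measurable_pred_coord[of i d "s - \<mu>"] by simp_all
    have "(\<lambda>r. r i - t * (if i = 0 then s - \<mu> else r (i - 1)) + \<mu> * vieta (Suc d) x i) \<in> borel_measurable (coords d)"
      by measurable
    then show "(\<lambda>r. ?D \<mu> r i) \<in> borel_measurable (coords d)" using i by simp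
  qed simp
  have Um: "?U \<mu> \<in> coords d \<rightarrow>\<^sub>M coords (Suc d)" for \<mu>
    by measurable
  have inner: "?V * ?I \<mu>
     = (\<integral>\<^sup>+r. G (?U \<mu> r) \<partial>coords d)" for \<mu>
  proof -
    have "?V * ?I \<mu>
      = (\<integral>\<^sup>+r. G (?U \<mu> (?D \<mu> r)) \<partial>coords d)"
      unfolding U by (rule Suc.IH[OF _ v0]) (rule measurable_compose[OF measurable_compose[OF Dm Um] Suc.prems(1)])
    also have "\<dots> = (\<integral>\<^sup>+r. G (?U \<mu> r) \<partial>coords d)"
      by (rule nn_integral_coords_shear) (rule measurable_compose[OF Um Suc.prems(1)])
    finally show ?thesis .
  qed
  have "ennreal \<bar>vandermonde (Suc (Suc d)) x\<bar> * (\<integral>\<^sup>+m. G (lagrange_coord s x (Suc d) m) \<partial>coords (Suc d))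
    = ennreal \<bar>\<rho>\<bar> * (?V * (\<integral>\<^sup>+\<mu>. ?I \<mu> \<partial>lborel))"
    unfolding v by (subst nn_integral_coords_Suc_rev) (measurable, simp add: abs_mult ennreal_mult mult_ac)
  also have "?V * (\<integral>\<^sup>+\<mu>. ?I \<mu> \<partial>lborel)
     = (\<integral>\<^sup>+\<mu>. (\<integral>\<^sup>+r. G (?U \<mu> r) \<partial>coords d) \<partial>lborel)"
    unfolding inner[symmetric]
    by (rule nn_integral_cmult[symmetric]) (intro sigma_finite_measure.borel_measurable_nn_integral sigma_finite_coords, measurable)
  also have "\<dots> = (\<integral>\<^sup>+r. (\<integral>\<^sup>+\<mu>. G (?U \<mu> r) \<partial>lborel) \<partial>coords d)"
    by (intro nn_integral_coords_swap[symmetric] sigma_finite_coords sigma_finite_lborel) measurable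
  also have "ennreal \<bar>\<rho>\<bar> * \<dots> = (\<integral>\<^sup>+r. ennreal \<bar>\<rho>\<bar> * (\<integral>\<^sup>+\<mu>. G (?U \<mu> r) \<partial>lborel) \<partial>coords d)"
    by (rule nn_integral_cmult[symmetric]) measurable
  also have "\<dots> = (\<integral>\<^sup>+r. (\<integral>\<^sup>+y. G (r(d := y)) \<partial>lborel) \<partial>coords d)"
  proof (intro nn_integral_cong)
    fix r assume r: "r \<in> space (coords d)"
    show "ennreal \<bar>\<rho>\<bar> * (\<integral>\<^sup>+\<mu>. G (?U \<mu> r) \<partial>lborel) = (\<integral>\<^sup>+y. G (r(d := y)) \<partial>lborel)"
      using r by (intro nn_integral_real_affine[OF _ \<rho>0, symmetric]) measurable
  qed
  also have "\<dots> = (\<integral>\<^sup>+r. G r \<partial>coords (Suc d))"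
    by (rule nn_integral_coords_Suc[OF Suc.prems(1), symmetric])
  finally show ?case .
qed

text \<open>Every difference occurs twice, once for each order of its nodes: this is the discriminant.\<close>

lemma prod_differences:
  "(\<Prod>i<n. \<Prod>j\<in>{..<n} - {i}. \<bar>x i - x j\<bar>) = (vandermonde n x)\<^sup>2"
proof (induction n)
  case 0
  then show ?case by (simp add: vandermonde_def)
next
  case (Suc n)
  have "(\<Prod>j\<in>{..<Suc n} - {i}. \<bar>x i - x j\<bar>) = \<bar>x i - x n\<bar> * (\<Prod>j\<in>{..<n} - {i}. \<bar>x i - x j\<bar>)" if "i < n" for i
  proof -
    have "{..<Suc n} - {i} = insert n ({..<n} - {i})" using that by auto
    then show ?thesis by (simp add: prod.insert)
  qed
  then have 1: "(\<Prod>i<n. \<Prod>j\<in>{..<Suc n} - {i}. \<bar>x i - x j\<bar>)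
      = (\<Prod>i<n. \<bar>x i - x n\<bar>) * (\<Prod>i<n. \<Prod>j\<in>{..<n} - {i}. \<bar>x i - x j\<bar>)"
    by (simp add: prod.distrib)
  have 2: "{..<Suc n} - {n} = {..<n}" by auto
  have 3: "(\<Prod>i<n. \<bar>x i - x n\<bar>) = \<bar>poly (root_poly n x) (x n)\<bar>" "(\<Prod>i<n. \<bar>x n - x i\<bar>) = \<bar>poly (root_poly n x) (x n)\<bar>"
    unfolding poly_root_poly abs_prod by (simp_all add: abs_minus_commute)
  have "(\<Prod>i<Suc n. \<Prod>j\<in>{..<Suc n} - {i}. \<bar>x i - x j\<bar>)
     = (\<Prod>i<n. \<Prod>j\<in>{..<Suc n} - {i}. \<bar>x i - x j\<bar>) * (\<Prod>j<n. \<bar>x n - x j\<bar>)"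
    by (subst prod.lessThan_Suc) (simp only: 2)
  also have "\<dots> = (vandermonde (Suc n) x)\<^sup>2"
    unfolding 1 3 Suc.IH vandermonde_Suc by (simp add: power2_eq_square mult_ac)
  finally show ?case .
qed

lemma sign_prod_differences:
  fixes x :: "nat \<Rightarrow> real"
  assumes "strict_mono_on {..n} x" "i \<le> n"
  shows "0 < (-1) ^ (n - i) * (\<Prod>j\<in>{..<Suc n} - {i}. x i - x j)"
proof -
  have s: "{..<Suc n} - {i} = {..<i} \<union> {i<..n}" using assms(2) by auto
  have "(\<Prod>j\<in>{..<Suc n} - {i}. x i - x j) = (\<Prod>j<i. x i - x j) * (\<Prod>j\<in>{i<..n}. x i - x j)"
    unfolding s by (intro prod.union_disjoint) auto
  also have "(\<Prod>j\<in>{i<..n}. x i - x j) = (\<Prod>j\<in>{i<..n}. (-1) * (x j - x i))" by simp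
  also have "\<dots> = (-1) ^ (n - i) * (\<Prod>j\<in>{i<..n}. x j - x i)" by (subst prod.distrib) simp
  finally have "(-1) ^ (n - i) * (\<Prod>j\<in>{..<Suc n} - {i}. x i - x j)
      = ((-1) ^ (n - i) * (-1) ^ (n - i)) * ((\<Prod>j<i. x i - x j) * (\<Prod>j\<in>{i<..n}. x j - x i))"
    by (simp only: mult_ac)
  moreover have "0 < (\<Prod>j<i. x i - x j) * (\<Prod>j\<in>{i<..n}. x j - x i)"
    using strict_mono_onD[OF assms(1)] assms(2) by (intro mult_pos_pos prod_pos) auto
  ultimately show ?thesis unfolding neg_one_pow_sq by simp
qed

text \<open>An unnormalised Dirichlet integral over the simplex of weights. All that matters about its value is that it
  does not involve the nodes.\<close>

definition dirichlet_mass :: "nat \<Rightarrow> real \<Rightarrow> ennreal" where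
  "dirichlet_mass n \<kappa> = (\<integral>\<^sup>+m. ennreal (\<Prod>i<Suc n. \<bar>mass 1 n m i\<bar> powr \<kappa>) * indicator {m. \<forall>i<Suc n. 0 < mass 1 n m i} m \<partial>coords n)"

text \<open>In terms of the masses, \<open>Q(x\<^sub>i) = m\<^sub>i P'(x\<^sub>i)\<close> and the sign conditions say \<open>m\<^sub>i > 0\<close>. The factors
  \<open>\<bar>P'(x\<^sub>i)\<bar>\<^sup>\<kappa>\<close> multiply to \<open>\<bar>\<Delta>\<bar>\<close> to the power \<open>2\<kappa>\<close>, and the interpolation map contributes another \<open>\<bar>\<Delta>\<bar>\<close>.\<close>

lemma nn_integral_second_poly:
  fixes x :: "nat \<Rightarrow> real"
  assumes x: "strict_mono_on {..n} x"
  shows "(\<integral>\<^sup>+r. ennreal (\<Prod>i<Suc n. \<bar>poly (cpoly 1 n r) (x i)\<bar> powr \<kappa>) *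
      indicator {r. \<forall>i<Suc n. 0 < (-1) ^ (n - i) * poly (cpoly 1 n r) (x i)} r \<partial>coords n)
    = ennreal (\<bar>vandermonde (Suc n) x\<bar> powr (1 + 2 * \<kappa>)) * dirichlet_mass n \<kappa>"
proof -
  let ?L = "\<lambda>m i. poly (cpoly 1 n (lagrange_coord 1 x n m)) (x i)" and ?D = "\<lambda>m. \<Prod>i<Suc n. \<bar>mass 1 n m i\<bar> powr \<kappa>"
  define w where "w i = (\<Prod>j\<in>{..<Suc n} - {i}. x i - x j)" for i
  define V where "V = \<bar>vandermonde (Suc n) x\<bar>"
  have ws: "0 < (-1) ^ (n - i) * w i" if "i < Suc n" for i
    using sign_prod_differences[OF x, of i] that by (simp add: w_def)
  have wV: "(\<Prod>i<Suc n. \<bar>w i\<bar>) = V\<^sup>2" using prod_differences[where n="Suc n" and x=x] by (simp add: w_def abs_prod V_def del: prod.lessThan_Suc)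
  have "w i \<noteq> 0" if "i < Suc n" for i using ws[OF that] by auto
  then have "(\<Prod>i<Suc n. \<bar>w i\<bar>) \<noteq> 0" by (simp del: prod.lessThan_Suc)
  then have V0: "vandermonde (Suc n) x \<noteq> 0" "0 < V" unfolding wV by (auto simp: V_def)
  define G where "G r = ennreal (\<Prod>i<Suc n. \<bar>poly (cpoly 1 n r) (x i)\<bar> powr \<kappa>) *
      indicator {r. \<forall>i<Suc n. 0 < (-1) ^ (n - i) * poly (cpoly 1 n r) (x i)} r" for r
  have [measurable]: "(\<lambda>r. poly (cpoly 1 n r) (x i)) \<in> borel_measurable (coords n)" for i
    by (rule measurable_poly_cpoly) auto
  have Gm: "G \<in> borel_measurable (coords n)" unfolding G_def by measurable
  have GL: "G (lagrange_coord 1 x n m) = ennreal (V powr (2 * \<kappa>)) *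
      (ennreal (?D m) * indicator {m. \<forall>i<Suc n. 0 < mass 1 n m i} m)" for m
  proof -
    have v: "?L m i = mass 1 n m i * w i" if "i < Suc n" for i
      using that by (simp add: cpoly_lagrange_coord poly_lagrange_poly w_def del: prod.lessThan_Suc)
    have s: "0 < (-1) ^ (n - i) * ?L m i \<longleftrightarrow> 0 < mass 1 n m i" if "i < Suc n" for i
    proof -
      have "(-1) ^ (n - i) * ?L m i = mass 1 n m i * ((-1) ^ (n - i) * w i)"
        using v[OF that] by simp
      then show ?thesis using ws[OF that] by (metis zero_less_mult_pos2 mult_pos_pos)
    qed
    have "(\<Prod>i<Suc n. \<bar>?L m i\<bar> powr \<kappa>)
      = (\<Prod>i<Suc n. \<bar>mass 1 n m i\<bar> powr \<kappa> * \<bar>w i\<bar> powr \<kappa>)"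
      by (intro prod.cong refl) (auto simp: v abs_mult powr_mult)
    also have "\<dots> = (?D m) * (\<Prod>i<Suc n. \<bar>w i\<bar> powr \<kappa>)"
      by (rule prod.distrib)
    also have "(\<Prod>i<Suc n. \<bar>w i\<bar> powr \<kappa>) = (\<Prod>i<Suc n. \<bar>w i\<bar>) powr \<kappa>"
      by (rule prod_powr_distrib[symmetric])
    also have "\<dots> = V powr (2 * \<kappa>)" unfolding wV using V0(2)
      by (simp add: powr_powr[symmetric] powr_numeral)
    finally have p: "(\<Prod>i<Suc n. \<bar>?L m i\<bar> powr \<kappa>)
      = V powr (2 * \<kappa>) * (?D m)" by simp
    have i: "indicator {r. \<forall>i<Suc n. 0 < (-1) ^ (n - i) * poly (cpoly 1 n r) (x i)} (lagrange_coord 1 x n m)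
      = (indicator {m. \<forall>i<Suc n. 0 < mass 1 n m i} m :: ennreal)"
      using s by (simp add: indicator_def)
    have "0 \<le> (?D m)" by (intro prod_nonneg) simp
    then show ?thesis unfolding G_def p i by (simp add: ennreal_mult mult.assoc del: prod.lessThan_Suc)
  qed
  have mm: "(\<lambda>m. mass 1 n m i) \<in> borel_measurable (coords n)" if "i < Suc n" for i
    using that unfolding mass_def by (cases i) auto
  have mp: "(\<lambda>m. \<Prod>i<Suc n. \<bar>mass 1 n m i\<bar> powr \<kappa>) \<in> borel_measurable (coords n)"
    by (intro borel_measurable_prod powr_real_measurable borel_measurable_abs mm) auto
  have pm: "Measurable.pred (coords n) (\<lambda>m. \<forall>i<Suc n. 0 < mass 1 n m i)"
  proof -
    have "Measurable.pred (coords n) (\<lambda>m. \<forall>i\<in>{..<Suc n}. 0 < mass 1 n m i)"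
      by (intro pred_intros_finite borel_measurable_pred_less borel_measurable_const mm) auto
    then show ?thesis by (simp only: Ball_def lessThan_iff)
  qed
  have "(\<integral>\<^sup>+r. G r \<partial>coords n) = ennreal V * (\<integral>\<^sup>+m. G (lagrange_coord 1 x n m) \<partial>coords n)"
    unfolding V_def by (rule nn_integral_lagrange[OF Gm V0(1), symmetric])
  also have "(\<integral>\<^sup>+m. G (lagrange_coord 1 x n m) \<partial>coords n) = ennreal (V powr (2 * \<kappa>)) * dirichlet_mass n \<kappa>"
    unfolding GL dirichlet_mass_def
  proof (rule nn_integral_cmult, rule borel_measurable_times_ennreal)
    show "(\<lambda>m. ennreal (?D m)) \<in> borel_measurable (coords n)"
      using mp by (rule measurable_compose) simp
    show "indicator {m. \<forall>i<Suc n. 0 < mass 1 n m i} \<in> borel_measurable (coords n)"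
      by (rule borel_measurable_indicator') (use pm in \<open>simp only: pred_def mem_Collect_eq\<close>)
  qed
  also have "ennreal V * (ennreal (V powr (2 * \<kappa>)) * dirichlet_mass n \<kappa>) = ennreal (V powr (1 + 2 * \<kappa>)) * dirichlet_mass n \<kappa>"
    using V0(2) by (simp add: powr_add ennreal_mult mult.assoc)
  finally show ?thesis unfolding G_def V_def .
qed

section \<open>The density of interlacing pairs under one step\<close>

abbreviation pair_coords :: "nat \<Rightarrow> ((nat \<Rightarrow> real) \<times> (nat \<Rightarrow> real)) measure" where
  "pair_coords n \<equiv> coords (Suc n) \<Otimes>\<^sub>M coords n"

definition pair_admissible :: "nat \<Rightarrow> (nat \<Rightarrow> real) \<times> (nat \<Rightarrow> real) \<Rightarrow> bool" where
  "pair_admissible n z \<longleftrightarrow> admissible n (cpoly 1 (Suc n) (fst z)) (cpoly 1 n (snd z)) (sorted_root (cpoly 1 (Suc n) (fst z)))"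

lemma admissible_sorted_root:
  assumes "admissible n P Q x" "i \<le> n" shows "sorted_root P i = x i"
  using assms sorted_root_root_poly[of "Suc n" x i] unfolding admissible_def lessThan_Suc_atMost by auto

lemma pair_admissible_iff: "pair_admissible n z \<longleftrightarrow> (\<exists>x. admissible n (cpoly 1 (Suc n) (fst z)) (cpoly 1 n (snd z)) x)"
proof
  assume "\<exists>x. admissible n (cpoly 1 (Suc n) (fst z)) (cpoly 1 n (snd z)) x"
  then obtain x where x: "admissible n (cpoly 1 (Suc n) (fst z)) (cpoly 1 n (snd z)) x" by blast
  let ?r = "sorted_root (cpoly 1 (Suc n) (fst z))"
  note e = admissible_sorted_root[OF x]
  have "root_poly (Suc n) ?r = root_poly (Suc n) x" by (rule root_poly_cong) (rule e, simp)
  moreover have "strict_mono_on {..n} ?r"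
  proof (rule strict_mono_onI)
    fix r s assume rs: "r \<in> {..n}" "s \<in> {..n}" "r < s"
    have "strict_mono_on {..n} x" using x unfolding admissible_def by blast
    then have "x r < x s" using rs by (rule strict_mono_onD)
    then show "?r r < ?r s" using e[of r] e[of s] rs by (simp only: atMost_iff)
  qed
  ultimately show "pair_admissible n z" using x e unfolding pair_admissible_def admissible_def by (simp del: cpoly.simps)
qed (auto simp: pair_admissible_def)

lemma measurable_pair_admissible: "Measurable.pred (pair_coords n) (pair_admissible n)"
proof -
  let ?r = "\<lambda>z. sorted_root (cpoly 1 (Suc n) (fst z))"
  have e: "pair_admissible n z \<longleftrightarrow> real_split (Suc n) (cpoly 1 (Suc n) (fst z)) \<and>
      (\<forall>i\<in>{..n}. \<bar>?r z i\<bar> < 2 \<and> 0 < (-1) ^ (n - i) * poly (cpoly 1 n (snd z)) (?r z i))" for z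
    unfolding pair_admissible_def admissible_def
    by (metis atMost_iff lessThan_Suc_atMost real_splitD real_split_def)
  have [measurable]: "(\<lambda>z. ?r z i) \<in> borel_measurable (pair_coords n)" for i
    using measurable_compose[OF measurable_fst measurable_sorted_root] .
  have [measurable]: "(\<lambda>z. poly (cpoly 1 n (snd z)) (?r z i)) \<in> borel_measurable (pair_coords n)" for i
    by (rule measurable_poly_cpoly) measurable
  have 1: "Measurable.pred (pair_coords n) (\<lambda>z. real_split (Suc n) (cpoly 1 (Suc n) (fst z)))"
    using measurable_compose[OF measurable_fst measurable_real_split] .
  have 2: "Measurable.pred (pair_coords n) (\<lambda>z. \<bar>?r z i\<bar> < 2 \<and> 0 < (-1) ^ (n - i) * poly (cpoly 1 n (snd z)) (?r z i))" for i
    by measurable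
  show ?thesis unfolding e by (intro pred_intros_logic 1 pred_intros_finite 2) simp
qed

definition pair_density :: "nat \<Rightarrow> real \<Rightarrow> real \<Rightarrow> real \<Rightarrow> (nat \<Rightarrow> real) \<times> (nat \<Rightarrow> real) \<Rightarrow> real" where
  "pair_density n \<kappa> a b z = (if pair_admissible n z then
     \<bar>poly (cpoly 1 (Suc n) (fst z)) 2\<bar> powr a * \<bar>poly (cpoly 1 (Suc n) (fst z)) (-2)\<bar> powr b *
     (\<Prod>i<Suc n. \<bar>poly (cpoly 1 n (snd z)) (sorted_root (cpoly 1 (Suc n) (fst z)) i)\<bar> powr \<kappa>) else 0)"

lemma pair_density_nonneg: "0 \<le> pair_density n \<kappa> a b z"
  unfolding pair_density_def by (auto intro!: mult_nonneg_nonneg prod_nonneg)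

lemma measurable_pair_density: "pair_density n \<kappa> a b \<in> borel_measurable (pair_coords n)"
proof -
  let ?r = "\<lambda>z. sorted_root (cpoly 1 (Suc n) (fst z))"
  have r[measurable]: "(\<lambda>z. ?r z i) \<in> borel_measurable (pair_coords n)" for i
    using measurable_compose[OF measurable_fst measurable_sorted_root] .
  have 1: "(\<lambda>z. poly (cpoly 1 n (snd z)) (?r z i)) \<in> borel_measurable (pair_coords n)" for i
    by (rule measurable_poly_cpoly) measurable
  have 2: "(\<lambda>z. poly (cpoly 1 (Suc n) (fst z)) t) \<in> borel_measurable (pair_coords n)" for t
    by (rule measurable_poly_cpoly) measurable
  show ?thesis unfolding pair_density_def
    by (intro measurable_If measurable_pair_admissible[unfolded pred_def] borel_measurable_times borel_measurable_prod
        powr_real_measurable borel_measurable_abs 1 2 borel_measurable_const)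
qed

text \<open>The coefficients of \<open>stepQ\<close>, written as an affine function of \<open>p\<close>.\<close>

definition stepQ_coord :: "nat \<Rightarrow> real \<Rightarrow> real \<Rightarrow> (nat \<Rightarrow> real) \<Rightarrow> (nat \<Rightarrow> real) \<Rightarrow> nat \<Rightarrow> real" where
  "stepQ_coord n u c q p = (\<lambda>i\<in>{..<Suc n}. (1 - u) * mul_linear 1 n q (- 2 * c) i + u * p i)"

text \<open>The coefficients of \<open>(X - 2c) Q - k q\<close>. The first depends on \<open>c\<close> alone once \<open>Q\<close> is fixed, the second then on \<open>k\<close>, and the
  others form an affine function of \<open>q\<close>: this triangular form makes the Jacobian visible.\<close>

definition stepP_coord :: "nat \<Rightarrow> real \<Rightarrow> real \<Rightarrow> (nat \<Rightarrow> real) \<Rightarrow> (nat \<Rightarrow> real) \<Rightarrow> nat \<Rightarrow> real" where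
  "stepP_coord n k c Q q = cons_coord (Suc n) (Q 0 - 2 * c)
     (cons_coord n (mul_linear 1 (Suc n) Q (2 * c) 1 - k)
       (\<lambda>i\<in>{..<n}. mul_linear 1 (Suc n) Q (2 * c) (i + 2) + (- k) * q i))"

lemma cpoly_stepQ_coord:
  "cpoly 1 (Suc n) (stepQ_coord n u c q p) = stepQ u c (cpoly 1 (Suc n) p) (cpoly 1 n q)"
proof -
  have "cpoly 1 (Suc n) (stepQ_coord n u c q p)
      = cpoly ((1 - u) * 1 + u * 1) (Suc n) (\<lambda>i. (1 - u) * mul_linear 1 n q (- 2 * c) i + u * p i)"
    by (subst cpoly_cong[of "Suc n" "stepQ_coord n u c q p" "\<lambda>i. (1 - u) * mul_linear 1 n q (- 2 * c) i + u * p i"])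
      (auto simp: stepQ_coord_def)
  then show ?thesis
    unfolding cpoly_add[symmetric] cpoly_smult[symmetric] cpoly_mul_linear stepQ_def by (simp add: add.commute)
qed

lemma cpoly_stepP_coord:
  "cpoly 1 (Suc (Suc n)) (stepP_coord n k c Q q) = [:- 2 * c, 1:] * cpoly 1 (Suc n) Q - smult k (cpoly 1 n q)"
proof -
  let ?e = "\<lambda>i. if i = 0 then 0 else if i = 1 then 1 else q (i - 2)"
  have 1: "cpoly 0 (Suc (Suc n)) ?e = cpoly 1 n q"
    by (rule poly_eqI) (auto simp: coeff_cpoly simp del: cpoly.simps)
  have "cpoly 1 (Suc (Suc n)) (stepP_coord n k c Q q)
     = cpoly (1 + (- k) * 0) (Suc (Suc n)) (\<lambda>i. mul_linear 1 (Suc n) Q (2 * c) i + (- k) * ?e i)"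
  proof -
    have "stepP_coord n k c Q q i = mul_linear 1 (Suc n) Q (2 * c) i + (- k) * ?e i" if "i < Suc (Suc n)" for i
    proof -
      consider "i = 0" | "i = 1" | j where "i = j + 2" "j < n"
      proof -
        have "i = (i - 2) + 2 \<and> i - 2 < n" if "i \<noteq> 0" "i \<noteq> 1" using that \<open>i < Suc (Suc n)\<close> by linarith
        then show ?thesis using that by metis
      qed
      then show ?thesis
        by cases (auto simp: stepP_coord_def cons_coord_def mul_linear_def)
    qed
    then show ?thesis by (simp only: mult_zero_right add_0_right) (rule cpoly_cong)
  qed
  also have "\<dots> = [:- (2 * c), 1:] * cpoly 1 (Suc n) Q + smult (- k) (cpoly 1 n q)"
    unfolding cpoly_add[symmetric] cpoly_smult[symmetric] 1 cpoly_mul_linear ..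
  finally show ?thesis by simp
qed

text \<open>The squared off-diagonal entry \<open>a\<^sub>1\<^sup>2 = 2 (1 - \<alpha>\<^sub>0\<^sup>2) (1 + \<alpha>\<^sub>1)\<close> for \<open>v = \<alpha>\<^sub>1\<close> and \<open>c = \<alpha>\<^sub>0\<close>.\<close>

definition offdiag_sq :: "real \<Rightarrow> real \<Rightarrow> real" where "offdiag_sq v c = 2 * (1 + v) * (1 - c\<^sup>2)"

definition step_coord :: "nat \<Rightarrow> real \<times> real \<Rightarrow> (nat \<Rightarrow> real) \<times> (nat \<Rightarrow> real) \<Rightarrow> (nat \<Rightarrow> real) \<times> (nat \<Rightarrow> real)" where
  "step_coord n w z = (let Q = stepQ_coord n ((1 - fst w) / 2) (snd w) (snd z) (fst z)
     in (stepP_coord n (offdiag_sq (fst w) (snd w)) (snd w) Q (snd z), Q))"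

lemma cpoly_step_coord:
  "cpoly 1 (Suc n) (snd (step_coord n (v, c) (p, q))) = stepQ ((1 - v) / 2) c (cpoly 1 (Suc n) p) (cpoly 1 n q)"
  "cpoly 1 (Suc (Suc n)) (fst (step_coord n (v, c) (p, q))) = stepP ((1 - v) / 2) c (cpoly 1 (Suc n) p) (cpoly 1 n q)"
proof -
  have k: "offdiag_sq v c = 4 * (1 - (1 - v) / 2) * (1 - c\<^sup>2)" by (simp add: offdiag_sq_def field_simps)
  show "cpoly 1 (Suc n) (snd (step_coord n (v, c) (p, q))) = stepQ ((1 - v) / 2) c (cpoly 1 (Suc n) p) (cpoly 1 n q)"
    unfolding step_coord_def Let_def fst_conv snd_conv by (rule cpoly_stepQ_coord)
  show "cpoly 1 (Suc (Suc n)) (fst (step_coord n (v, c) (p, q))) = stepP ((1 - v) / 2) c (cpoly 1 (Suc n) p) (cpoly 1 n q)"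
    unfolding step_coord_def Let_def fst_conv snd_conv cpoly_stepP_coord cpoly_stepQ_coord k stepP_def by simp
qed

lemma pair_admissible_step_rev:
  assumes "pair_admissible (Suc n) (step_coord n (v, c) (p, q))"
  shows "\<bar>c\<bar> < 1" "\<bar>v\<bar> < 1" "pair_admissible n (p, q)"
proof -
  obtain x where x: "admissible (Suc n) (stepP ((1 - v) / 2) c (cpoly 1 (Suc n) p) (cpoly 1 n q))
      (stepQ ((1 - v) / 2) c (cpoly 1 (Suc n) p) (cpoly 1 n q)) x"
    using assms unfolding pair_admissible_iff cpoly_step_coord by blast
  have d: "degree (cpoly 1 (Suc n) p) = Suc n" "coeff (cpoly 1 (Suc n) p) (Suc n) = 1" "degree (cpoly 1 n q) = n" "coeff (cpoly 1 n q) n = 1"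
    by (simp_all add: degree_cpoly coeff_cpoly del: cpoly.simps)
  note r = step_admissible_rev[OF x d]
  show "\<bar>c\<bar> < 1" "pair_admissible n (p, q)" using r by (auto simp: pair_admissible_iff)
  show "\<bar>v\<bar> < 1" using r(2,3) by (simp add: field_simps abs_less_iff)
qed

lemma pair_admissible_step:
  assumes "\<bar>c\<bar> < 1" "\<bar>v\<bar> < 1"
  shows "pair_admissible (Suc n) (step_coord n (v, c) (p, q)) \<longleftrightarrow> pair_admissible n (p, q)"
proof
  assume "pair_admissible n (p, q)"
  then obtain y where y: "admissible n (cpoly 1 (Suc n) p) (cpoly 1 n q) y" by (auto simp: pair_admissible_iff)
  have u: "0 < (1 - v) / 2" "(1 - v) / 2 < 1" using assms by (auto simp: abs_less_iff)
  show "pair_admissible (Suc n) (step_coord n (v, c) (p, q))"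
    unfolding pair_admissible_iff cpoly_step_coord
    by (rule step_admissible[OF u assms(1) y]) (auto simp: degree_cpoly coeff_cpoly)
qed (rule pair_admissible_step_rev)

text \<open>The parameters of the law of \<open>\<alpha>\<^bsub>2n-2-m\<^esub>\<close>, which do not depend on \<open>n\<close>.\<close>

definition rev_param1 :: "real \<Rightarrow> real \<Rightarrow> real \<Rightarrow> nat \<Rightarrow> real" where
  "rev_param1 \<beta> a b m = (if even m then real m / 4 * \<beta> + a + 1 else (real m - 1) / 4 * \<beta> + a + b + 2)"

definition rev_param2 :: "real \<Rightarrow> real \<Rightarrow> real \<Rightarrow> nat \<Rightarrow> real" where
  "rev_param2 \<beta> a b m = (if even m then real m / 4 * \<beta> + b + 1 else (real m + 1) / 4 * \<beta>)"

text \<open>The Jacobian of \<open>(p, q, v, c) \<mapsto> (P, Q)\<close>: a factor \<open>u = (1 - v) / 2\<close> for each coefficient of \<open>p\<close>, a factor \<open>k\<close> for each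
  coefficient of \<open>q\<close>, and \<open>2 \<bar>1 - c\<^sup>2\<bar>\<close> and \<open>2\<close> for \<open>v\<close> and \<open>c\<close>.\<close>

definition step_jacobian :: "nat \<Rightarrow> real \<Rightarrow> real \<Rightarrow> real" where
  "step_jacobian n v c = ((1 - v) / 2) ^ Suc n * \<bar>offdiag_sq v c\<bar> ^ n * (4 * \<bar>1 - c\<^sup>2\<bar>)"

definition beta_const :: "real \<Rightarrow> real \<Rightarrow> real" where
  "beta_const s t = 2 powr (1 - s - t) * Gamma (s + t) / (Gamma s * Gamma t)"

lemma beta_const_pos: "0 < s \<Longrightarrow> 0 < t \<Longrightarrow> 0 < beta_const s t"
  by (simp add: beta_const_def Gamma_real_pos)

lemma beta_density_eq:
  "beta_density s t x = (if \<bar>x\<bar> < 1 then beta_const s t * ((1 - x) powr (s - 1) * (1 + x) powr (t - 1)) else 0)"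
proof -
  consider "\<bar>x\<bar> < 1" | "x = 1 \<or> x = -1" | "1 < \<bar>x\<bar>" by linarith
  then show ?thesis
    by cases (auto simp: beta_density_def beta_const_def indicator_def abs_less_iff)
qed

lemma rev_param_pos:
  assumes "\<beta> > 0" "a > -1" "b > -1"
  shows "0 < rev_param1 \<beta> a b m" "0 < rev_param2 \<beta> a b m"
proof -
  have 1: "0 \<le> real m / 4 * \<beta>" using assms by simp
  have 2: "0 \<le> (real m - 1) / 4 * \<beta>" "0 < (real m + 1) / 4 * \<beta>" if "odd m"
    using assms that by (auto intro!: mult_nonneg_nonneg simp: odd_pos Suc_leI)
  have "0 < rev_param1 \<beta> a b m \<and> 0 < rev_param2 \<beta> a b m"
  proof (cases "even m")
    case True
    have "0 < real m / 4 * \<beta> + a + 1" "0 < real m / 4 * \<beta> + b + 1" using 1 assms(2,3) by linarith+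
    then show ?thesis using True unfolding rev_param1_def rev_param2_def by (simp only: if_True simp_thms)
  next
    case False
    have "0 < (real m - 1) / 4 * \<beta> + a + b + 2" "0 < (real m + 1) / 4 * \<beta>" using 2[OF False] assms(2,3) by linarith+
    then show ?thesis using False unfolding rev_param1_def rev_param2_def by (simp only: if_False simp_thms)
  qed
  then show "0 < rev_param1 \<beta> a b m" "0 < rev_param2 \<beta> a b m" by blast+
qed

text \<open>In terms of \<open>u\<close>, \<open>1 - u\<close>, \<open>1 - c\<close> and \<open>1 + c\<close> both sides are monomials times the same function of \<open>(p, q)\<close>. Comparing
  exponents shows that the parameters of the beta distributions are exactly the ones that make
  the identity true; this is where their dependence on the index comes from.\<close>

lemma pair_density_step:
  assumes par: "\<beta> > 0" "a > -1" "b > -1" and \<kappa>: "\<kappa> = \<beta> / 2 - 1"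
  obtains C where "0 < C" "\<And>v c z. beta_density (rev_param1 \<beta> a b (2 * n + 1)) (rev_param2 \<beta> a b (2 * n + 1)) v *
      beta_density (rev_param1 \<beta> a b (2 * n + 2)) (rev_param2 \<beta> a b (2 * n + 2)) c * pair_density n \<kappa> a b z
    = C * (indicator {-1<..<1} v * indicator {-1<..<1} c * step_jacobian n v c * pair_density (Suc n) \<kappa> a b (step_coord n (v, c) z))"
proof -
  define s1 where "s1 = rev_param1 \<beta> a b (2 * n + 1)"
  define t1 where "t1 = rev_param2 \<beta> a b (2 * n + 1)"
  define s2 where "s2 = rev_param1 \<beta> a b (2 * n + 2)"
  define t2 where "t2 = rev_param2 \<beta> a b (2 * n + 2)"
  have st: "s1 = real n * \<beta> / 2 + a + b + 2" "t1 = real (Suc n) * \<beta> / 2"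
    "s2 = real (Suc n) * \<beta> / 2 + a + 1" "t2 = real (Suc n) * \<beta> / 2 + b + 1"
    by (simp_all add: s1_def t1_def s2_def t2_def rev_param1_def rev_param2_def field_simps)
  have pos: "0 < s1" "0 < t1" "0 < s2" "0 < t2" unfolding s1_def t1_def s2_def t2_def by (intro rev_param_pos par)+
  \<comment> \<open>The powers of \<open>2\<close> that the step contributes to the pair density and to its Jacobian.\<close>
  define D where "D = 2 powr a * 2 powr b * (4 ^ Suc n) powr \<kappa> * (4::real) ^ Suc n"
  define C where "C = beta_const s1 t1 * beta_const s2 t2 * 2 powr (s1 - 1) * 2 powr (t1 - 1) / D"
  have D0: "0 < D" by (simp add: D_def)
  have C0: "0 < C" using pos D0 by (simp add: C_def beta_const_pos)
  have CD: "C * D = beta_const s1 t1 * beta_const s2 t2 * 2 powr (s1 - 1) * 2 powr (t1 - 1)"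
    using D0 by (simp add: C_def)
  have *: "beta_density s1 t1 v * beta_density s2 t2 c * pair_density n \<kappa> a b (p, q)
    = C * (indicator {-1<..<1} v * indicator {-1<..<1} c * step_jacobian n v c * pair_density (Suc n) \<kappa> a b (step_coord n (v, c) (p, q)))"
    for v c p q
  proof (cases "\<bar>v\<bar> < 1 \<and> \<bar>c\<bar> < 1 \<and> pair_admissible n (p, q)")
    case False
    then consider "\<not> \<bar>v\<bar> < 1" | "\<not> \<bar>c\<bar> < 1" | "\<bar>v\<bar> < 1" "\<bar>c\<bar> < 1" "\<not> pair_admissible n (p, q)" by blast
    then show ?thesis
    proof cases
      case 1
      then have "beta_density s1 t1 v = 0" "indicator {-1<..<1} v = (0::real)"
        by (auto simp: beta_density_eq indicator_def)
      then show ?thesis by simp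
    next
      case 2
      then have "beta_density s2 t2 c = 0" "indicator {-1<..<1} c = (0::real)"
        by (auto simp: beta_density_eq indicator_def)
      then show ?thesis by simp
    next
      case 3
      then have "pair_density n \<kappa> a b (p, q) = 0" "pair_density (Suc n) \<kappa> a b (step_coord n (v, c) (p, q)) = 0"
        using pair_admissible_step[OF 3(2,1)] by (auto simp: pair_density_def)
      then show ?thesis by simp
    qed
  next
    case True
    then have v: "\<bar>v\<bar> < 1" and c: "\<bar>c\<bar> < 1" and adm: "pair_admissible n (p, q)" by auto
    have adm': "pair_admissible (Suc n) (step_coord n (v, c) (p, q))" using pair_admissible_step[OF c v] adm by blast
    define u where "u = (1 - v) / 2"
    define w where "w = 1 - u"
    define e where "e = 1 - c"
    define f where "f = 1 + c"
    have p0: "0 < u" "0 < w" "0 < e" "0 < f" using v c by (auto simp: u_def w_def e_def f_def abs_less_iff)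
    have vu: "1 - v = 2 * u" "1 + v = 2 * w" by (simp_all add: u_def w_def field_simps)
    have ef: "1 - c\<^sup>2 = e * f" by (simp add: e_def f_def power2_eq_square algebra_simps)
    let ?p = "cpoly 1 (Suc n) p" and ?q = "cpoly 1 n q"
    let ?y = "sorted_root ?p"
    let ?P = "stepP u c ?p ?q" and ?Q = "stepQ u c ?p ?q"
    let ?x = "sorted_root ?P"
    have y: "admissible n ?p ?q ?y" using adm by (simp add: pair_admissible_def)
    have x: "admissible (Suc n) ?P ?Q ?x" using adm' unfolding pair_admissible_def cpoly_step_coord u_def .
    have u1: "u < 1" using p0 by (simp add: w_def)
    define R where "R = (\<Prod>i<Suc n. \<bar>poly ?q (?y i)\<bar>)"
    have Rp: "(\<Prod>i<Suc n. \<bar>poly ?q (?y i)\<bar> powr \<kappa>) = R powr \<kappa>"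
      unfolding R_def by (rule prod_powr_distrib[symmetric])
    have "(\<Prod>i<Suc (Suc n). \<bar>poly ?Q (?x i)\<bar> powr \<kappa>) = (\<Prod>i<Suc (Suc n). \<bar>poly ?Q (?x i)\<bar>) powr \<kappa>"
      by (rule prod_powr_distrib[symmetric])
    also have "(\<Prod>i<Suc (Suc n). \<bar>poly ?Q (?x i)\<bar>) = 4 ^ Suc n * u ^ n * w ^ Suc n * (e ^ Suc n * f ^ Suc n) * R"
      using step_weight[OF p0(1) u1 c y x] unfolding R_def w_def[symmetric] ef
      by (simp only: power_mult_distrib mult.assoc)
    also have "\<dots> powr \<kappa> = (4 ^ Suc n) powr \<kappa> * (u ^ n) powr \<kappa> * (w ^ Suc n) powr \<kappa> *
        ((e ^ Suc n) powr \<kappa> * (f ^ Suc n) powr \<kappa>) * R powr \<kappa>"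
      using p0 by (simp add: powr_mult prod_nonneg R_def del: power_Suc prod.lessThan_Suc)
    finally have Qp: "(\<Prod>i<Suc (Suc n). \<bar>poly ?Q (?x i)\<bar> powr \<kappa>) = \<dots>" .
    have "\<bar>poly ?P 2\<bar> = 2 * u * e * \<bar>poly ?p 2\<bar>"
      using p0 by (simp add: poly_stepP e_def abs_mult)
    then have P2: "\<bar>poly ?P 2\<bar> powr a = 2 powr a * u powr a * e powr a * \<bar>poly ?p 2\<bar> powr a"
      using p0 by (simp add: powr_mult)
    have "\<bar>poly ?P (-2)\<bar> = 2 * u * f * \<bar>poly ?p (-2)\<bar>"
    proof -
      have "poly ?P (-2) = - (2 * u * f) * poly ?p (-2)" by (simp add: poly_stepP f_def algebra_simps)
      then show ?thesis using p0 by (simp add: abs_mult)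
    qed
    then have Pm2: "\<bar>poly ?P (-2)\<bar> powr b = 2 powr b * u powr b * f powr b * \<bar>poly ?p (-2)\<bar> powr b"
      using p0 by (simp add: powr_mult)
    have pw: "t powr (real m * \<kappa> + r + real l) = (t ^ m) powr \<kappa> * t powr r * t ^ l" if "0 < t" for t r :: real and m l
      using that by (simp add: powr_add powr_powr powr_realpow[symmetric])
    have b1: "(1 - v) powr (s1 - 1) = 2 powr (s1 - 1) * ((u ^ n) powr \<kappa> * u powr (a + b) * u ^ Suc n)"
      unfolding vu powr_mult pw[OF p0(1), symmetric] by (simp add: st \<kappa> field_simps)
    have b2: "(1 + v) powr (t1 - 1) = 2 powr (t1 - 1) * ((w ^ Suc n) powr \<kappa> * w powr 0 * w ^ n)"
      unfolding vu powr_mult pw[OF p0(2), symmetric] by (simp add: st \<kappa> field_simps)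
    have b3: "(1 - c) powr (s2 - 1) = (e ^ Suc n) powr \<kappa> * e powr a * e ^ Suc n"
      unfolding e_def[symmetric] pw[OF p0(3), symmetric] by (simp add: st \<kappa> field_simps)
    have b4: "(1 + c) powr (t2 - 1) = (f ^ Suc n) powr \<kappa> * f powr b * f ^ Suc n"
      unfolding f_def[symmetric] pw[OF p0(4), symmetric] by (simp add: st \<kappa> field_simps)
    have j1: "pair_density n \<kappa> a b (p, q) = \<bar>poly ?p 2\<bar> powr a * \<bar>poly ?p (-2)\<bar> powr b * R powr \<kappa>"
      using adm unfolding pair_density_def fst_conv snd_conv Rp by simp
    have j2: "pair_density (Suc n) \<kappa> a b (step_coord n (v, c) (p, q)) =
       (2 powr a * u powr a * e powr a * \<bar>poly ?p 2\<bar> powr a) * (2 powr b * u powr b * f powr b * \<bar>poly ?p (-2)\<bar> powr b) *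
       ((4 ^ Suc n) powr \<kappa> * (u ^ n) powr \<kappa> * (w ^ Suc n) powr \<kappa> * ((e ^ Suc n) powr \<kappa> * (f ^ Suc n) powr \<kappa>) * R powr \<kappa>)"
      using adm' unfolding pair_density_def cpoly_step_coord u_def[symmetric] Qp P2 Pm2 by (simp only: if_True)
    have jc: "step_jacobian n v c = 4 ^ Suc n * u ^ Suc n * w ^ n * (e ^ Suc n * f ^ Suc n)"
    proof -
      have "offdiag_sq v c = 4 * w * (e * f)" unfolding offdiag_sq_def vu ef by simp
      then show ?thesis unfolding step_jacobian_def u_def[symmetric] ef
        using p0 by (simp add: abs_mult power_mult_distrib mult_ac)
    qed
    have bd: "beta_density s1 t1 v = beta_const s1 t1 * ((1 - v) powr (s1 - 1) * (1 + v) powr (t1 - 1))"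
      "beta_density s2 t2 c = beta_const s2 t2 * ((1 - c) powr (s2 - 1) * (1 + c) powr (t2 - 1))"
      using v c by (simp_all add: beta_density_eq)
    have ind: "indicator {-1<..<1} v = (1::real)" "indicator {-1<..<1} c = (1::real)"
      using v c by (auto simp: abs_less_iff)
    have "beta_density s1 t1 v * beta_density s2 t2 c * pair_density n \<kappa> a b (p, q)
      = (C * D) * ((u ^ n) powr \<kappa> * (u powr a * u powr b) * u ^ Suc n * ((w ^ Suc n) powr \<kappa> * w ^ n) *
        ((e ^ Suc n) powr \<kappa> * e powr a * e ^ Suc n) * ((f ^ Suc n) powr \<kappa> * f powr b * f ^ Suc n)
        * (\<bar>poly ?p 2\<bar> powr a * \<bar>poly ?p (-2)\<bar> powr b * R powr \<kappa>))"
      unfolding bd b1 b2 b3 b4 j1 CD powr_add using p0 by (simp add: mult_ac)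
    also have "\<dots> = C * (indicator {-1<..<1} v * indicator {-1<..<1} c * step_jacobian n v c * pair_density (Suc n) \<kappa> a b (step_coord n (v, c) (p, q)))"
      unfolding ind j2 jc D_def by (simp only: mult_ac mult_1)
    finally show ?thesis .
  qed
  show ?thesis
  proof (rule that[OF C0])
    fix v c z
    show "beta_density (rev_param1 \<beta> a b (2 * n + 1)) (rev_param2 \<beta> a b (2 * n + 1)) v *
      beta_density (rev_param1 \<beta> a b (2 * n + 2)) (rev_param2 \<beta> a b (2 * n + 2)) c * pair_density n \<kappa> a b z
    = C * (indicator {-1<..<1} v * indicator {-1<..<1} c * step_jacobian n v c * pair_density (Suc n) \<kappa> a b (step_coord n (v, c) z))"
      using *[of v c "fst z" "snd z"] unfolding s1_def t1_def s2_def t2_def by simp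
  qed
qed

section \<open>Integration over one step\<close>

lemma measurable_mul_linear:
  assumes f: "f \<in> N \<rightarrow>\<^sub>M coords n" and g[measurable]: "g \<in> borel_measurable N" and i: "i < Suc n"
  shows "(\<lambda>x. mul_linear s n (f x) (g x) i) \<in> borel_measurable N"
proof -
  have 1[measurable]: "(\<lambda>x. if i < n then f x i else 0) \<in> borel_measurable N"
    using measurable_coord_app[OF f, of i] by (cases "i < n") auto
  have 2[measurable]: "(\<lambda>x. if i = 0 then s else f x (i - 1)) \<in> borel_measurable N"
    using measurable_coord_app[OF f, of "i - 1"] i by (cases "i = 0") auto
  show ?thesis unfolding mul_linear_def by measurable
qed

lemma measurable_stepQ_coord [measurable (raw)]:
  assumes u[measurable]: "u \<in> borel_measurable N" and c[measurable]: "c \<in> borel_measurable N"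
    and q: "q \<in> N \<rightarrow>\<^sub>M coords n" and p: "p \<in> N \<rightarrow>\<^sub>M coords (Suc n)"
  shows "(\<lambda>x. stepQ_coord n (u x) (c x) (q x) (p x)) \<in> N \<rightarrow>\<^sub>M coords (Suc n)"
proof (rule coordsI)
  fix i assume i: "i < Suc n"
  have [measurable]: "(\<lambda>x. mul_linear 1 n (q x) (- 2 * c x) i) \<in> borel_measurable N"
    by (rule measurable_mul_linear[OF q _ i]) measurable
  have [measurable]: "(\<lambda>x. p x i) \<in> borel_measurable N" by (rule measurable_coord_app[OF p i])
  have "(\<lambda>x. (1 - u x) * mul_linear 1 n (q x) (- 2 * c x) i + u x * p x i) \<in> borel_measurable N"
    by measurable
  then show "(\<lambda>x. stepQ_coord n (u x) (c x) (q x) (p x) i) \<in> borel_measurable N"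
    using i by (simp add: stepQ_coord_def)
qed (simp add: stepQ_coord_def)

lemma measurable_stepP_coord [measurable (raw)]:
  assumes k[measurable]: "k \<in> borel_measurable N" and c[measurable]: "c \<in> borel_measurable N"
    and Q: "Q \<in> N \<rightarrow>\<^sub>M coords (Suc n)" and q: "q \<in> N \<rightarrow>\<^sub>M coords n"
  shows "(\<lambda>x. stepP_coord n (k x) (c x) (Q x) (q x)) \<in> N \<rightarrow>\<^sub>M coords (Suc (Suc n))"
proof -
  have c2[measurable]: "(\<lambda>x. 2 * c x) \<in> borel_measurable N" by measurable
  have [measurable]: "(\<lambda>x. mul_linear 1 (Suc n) (Q x) (2 * c x) 1) \<in> borel_measurable N"
    by (rule measurable_mul_linear[OF Q c2]) simp
  have [measurable]: "(\<lambda>x. Q x 0) \<in> borel_measurable N" by (rule measurable_coord_app[OF Q]) simp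
  have [measurable]: "(\<lambda>x. \<lambda>i\<in>{..<n}. mul_linear 1 (Suc n) (Q x) (2 * c x) (i + 2) + (- k x) * q x i) \<in> N \<rightarrow>\<^sub>M coords n"
  proof (rule coordsI)
    fix i assume i: "i < n"
    have [measurable]: "(\<lambda>x. mul_linear 1 (Suc n) (Q x) (2 * c x) (i + 2)) \<in> borel_measurable N"
      by (rule measurable_mul_linear[OF Q c2]) (use i in simp)
    have [measurable]: "(\<lambda>x. q x i) \<in> borel_measurable N" by (rule measurable_coord_app[OF q i])
    have "(\<lambda>x. mul_linear 1 (Suc n) (Q x) (2 * c x) (i + 2) + (- k x) * q x i) \<in> borel_measurable N"
      by measurable
    then show "(\<lambda>x. (\<lambda>i\<in>{..<n}. mul_linear 1 (Suc n) (Q x) (2 * c x) (i + 2) + (- k x) * q x i) i) \<in> borel_measurable N"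
      using i by simp
  qed simp
  show ?thesis unfolding stepP_coord_def by measurable
qed

lemma measurable_offdiag_sq [measurable (raw)]:
  assumes [measurable]: "v \<in> borel_measurable N" "c \<in> borel_measurable N"
  shows "(\<lambda>x. offdiag_sq (v x) (c x)) \<in> borel_measurable N"
  unfolding offdiag_sq_def by measurable

lemma measurable_step_jacobian [measurable (raw)]:
  assumes [measurable]: "v \<in> borel_measurable N" "c \<in> borel_measurable N"
  shows "(\<lambda>x. step_jacobian n (v x) (c x)) \<in> borel_measurable N"
  unfolding step_jacobian_def by measurable

lemma measurable_step_coord [measurable (raw)]:
  assumes w: "w \<in> N \<rightarrow>\<^sub>M lborel \<Otimes>\<^sub>M lborel" and z: "z \<in> N \<rightarrow>\<^sub>M pair_coords n"
  shows "(\<lambda>x. step_coord n (w x) (z x)) \<in> N \<rightarrow>\<^sub>M pair_coords (Suc n)"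
proof -
  have [measurable]: "(\<lambda>x. fst (w x)) \<in> borel_measurable N" "(\<lambda>x. snd (w x)) \<in> borel_measurable N"
    using measurable_compose[OF w measurable_fst] measurable_compose[OF w measurable_snd] by simp_all
  have [measurable]: "(\<lambda>x. fst (z x)) \<in> N \<rightarrow>\<^sub>M coords (Suc n)" "(\<lambda>x. snd (z x)) \<in> N \<rightarrow>\<^sub>M coords n"
    using measurable_compose[OF z measurable_fst] measurable_compose[OF z measurable_snd] by simp_all
  show ?thesis unfolding step_coord_def Let_def by measurable
qed

lemma nn_integral_pair_coords:
  assumes "f \<in> borel_measurable (pair_coords n)"
  shows "(\<integral>\<^sup>+z. f z \<partial>pair_coords n) = (\<integral>\<^sup>+q. (\<integral>\<^sup>+p. f (p, q) \<partial>coords (Suc n)) \<partial>coords n)"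
  by (rule pair_sigma_finite.nn_integral_snd[symmetric])
    (use assms in \<open>auto intro!: pair_sigma_finite.intro sigma_finite_coords\<close>)

lemma nn_integral_affine_coord:
  assumes [measurable]: "f \<in> borel_measurable (coords n)" and "s \<noteq> 0"
  shows "(\<integral>\<^sup>+c. ennreal (\<bar>s\<bar> ^ n) * f (\<lambda>i\<in>{..<n}. e i + s * c i) \<partial>coords n) = (\<integral>\<^sup>+c. f c \<partial>coords n)"
proof -
  have m: "(\<lambda>c. \<lambda>i\<in>{..<n}. e i + s * c i) \<in> coords n \<rightarrow>\<^sub>M coords n" by (rule measurable_restrict) simp
  have "(\<integral>\<^sup>+c. ennreal (\<bar>s\<bar> ^ n) * f (\<lambda>i\<in>{..<n}. e i + s * c i) \<partial>coords n)
    = ennreal (\<bar>s\<bar> ^ n) * (\<integral>\<^sup>+c. f (\<lambda>i\<in>{..<n}. e i + s * c i) \<partial>coords n)"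
    by (rule nn_integral_cmult) (rule measurable_compose[OF m assms(1)])
  then show ?thesis using nn_integral_coords_affine[OF assms] by simp
qed

text \<open>With \<open>v\<close> and \<open>c\<close> fixed, \<open>p\<close> is exchanged for \<open>Q\<close>, and then \<open>q\<close> for all but the first two coefficients of \<open>P\<close>.\<close>

lemma nn_integral_step_pq:
  assumes F[measurable]: "F \<in> borel_measurable (pair_coords (Suc n))"
    and v: "v \<noteq> 1" "v \<noteq> -1" "v < 1" and c: "c\<^sup>2 \<noteq> 1"
  shows "(\<integral>\<^sup>+z. ennreal (step_jacobian n v c) * F (step_coord n (v, c) z) \<partial>pair_coords n)
    = ennreal (4 * \<bar>1 - c\<^sup>2\<bar>) * (\<integral>\<^sup>+Q. (\<integral>\<^sup>+y. F (cons_coord (Suc n) (Q 0 - 2 * c)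
        (cons_coord n (mul_linear 1 (Suc n) Q (2 * c) 1 - offdiag_sq v c) y), Q) \<partial>coords n) \<partial>coords (Suc n))"
proof -
  define u where "u = (1 - v) / 2"
  define k where "k = offdiag_sq v c"
  have u0: "0 < u" using v by (simp add: u_def)
  have k0: "k \<noteq> 0" using v c by (auto simp: k_def offdiag_sq_def)
  let ?J = "\<lambda>z. ennreal (step_jacobian n v c) * F (step_coord n (v, c) z)"
  let ?R = "\<lambda>Q y. F (cons_coord (Suc n) (Q 0 - 2 * c) (cons_coord n (mul_linear 1 (Suc n) Q (2 * c) 1 - k) y), Q)"
  let ?P = "\<lambda>Q q. stepP_coord n k c Q q"
  let ?A = "ennreal (4 * \<bar>1 - c\<^sup>2\<bar>)"
  have j: "ennreal (step_jacobian n v c) = ?A * ennreal (\<bar>k\<bar> ^ n) * ennreal (\<bar>u\<bar> ^ Suc n)"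
    using u0 by (simp add: step_jacobian_def u_def[symmetric] k_def ennreal_mult[symmetric] mult_ac del: power_Suc)
  have Fm: "(\<lambda>Q. F (?P Q q, Q)) \<in> borel_measurable (coords (Suc n))" if "q \<in> space (coords n)" for q
    using that by measurable
  have "(\<integral>\<^sup>+z. ?J z \<partial>pair_coords n)
    = (\<integral>\<^sup>+q. (\<integral>\<^sup>+p. ?J (p, q) \<partial>coords (Suc n)) \<partial>coords n)"
    by (rule nn_integral_pair_coords) measurable
  also have "\<dots> = (\<integral>\<^sup>+q. (\<integral>\<^sup>+Q. ?A * ennreal (\<bar>k\<bar> ^ n) * F (?P Q q, Q) \<partial>coords (Suc n)) \<partial>coords n)"
  proof (rule nn_integral_cong)
    fix q assume q: "q \<in> space (coords n)"
    have "(\<integral>\<^sup>+p. ?J (p, q) \<partial>coords (Suc n))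
      = (\<integral>\<^sup>+p. ennreal (\<bar>u\<bar> ^ Suc n) * (\<lambda>Q. ?A * ennreal (\<bar>k\<bar> ^ n) * F (?P Q q, Q))
           (\<lambda>i\<in>{..<Suc n}. (1 - u) * mul_linear 1 n q (- 2 * c) i + u * p i) \<partial>coords (Suc n))"
      unfolding j step_coord_def Let_def fst_conv snd_conv u_def[symmetric] k_def[symmetric] stepQ_coord_def
      by (simp only: mult_ac)
    also have "\<dots> = (\<integral>\<^sup>+Q. ?A * ennreal (\<bar>k\<bar> ^ n) * F (?P Q q, Q) \<partial>coords (Suc n))"
    proof (rule nn_integral_affine_coord)
      show "(\<lambda>Q. ?A * ennreal (\<bar>k\<bar> ^ n) * F (?P Q q, Q)) \<in> borel_measurable (coords (Suc n))"
        by (rule borel_measurable_times_ennreal[OF borel_measurable_const Fm[OF q]])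
    qed (use u0 in simp)
    finally show "(\<integral>\<^sup>+p. ?J (p, q) \<partial>coords (Suc n))
      = (\<integral>\<^sup>+Q. ?A * ennreal (\<bar>k\<bar> ^ n) * F (?P Q q, Q) \<partial>coords (Suc n))" .
  qed
  also have "\<dots> = (\<integral>\<^sup>+Q. (\<integral>\<^sup>+q. ?A * ennreal (\<bar>k\<bar> ^ n) * F (?P Q q, Q) \<partial>coords n) \<partial>coords (Suc n))"
    by (intro nn_integral_coords_swap sigma_finite_coords) measurable
  also have "\<dots> = (\<integral>\<^sup>+Q. ?A * (\<integral>\<^sup>+y. ?R Q y \<partial>coords n) \<partial>coords (Suc n))"
  proof (rule nn_integral_cong)
    fix Q assume Q: "Q \<in> space (coords (Suc n))"
    define G where "G y = ?R Q y" for y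
    have [measurable]: "G \<in> borel_measurable (coords n)" unfolding G_def using Q by measurable
    have "(\<integral>\<^sup>+q. ?A * ennreal (\<bar>k\<bar> ^ n) * F (?P Q q, Q) \<partial>coords n)
      = (\<integral>\<^sup>+q. ennreal (\<bar>- k\<bar> ^ n) * (\<lambda>y. ?A * G y) (\<lambda>i\<in>{..<n}. mul_linear 1 (Suc n) Q (2 * c) (i + 2) + (- k) * q i) \<partial>coords n)"
      unfolding stepP_coord_def G_def abs_minus_cancel by (simp only: mult_ac)
    also have "\<dots> = (\<integral>\<^sup>+y. ?A * G y \<partial>coords n)"
      by (rule nn_integral_affine_coord) (measurable, use k0 in simp)
    also have "\<dots> = ?A * (\<integral>\<^sup>+y. G y \<partial>coords n)" by (rule nn_integral_cmult) measurable
    finally show "(\<integral>\<^sup>+q. ?A * ennreal (\<bar>k\<bar> ^ n) * F (?P Q q, Q) \<partial>coords n) = ?A * (\<integral>\<^sup>+y. ?R Q y \<partial>coords n)" unfolding G_def .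
  qed
  also have "\<dots> = ?A * (\<integral>\<^sup>+Q. (\<integral>\<^sup>+y. ?R Q y \<partial>coords n) \<partial>coords (Suc n))"
    by (rule nn_integral_cmult) (intro sigma_finite_measure.borel_measurable_nn_integral sigma_finite_coords,
      use measurable_mul_linear[of "fst" "coords (Suc n) \<Otimes>\<^sub>M coords n" "Suc n" "\<lambda>_. 2 * c" 1 1] in measurable)
  finally show ?thesis unfolding k_def .
qed

text \<open>Solving the two affine systems for \<open>q\<close> and \<open>p\<close>. Thus every pair with the given first two coefficients is
  the image of some \<open>(p, q)\<close>, to which \<open>pair_admissible_step_rev\<close> applies.\<close>

lemma step_coord_surj:
  assumes v: "v \<noteq> 1" "v \<noteq> -1" and c: "c\<^sup>2 \<noteq> 1"
    and Q: "Q \<in> space (coords (Suc n))" and y: "y \<in> space (coords n)"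
  shows "\<exists>p q. step_coord n (v, c) (p, q) = (cons_coord (Suc n) (Q 0 - 2 * c)
        (cons_coord n (mul_linear 1 (Suc n) Q (2 * c) 1 - offdiag_sq v c) y), Q)"
proof -
  define u where "u = (1 - v) / 2"
  define k where "k = offdiag_sq v c"
  have u0: "u \<noteq> 0" and k0: "k \<noteq> 0" using v c by (auto simp: k_def offdiag_sq_def u_def)
  define q where "q i = (mul_linear 1 (Suc n) Q (2 * c) (i + 2) - y i) / k" for i
  define p where "p i = (Q i - (1 - u) * mul_linear 1 n q (- 2 * c) i) / u" for i
  have "(\<lambda>i\<in>{..<n}. mul_linear 1 (Suc n) Q (2 * c) (i + 2) + (- k) * q i) = y"
  proof (rule extensionalityI[of _ "{..<n}"])
    show "y \<in> extensional {..<n}" using y by (simp add: space_PiM PiE_def)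
  qed (use k0 in \<open>auto simp: q_def\<close>)
  moreover have "(\<lambda>i\<in>{..<Suc n}. (1 - u) * mul_linear 1 n q (- 2 * c) i + u * p i) = Q"
  proof (rule extensionalityI[of _ "{..<Suc n}"])
    show "Q \<in> extensional {..<Suc n}" using Q by (simp add: space_PiM PiE_def)
  qed (use u0 in \<open>auto simp: p_def\<close>)
  ultimately have "step_coord n (v, c) (p, q) = (cons_coord (Suc n) (Q 0 - 2 * c)
        (cons_coord n (mul_linear 1 (Suc n) Q (2 * c) 1 - k) y), Q)"
    unfolding step_coord_def Let_def fst_conv snd_conv u_def[symmetric] k_def[symmetric] stepQ_coord_def stepP_coord_def by simp
  then show ?thesis unfolding k_def by blast
qed

lemma borel_measurable_affine_arg:
  fixes g :: "real \<Rightarrow> ennreal"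
  assumes [measurable]: "g \<in> borel_measurable borel"
  shows "(\<lambda>v. g (e + r * v)) \<in> borel_measurable lborel"
  by measurable

text \<open>After \<open>nn_integral_step_pq\<close> the variables \<open>v\<close> and \<open>c\<close> occur only in the second and in the first coefficient of \<open>P\<close>, each
  time affinely. The restriction to \<open>\<bar>v\<bar> < 1\<close> and \<open>\<bar>c\<bar> < 1\<close> can be dropped, up to null sets, because an
  admissible image forces it.\<close>

theorem nn_integral_step:
  assumes F[measurable]: "F \<in> borel_measurable (pair_coords (Suc n))"
    and F0: "\<And>z. \<not> pair_admissible (Suc n) z \<Longrightarrow> F z = 0"
  shows "(\<integral>\<^sup>+w. indicator {-1<..<1} (fst w) * indicator {-1<..<1} (snd w) *
      (\<integral>\<^sup>+z. ennreal (step_jacobian n (fst w) (snd w)) * F (step_coord n w z) \<partial>pair_coords n) \<partial>(lborel \<Otimes>\<^sub>M lborel))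
    = (\<integral>\<^sup>+z. F z \<partial>pair_coords (Suc n))"
proof -
  let ?R = "\<lambda>Q x y z. F (cons_coord (Suc n) x (cons_coord n y z), Q)"
  let ?A = "\<lambda>c::real. ennreal (4 * \<bar>1 - c\<^sup>2\<bar>)"
  let ?G = "\<lambda>Q x y. \<integral>\<^sup>+z. ?R Q x y z \<partial>coords n"
  let ?m = "\<lambda>Q c. mul_linear 1 (Suc n) Q (2 * c) 1"
  have sf: "sigma_finite_measure (pair_coords n)"
    by (intro sigma_finite_pair_measure sigma_finite_coords)
  have mm[measurable (raw)]: "(\<lambda>x. mul_linear 1 (Suc n) (f x) (2 * c x) 1) \<in> borel_measurable N"
    if "f \<in> N \<rightarrow>\<^sub>M coords (Suc n)" "c \<in> borel_measurable N" for f c and N :: "'z measure"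
    using that by (intro measurable_mul_linear) auto
  have m0[measurable (raw)]: "(\<lambda>x. f x 0) \<in> borel_measurable N"
    if "f \<in> N \<rightarrow>\<^sub>M coords (Suc n)" for f and N :: "'z measure"
    using that by (rule measurable_coord_app) simp
  define E where "E = (\<lambda>w. indicator {-1<..<1} (fst w) * indicator {-1<..<1} (snd w) *
      (\<integral>\<^sup>+z. ennreal (step_jacobian n (fst w) (snd w)) * F (step_coord n w z) \<partial>pair_coords n))"
  have Em: "E \<in> borel_measurable (lborel \<Otimes>\<^sub>M lborel)" unfolding E_def
  proof (intro borel_measurable_times_ennreal sigma_finite_measure.borel_measurable_nn_integral[OF sf])
    show "(\<lambda>(w, z). ennreal (step_jacobian n (fst w) (snd w)) * F (step_coord n w z))
      \<in> borel_measurable ((lborel \<Otimes>\<^sub>M lborel) \<Otimes>\<^sub>M pair_coords n)" by measurable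
  qed measurable
  have E: "E (v, c) = ?A c *
      (\<integral>\<^sup>+Q. ?G Q (Q 0 - 2 * c) (?m Q c - offdiag_sq v c) \<partial>coords (Suc n))"
    if v: "v \<noteq> 1" "v \<noteq> -1" and c: "c\<^sup>2 \<noteq> 1" for v c
  proof (cases "\<bar>v\<bar> < 1 \<and> \<bar>c\<bar> < 1")
    case True
    then have i: "v \<in> {-1<..<1}" "c \<in> {-1<..<1}" and "v < 1" by auto
    show ?thesis unfolding E_def fst_conv snd_conv nn_integral_step_pq[OF F v \<open>v < 1\<close> c] using i by simp
  next
    case False
    have "?R Q (Q 0 - 2 * c) (?m Q c - offdiag_sq v c) z = 0" if Q: "Q \<in> space (coords (Suc n))" and z: "z \<in> space (coords n)" for Q z
    proof (rule F0)
      let ?e = "\<lambda>z. (cons_coord (Suc n) (Q 0 - 2 * c) (cons_coord n (?m Q c - offdiag_sq v c) z), Q)"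
      obtain p q where e: "step_coord n (v, c) (p, q) = (?e z)"
        using step_coord_surj[OF v c Q z] by blast
      show "\<not> pair_admissible (Suc n) (?e z)"
        unfolding e[symmetric] using pair_admissible_step_rev[of n v c p q] False by blast
    qed
    then have "(\<integral>\<^sup>+Q. ?G Q (Q 0 - 2 * c) (?m Q c - offdiag_sq v c) \<partial>coords (Suc n))
       = (\<integral>\<^sup>+Q. (\<integral>\<^sup>+z. 0 \<partial>coords n) \<partial>coords (Suc n))"
      by (intro nn_integral_cong)
    moreover have "v \<notin> {-1<..<1} \<or> c \<notin> {-1<..<1}" using False by auto
    ultimately show ?thesis unfolding E_def by auto
  qed
  have AEv: "AE v in lborel. v \<noteq> 1 \<and> v \<noteq> (-1::real)"
    using AE_lborel_singleton[of "1::real"] AE_lborel_singleton[of "-1::real"] by eventually_elim auto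
  then have AEc: "AE c in lborel. c\<^sup>2 \<noteq> (1::real)"
    by eventually_elim (auto simp: power2_eq_1_iff)
  have G2: "(\<integral>\<^sup>+v. E (v, c) \<partial>lborel) = (\<integral>\<^sup>+Q. ennreal 2 * (\<integral>\<^sup>+x. ?G Q (Q 0 - 2 * c) x \<partial>lborel) \<partial>coords (Suc n))"
    if c: "c\<^sup>2 \<noteq> 1" for c
  proof -
    \<comment> \<open>The slope of the second coefficient of \<open>P\<close> as a function of \<open>v\<close>.\<close>
    define s where "s = - 2 * (1 - c\<^sup>2)"
    have s0: "s \<noteq> 0" using c by (simp add: s_def)
    have A: "?A c = ennreal 2 * ennreal \<bar>s\<bar>"
    proof -
      have "\<bar>s\<bar> = 2 * \<bar>1 - c\<^sup>2\<bar>" unfolding s_def abs_mult by simp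
      then show ?thesis by (subst ennreal_mult[symmetric]) (simp_all del: abs_mult)
    qed
    have k: "?m Q c - offdiag_sq v c = (?m Q c + s) + s * v" for Q v
      by (simp add: offdiag_sq_def s_def algebra_simps)
    have "(\<integral>\<^sup>+v. E (v, c) \<partial>lborel) = (\<integral>\<^sup>+v. ?A c *
      (\<integral>\<^sup>+Q. ?G Q (Q 0 - 2 * c) ((?m Q c + s) + s * v) \<partial>coords (Suc n)) \<partial>lborel)"
      by (intro nn_integral_cong_AE, use AEv in eventually_elim, subst E[OF _ _ c], blast, blast, simp only: k)
    also have "\<dots> = (\<integral>\<^sup>+v. (\<integral>\<^sup>+Q. ?A c *
       ?G Q (Q 0 - 2 * c) ((?m Q c + s) + s * v) \<partial>coords (Suc n)) \<partial>lborel)"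
      by (intro nn_integral_cong nn_integral_cmult[symmetric] sigma_finite_measure.borel_measurable_nn_integral sigma_finite_coords) measurable
    also have "\<dots> = (\<integral>\<^sup>+Q. (\<integral>\<^sup>+v. ?A c *
       ?G Q (Q 0 - 2 * c) ((?m Q c + s) + s * v) \<partial>lborel) \<partial>coords (Suc n))"
    proof (intro nn_integral_coords_swap sigma_finite_coords sigma_finite_lborel)
      have "(\<lambda>x. \<integral>\<^sup>+z. ?R (fst x) (fst x 0 - 2 * c) ((?m (fst x) c + s) + s * snd x) z \<partial>coords n)
        \<in> borel_measurable (coords (Suc n) \<Otimes>\<^sub>M lborel)"
        by (intro sigma_finite_measure.borel_measurable_nn_integral sigma_finite_coords) measurable
      then show "(\<lambda>(Q, v). ?A c *
         ?G Q (Q 0 - 2 * c) ((?m Q c + s) + s * v)) \<in> borel_measurable (coords (Suc n) \<Otimes>\<^sub>M lborel)"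
        unfolding case_prod_unfold by (rule borel_measurable_times_ennreal[OF borel_measurable_const])
    qed
    also have "\<dots> = (\<integral>\<^sup>+Q. ennreal 2 * (\<integral>\<^sup>+x. ?G Q (Q 0 - 2 * c) x \<partial>lborel) \<partial>coords (Suc n))"
    proof (rule nn_integral_cong)
      fix Q assume Q: "Q \<in> space (coords (Suc n))"
      define g where "g x = ?G Q (Q 0 - 2 * c) x" for x
      have g[measurable]: "g \<in> borel_measurable borel"
      proof -
        have "(\<lambda>(x, z). ?R Q (Q 0 - 2 * c) x z) \<in> borel_measurable (borel \<Otimes>\<^sub>M coords n)" using Q by measurable
        then show ?thesis unfolding g_def
          by (rule sigma_finite_measure.borel_measurable_nn_integral[OF sigma_finite_coords])
      qed
      have gm: "(\<lambda>v. g (e + r * v)) \<in> borel_measurable lborel" for e r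
        using g by (rule borel_measurable_affine_arg)
      have "(\<integral>\<^sup>+v. ?A c * g ((?m Q c + s) + s * v) \<partial>lborel)
        = ennreal 2 * (ennreal \<bar>s\<bar> * (\<integral>\<^sup>+v. g ((?m Q c + s) + s * v) \<partial>lborel))"
        unfolding A mult.assoc by (simp only: nn_integral_cmult[OF gm] nn_integral_cmult[OF borel_measurable_times_ennreal[OF borel_measurable_const gm]])
      also have "ennreal \<bar>s\<bar> * (\<integral>\<^sup>+v. g ((?m Q c + s) + s * v) \<partial>lborel) = (\<integral>\<^sup>+x. g x \<partial>lborel)"
        by (rule nn_integral_real_affine[OF g s0, symmetric])
      finally show "(\<integral>\<^sup>+v. ?A c *
       ?G Q (Q 0 - 2 * c) ((?m Q c + s) + s * v) \<partial>lborel) = ennreal 2 * (\<integral>\<^sup>+x. ?G Q (Q 0 - 2 * c) x \<partial>lborel)"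
        unfolding g_def .
    qed
    finally show ?thesis .
  qed
  have "(\<integral>\<^sup>+w. E w \<partial>(lborel \<Otimes>\<^sub>M lborel)) = (\<integral>\<^sup>+c. (\<integral>\<^sup>+v. E (v, c) \<partial>lborel) \<partial>lborel)"
    by (rule pair_sigma_finite.nn_integral_snd[symmetric]) (auto intro!: pair_sigma_finite.intro sigma_finite_lborel Em)
  also have "\<dots> = (\<integral>\<^sup>+c. (\<integral>\<^sup>+Q. ennreal 2 * (\<integral>\<^sup>+x. ?G Q (Q 0 - 2 * c) x \<partial>lborel) \<partial>coords (Suc n)) \<partial>lborel)"
    by (intro nn_integral_cong_AE, use AEc in eventually_elim) (rule G2)
  also have "\<dots> = (\<integral>\<^sup>+Q. (\<integral>\<^sup>+c. ennreal 2 * (\<integral>\<^sup>+x. ?G Q (Q 0 - 2 * c) x \<partial>lborel) \<partial>lborel) \<partial>coords (Suc n))"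
  proof (intro nn_integral_coords_swap sigma_finite_coords sigma_finite_lborel)
    have "(\<lambda>w. \<integral>\<^sup>+z. ?R (fst (fst w)) (fst (fst w) 0 - 2 * snd (fst w)) (snd w) z \<partial>coords n)
        \<in> borel_measurable ((coords (Suc n) \<Otimes>\<^sub>M lborel) \<Otimes>\<^sub>M lborel)"
      by (intro sigma_finite_measure.borel_measurable_nn_integral sigma_finite_coords) measurable
    then have "(\<lambda>w. \<integral>\<^sup>+x. ?G (fst w) (fst w 0 - 2 * snd w) x \<partial>lborel) \<in> borel_measurable (coords (Suc n) \<Otimes>\<^sub>M lborel)"
      by (intro sigma_finite_measure.borel_measurable_nn_integral sigma_finite_lborel) (simp only: case_prod_unfold)
    then show "(\<lambda>(Q, c). ennreal 2 * (\<integral>\<^sup>+x. ?G Q (Q 0 - 2 * c) x \<partial>lborel)) \<in> borel_measurable (coords (Suc n) \<Otimes>\<^sub>M lborel)"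
      unfolding case_prod_unfold by (rule borel_measurable_times_ennreal[OF borel_measurable_const])
  qed
  also have "\<dots> = (\<integral>\<^sup>+Q. (\<integral>\<^sup>+P. F (P, Q) \<partial>coords (Suc (Suc n))) \<partial>coords (Suc n))"
  proof (rule nn_integral_cong)
    fix Q assume Q: "Q \<in> space (coords (Suc n))"
    define g where "g x' = (\<integral>\<^sup>+x. ?G Q x' x \<partial>lborel)" for x'
    have g[measurable]: "g \<in> borel_measurable borel"
    proof -
      have "(\<lambda>(x, z). ?R Q (fst x) (snd x) z) \<in> borel_measurable ((borel \<Otimes>\<^sub>M lborel) \<Otimes>\<^sub>M coords n)" using Q by measurable
      then have "(\<lambda>x. \<integral>\<^sup>+z. ?R Q (fst x) (snd x) z \<partial>coords n) \<in> borel_measurable (borel \<Otimes>\<^sub>M lborel)"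
        by (rule sigma_finite_measure.borel_measurable_nn_integral[OF sigma_finite_coords])
      then show ?thesis unfolding g_def
        by (intro sigma_finite_measure.borel_measurable_nn_integral[OF sigma_finite_lborel]) (simp only: case_prod_unfold)
    qed
      have gm: "(\<lambda>v. g (e + r * v)) \<in> borel_measurable lborel" for e r
        using g by (rule borel_measurable_affine_arg)
    have "(\<integral>\<^sup>+c. ennreal 2 * g (Q 0 - 2 * c) \<partial>lborel) = ennreal \<bar>-2\<bar> * (\<integral>\<^sup>+c. g (Q 0 + (-2) * c) \<partial>lborel)"
      using nn_integral_cmult[OF gm[of "Q 0" "-2"], of "ennreal 2"] by simp
    also have "\<dots> = (\<integral>\<^sup>+x. g x \<partial>lborel)" by (rule nn_integral_real_affine[OF g, symmetric]) simp
    also have "\<dots> = (\<integral>\<^sup>+x'. (\<integral>\<^sup>+P. F (cons_coord (Suc n) x' P, Q) \<partial>coords (Suc n)) \<partial>lborel)"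
      unfolding g_def
      by (intro nn_integral_cong nn_integral_coords_cons[where f="\<lambda>P. F (cons_coord (Suc n) _ P, Q)", symmetric]) (use Q in measurable)
    also have "\<dots> = (\<integral>\<^sup>+P. F (P, Q) \<partial>coords (Suc (Suc n)))"
      by (rule nn_integral_coords_cons[symmetric]) (use Q in measurable)
    finally show "(\<integral>\<^sup>+c. ennreal 2 * (\<integral>\<^sup>+x. ?G Q (Q 0 - 2 * c) x \<partial>lborel) \<partial>lborel) = (\<integral>\<^sup>+P. F (P, Q) \<partial>coords (Suc (Suc n)))"
      unfolding g_def .
  qed
  also have "\<dots> = (\<integral>\<^sup>+z. F z \<partial>pair_coords (Suc n))" by (rule nn_integral_pair_coords[OF F, symmetric])
  finally show ?thesis unfolding E_def .
qed

section \<open>The law of the pair of characteristic polynomials\<close>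

definition rev_alpha_law :: "real \<Rightarrow> real \<Rightarrow> real \<Rightarrow> nat \<Rightarrow> real measure" where
  "rev_alpha_law \<beta> a b m = density lborel (\<lambda>x. ennreal (beta_density (rev_param1 \<beta> a b m) (rev_param2 \<beta> a b m) x))"

lemma measurable_beta_density [measurable]: "beta_density s t \<in> borel_measurable borel"
  unfolding beta_density_def by measurable

lemma sets_rev_alpha_law [measurable_cong, simp]: "sets (rev_alpha_law \<beta> a b m) = sets borel"
  by (simp add: rev_alpha_law_def)

lemma measurable_component_rev_alpha_law:
  "i \<in> I \<Longrightarrow> (\<lambda>x. x i) \<in> borel_measurable (Pi\<^sub>M I (rev_alpha_law \<beta> a b))"
  using measurable_component_singleton[of i I "rev_alpha_law \<beta> a b"] measurable_cong_sets[OF refl sets_rev_alpha_law] by blast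

lemma product_sigma_finite_rev_alpha_law: "product_sigma_finite (rev_alpha_law \<beta> a b)"
  unfolding product_sigma_finite_def
proof
  fix m
  show "sigma_finite_measure (rev_alpha_law \<beta> a b m)"
    unfolding rev_alpha_law_def by (subst sigma_finite_measure.sigma_finite_iff_density_finite[OF sigma_finite_lborel]) auto
qed

text \<open>The coefficients of \<open>(P, Q)\<close> as a function of the reversed sequence \<open>x m = \<alpha>\<^bsub>2n-m\<^esub>\<close>, for a matrix of size \<open>n + 1\<close>.\<close>

primrec char_pair :: "nat \<Rightarrow> (nat \<Rightarrow> real) \<Rightarrow> (nat \<Rightarrow> real) \<times> (nat \<Rightarrow> real)" where
  "char_pair 0 x = (\<lambda>i\<in>{..<Suc 0}. - 2 * x 0, \<lambda>_. undefined)"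
| "char_pair (Suc n) x = step_coord n (x (2 * n + 1), x (2 * n + 2)) (char_pair n x)"

lemma char_pair_cong: "(\<And>i. i < 2 * n + 1 \<Longrightarrow> x i = y i) \<Longrightarrow> char_pair n x = char_pair n y"
  by (induction n) auto

lemma measurable_char_pair:
  assumes "\<And>i. i < 2 * n + 1 \<Longrightarrow> (\<lambda>x. f x i) \<in> borel_measurable N"
  shows "(\<lambda>x. char_pair n (f x)) \<in> N \<rightarrow>\<^sub>M pair_coords n"
  using assms
proof (induction n)
  case 0
  have [measurable]: "(\<lambda>x. f x 0) \<in> borel_measurable N" using 0 by simp
  have 1: "(\<lambda>x. \<lambda>i\<in>{..<Suc 0}. - 2 * f x 0) \<in> N \<rightarrow>\<^sub>M coords (Suc 0)"
    by (rule measurable_restrict) simp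
  have 2: "(\<lambda>x. \<lambda>_. undefined) \<in> N \<rightarrow>\<^sub>M coords 0"
    by (rule measurable_const) (simp add: space_PiM)
  show ?case unfolding char_pair.simps by (rule measurable_Pair[OF 1 2])
next
  case (Suc n)
  have [measurable]: "(\<lambda>x. f x (2 * n + 1)) \<in> borel_measurable N" "(\<lambda>x. f x (2 * n + 2)) \<in> borel_measurable N"
    using Suc.prems by auto
  have w: "(\<lambda>x. (f x (2 * n + 1), f x (2 * n + 2))) \<in> N \<rightarrow>\<^sub>M lborel \<Otimes>\<^sub>M lborel" by measurable
  show ?case unfolding char_pair.simps
    by (rule measurable_step_coord[OF w Suc.IH]) (rule Suc.prems, simp)
qed

lemma pair_admissible_0: "pair_admissible 0 (cons_coord 0 (- 2 * y) d, d') \<longleftrightarrow> \<bar>y\<bar> < 1"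
proof -
  have p: "cpoly 1 (Suc 0) (cons_coord 0 (- 2 * y) d) = [:- (2 * y), 1:]" by (simp add: cons_coord_def)
  have r: "root_poly (Suc 0) x = [:- x 0, 1:]" for x by (simp add: root_poly_def)
  show ?thesis unfolding pair_admissible_iff admissible_def fst_conv snd_conv p r
    by (auto simp: strict_mono_on_def abs_mult intro!: exI[of _ "\<lambda>_. 2 * y"])
qed

lemma pair_density_0: "pair_density 0 \<kappa> a b (cons_coord 0 (- 2 * y) d, d')
   = (if \<bar>y\<bar> < 1 then 2 powr a * 2 powr b * ((1 - y) powr a * (1 + y) powr b) else 0)"
proof (cases "\<bar>y\<bar> < 1")
  case True
  have p: "cpoly 1 (Suc 0) (cons_coord 0 (- 2 * y) d) = [:- (2 * y), 1:]" by (simp add: cons_coord_def)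
  have "\<bar>poly [:- (2 * y), 1:] 2\<bar> = 2 * (1 - y)" "\<bar>poly [:- (2 * y), 1:] (-2)\<bar> = 2 * (1 + y)"
    using True by (auto simp: abs_if)
  then have e: "\<bar>poly [:- (2 * y), 1:] 2\<bar> powr a = 2 powr a * (1 - y) powr a"
    "\<bar>poly [:- (2 * y), 1:] (-2)\<bar> powr b = 2 powr b * (1 + y) powr b"
    by (simp_all only: powr_mult)
  have "pair_admissible 0 (cons_coord 0 (- 2 * y) d, d')" using True pair_admissible_0 by blast
  then show ?thesis using True unfolding pair_density_def fst_conv snd_conv p e by simp
qed (use pair_admissible_0[of y d d'] in \<open>simp add: pair_density_def\<close>)

text \<open>Induction on the size: two new variables are integrated against their beta densities; \<open>pair_density_step\<close>
  and \<open>nn_integral_step\<close> turn the result into an integral over pairs one degree higher.\<close>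

theorem char_pair_law:
  assumes par: "\<beta> > 0" "a > -1" "b > -1" and \<kappa>: "\<kappa> = \<beta> / 2 - 1"
  shows "\<exists>K>0. \<forall>H\<in>borel_measurable (pair_coords n).
    (\<integral>\<^sup>+x. H (char_pair n x) \<partial>Pi\<^sub>M {..<2 * n + 1} (rev_alpha_law \<beta> a b)) = ennreal K * (\<integral>\<^sup>+z. H z * ennreal (pair_density n \<kappa> a b z) \<partial>pair_coords n)"
proof (induction n)
  case 0
  interpret product_sigma_finite "rev_alpha_law \<beta> a b" by (rule product_sigma_finite_rev_alpha_law)
  define s where "s = rev_param1 \<beta> a b 0"
  define t where "t = rev_param2 \<beta> a b 0"
  have st: "s = a + 1" "t = b + 1" by (simp_all add: s_def t_def rev_param1_def rev_param2_def)
  \<comment> \<open>For size one \<open>P = X - 2 \<alpha>\<^sub>0\<close> and \<open>Q = 1\<close>, so only powers of \<open>2\<close> and the beta constant remain.\<close>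
  define D where "D = 2 * (2 powr a * 2 powr b) / beta_const s t"
  have "0 < beta_const s t" using par by (intro beta_const_pos) (auto simp: st)
  then have D0: "0 < D" and DB: "D * beta_const s t = 2 * (2 powr a * 2 powr b)" by (simp_all add: D_def)
  have bd: "2 * pair_density 0 \<kappa> a b (cons_coord 0 (- 2 * y) d, d') = D * beta_density s t y" for y d d'
    unfolding pair_density_0 beta_density_eq using DB by (simp add: st mult.assoc[symmetric])
  show ?case
  proof (intro exI[of _ "1 / D"] conjI ballI)
    show "0 < 1 / D" using D0 by simp
    fix H :: "(nat \<Rightarrow> real) \<times> (nat \<Rightarrow> real) \<Rightarrow> ennreal"
    assume H[measurable]: "H \<in> borel_measurable (pair_coords 0)"
    let ?d = "\<lambda>_::nat. undefined :: real"
    let ?c = "\<lambda>y. cons_coord 0 y ?d"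
    let ?h = "\<lambda>y. H (?c y, ?d)" and ?p = "\<lambda>y. pair_density 0 \<kappa> a b (?c y, ?d)"
    have [simp]: "?d \<in> space (coords 0)" by (simp add: space_PiM)
    note [measurable] = measurable_pair_density
    have cm[measurable]: "(\<lambda>y. (?c (f y), ?d)) \<in> N \<rightarrow>\<^sub>M pair_coords 0" if "f \<in> borel_measurable N" for f and N :: "real measure"
    proof (rule measurable_Pair)
      show "(\<lambda>y. ?c (f y)) \<in> N \<rightarrow>\<^sub>M coords (Suc 0)"
        using that by (intro measurable_cons_coord measurable_const) auto
    qed (rule measurable_const, simp)
    have Hm: "(\<lambda>y. ?h (- 2 * y)) \<in> borel_measurable borel"
      by (rule measurable_compose[OF cm H]) simp
    have "(\<integral>\<^sup>+x. H (char_pair 0 x) \<partial>Pi\<^sub>M {..<2 * 0 + 1} (rev_alpha_law \<beta> a b)) = (\<integral>\<^sup>+x. (\<lambda>y. ?h (- 2 * y)) (x 0) \<partial>Pi\<^sub>M {0} (rev_alpha_law \<beta> a b))"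
    proof -
      have "{..<2 * 0 + 1} = {0::nat}" by auto
      moreover have "char_pair 0 x = (?c (- 2 * x 0), ?d)" for x by (auto simp: cons_coord_def)
      ultimately show ?thesis by simp
    qed
    also have "\<dots> = (\<integral>\<^sup>+y. ?h (- 2 * y) \<partial>rev_alpha_law \<beta> a b 0)"
      by (rule product_nn_integral_singleton) (use Hm in simp)
    also have "\<dots> = (\<integral>\<^sup>+y. ennreal (beta_density s t y) * ?h (- 2 * y) \<partial>lborel)"
      unfolding rev_alpha_law_def s_def[symmetric] t_def[symmetric] by (rule nn_integral_density) (use Hm in auto)
    also have "\<dots> = ennreal (1 / D) * (ennreal \<bar>-2\<bar> * (\<integral>\<^sup>+y. ?h (0 + (- 2) * y) * ennreal (?p (0 + (- 2) * y)) \<partial>lborel))"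
    proof -
      have m: "(\<lambda>y. ?h (0 + (- 2) * y) * ennreal (?p (0 + (- 2) * y))) \<in> borel_measurable lborel"
        using Hm measurable_compose[OF cm measurable_pair_density, of "\<lambda>y. - 2 * y" lborel \<kappa> a b] by simp
      have "ennreal (beta_density s t y) = ennreal (1 / D) * (ennreal \<bar>-2\<bar> * ennreal (?p (0 + (- 2) * y)))" for y
      proof -
        have "beta_density s t y = 1 / D * (\<bar>-2\<bar> * ?p (0 + (- 2) * y))"
          using bd[of y ?d ?d] D0 by (simp add: field_simps)
        also have "ennreal \<dots> = ennreal (1 / D) * ennreal (\<bar>-2\<bar> * ?p (0 + (- 2) * y))"
          by (rule ennreal_mult) (use D0 pair_density_nonneg in auto)
        also have "ennreal (\<bar>-2\<bar> * ?p (0 + (- 2) * y)) = ennreal \<bar>-2\<bar> * ennreal (?p (0 + (- 2) * y))"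
          by (rule ennreal_mult) (use pair_density_nonneg in auto)
        finally show ?thesis .
      qed
      then have "(\<integral>\<^sup>+y. ennreal (beta_density s t y) * ?h (- 2 * y) \<partial>lborel) =
         (\<integral>\<^sup>+y. ennreal (1 / D) * (ennreal \<bar>-2\<bar> * (?h (0 + (- 2) * y) * ennreal (?p (0 + (- 2) * y)))) \<partial>lborel)"
        by (simp add: mult_ac)
      then show ?thesis by (simp only: nn_integral_cmult[OF m] nn_integral_cmult[OF borel_measurable_times_ennreal[OF borel_measurable_const m]])
    qed
    also have "ennreal \<bar>-2\<bar> * (\<integral>\<^sup>+y. ?h (0 + (- 2) * y) * ennreal (?p (0 + (- 2) * y)) \<partial>lborel)
      = (\<integral>\<^sup>+y. ?h y * ennreal (?p y) \<partial>lborel)"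
    proof (rule nn_integral_real_affine[symmetric])
      show "(\<lambda>y. ?h y * ennreal (?p y)) \<in> borel_measurable borel"
        using measurable_compose[OF cm H, of "\<lambda>y. y" borel] measurable_compose[OF cm measurable_pair_density, of "\<lambda>y. y" borel \<kappa> a b] by simp
    qed simp
    also have "\<dots> = (\<integral>\<^sup>+p. H (p, ?d) * ennreal (pair_density 0 \<kappa> a b (p, ?d)) \<partial>coords (Suc 0))"
      by (subst nn_integral_coords_cons) (measurable, simp only: nn_integral_coords_0)
    also have "\<dots> = (\<integral>\<^sup>+z. H z * ennreal (pair_density 0 \<kappa> a b z) \<partial>pair_coords 0)"
      by (subst nn_integral_pair_coords) (measurable, simp only: nn_integral_coords_0)
    finally show "(\<integral>\<^sup>+x. H (char_pair 0 x) \<partial>Pi\<^sub>M {..<2 * 0 + 1} (rev_alpha_law \<beta> a b)) = ennreal (1 / D) * (\<integral>\<^sup>+z. H z * ennreal (pair_density 0 \<kappa> a b z) \<partial>pair_coords 0)" .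
  qed
next
  case (Suc n)
  let ?M = "rev_alpha_law \<beta> a b"
  let ?I1 = "insert (2 * n + 1) {..<2 * n + 1}"
  let ?I2 = "insert (2 * n + 2) ?I1"
  let ?L = "lborel \<Otimes>\<^sub>M lborel :: (real \<times> real) measure"
  interpret product_sigma_finite "rev_alpha_law \<beta> a b" by (rule product_sigma_finite_rev_alpha_law)
  obtain K where K: "0 < K" and IH: "\<And>H. H \<in> borel_measurable (pair_coords n) \<Longrightarrow>
    (\<integral>\<^sup>+x. H (char_pair n x) \<partial>Pi\<^sub>M {..<2 * n + 1} ?M) = ennreal K * (\<integral>\<^sup>+z. H z * ennreal (pair_density n \<kappa> a b z) \<partial>pair_coords n)"
    using Suc.IH by blast
  let ?b1 = "beta_density (rev_param1 \<beta> a b (2 * n + 1)) (rev_param2 \<beta> a b (2 * n + 1))"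
  let ?b2 = "beta_density (rev_param1 \<beta> a b (2 * n + 2)) (rev_param2 \<beta> a b (2 * n + 2))"
  let ?b = "\<lambda>w. ennreal (?b1 (fst w)) * ennreal (?b2 (snd w))"
  let ?i = "\<lambda>w::real \<times> real. indicator {-1<..<1} (fst w) * indicator {-1<..<1} (snd w) :: ennreal"
  obtain C where C: "0 < C" and jC: "\<And>v c z. ?b1 v * ?b2 c * pair_density n \<kappa> a b z
    = C * (indicator {-1<..<1} v * indicator {-1<..<1} c * step_jacobian n v c * pair_density (Suc n) \<kappa> a b (step_coord n (v, c) z))"
    using pair_density_step[OF par \<kappa>, of n] by metis
  have b0: "0 \<le> ?b1 v" "0 \<le> ?b2 v" for v
    using rev_param_pos[OF par] by (auto simp: beta_density_eq intro!: mult_nonneg_nonneg less_imp_le[OF beta_const_pos])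
  have sf: "sigma_finite_measure (pair_coords n)" "sigma_finite_measure (lborel \<Otimes>\<^sub>M lborel :: (real \<times> real) measure)"
    by (intro sigma_finite_pair_measure sigma_finite_coords sigma_finite_lborel)+
  show ?case
  proof (intro exI[of _ "K * C"] conjI ballI)
    show "0 < K * C" using K C by simp
    fix H :: "(nat \<Rightarrow> real) \<times> (nat \<Rightarrow> real) \<Rightarrow> ennreal"
    assume H[measurable]: "H \<in> borel_measurable (pair_coords (Suc n))"
    note [measurable] = measurable_pair_density
    define F where "F z = H z * ennreal (pair_density (Suc n) \<kappa> a b z)" for z
    let ?g = "\<lambda>w z. ennreal (step_jacobian n (fst w) (snd w)) * F (step_coord n w z)"
    have Fm[measurable]: "F \<in> borel_measurable (pair_coords (Suc n))" unfolding F_def by measurable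
    define H' where "H' z = (\<integral>\<^sup>+w. ?b w * H (step_coord n w z) \<partial>?L)" for z
    have m1: "(\<lambda>(z, w). ?b w * H (step_coord n w z))
      \<in> borel_measurable (pair_coords n \<Otimes>\<^sub>M ?L)" by measurable
    have H'm[measurable]: "H' \<in> borel_measurable (pair_coords n)"
      unfolding H'_def by (rule sigma_finite_measure.borel_measurable_nn_integral[OF sf(2) m1])
    have I1: "{..<2 * Suc n + 1} = ?I2" by auto
    have m2: "(\<lambda>x. H (char_pair (Suc n) x)) \<in> borel_measurable (Pi\<^sub>M ?I2 ?M)"
    proof (rule measurable_compose[OF measurable_char_pair H])
      fix i assume "i < 2 * Suc n + 1"
      then have "i \<in> ?I2" by auto
      then show "(\<lambda>x. x i) \<in> borel_measurable (Pi\<^sub>M ?I2 ?M)"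
        by (rule measurable_component_rev_alpha_law)
    qed
    have "(\<integral>\<^sup>+x. H (char_pair (Suc n) x) \<partial>Pi\<^sub>M {..<2 * Suc n + 1} (rev_alpha_law \<beta> a b))
      = (\<integral>\<^sup>+x. (\<integral>\<^sup>+c. H (char_pair (Suc n) (x(2 * n + 2 := c))) \<partial>?M (2 * n + 2)) \<partial>Pi\<^sub>M ?I1 ?M)"
      unfolding I1 by (rule product_nn_integral_insert[OF _ _ m2]) auto
    also have "\<dots> = (\<integral>\<^sup>+x. (\<integral>\<^sup>+v. (\<integral>\<^sup>+c. H (char_pair (Suc n) (x(2 * n + 1 := v, 2 * n + 2 := c))) \<partial>?M (2 * n + 2)) \<partial>?M (2 * n + 1)) \<partial>Pi\<^sub>M {..<2 * n + 1} ?M)"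
    proof (rule product_nn_integral_insert)
      have "(\<lambda>(x, c). H (char_pair (Suc n) (x(2 * n + 2 := c)))) \<in> borel_measurable (Pi\<^sub>M ?I1 ?M \<Otimes>\<^sub>M ?M (2 * n + 2))"
        using measurable_compose[OF measurable_add_dim m2] by (simp only: case_prod_unfold)
      then show "(\<lambda>x. \<integral>\<^sup>+c. H (char_pair (Suc n) (x(2 * n + 2 := c))) \<partial>?M (2 * n + 2)) \<in> borel_measurable (Pi\<^sub>M ?I1 ?M)"
        by (rule sigma_finite_measure.borel_measurable_nn_integral[OF sigma_finite_measures])
    qed auto
    also have "\<dots> = (\<integral>\<^sup>+x. H' (char_pair n x) \<partial>Pi\<^sub>M {..<2 * n + 1} ?M)"
    proof (rule nn_integral_cong)
      fix x assume x: "x \<in> space (Pi\<^sub>M {..<2 * n + 1} ?M)"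
      have sn: "char_pair n x \<in> space (pair_coords n)"
      proof -
        have "char_pair n \<in> Pi\<^sub>M {..<2 * n + 1} ?M \<rightarrow>\<^sub>M pair_coords n"
        proof (rule measurable_char_pair)
          fix i assume "i < 2 * n + 1"
          then have "i \<in> {..<2 * n + 1}" by simp
          then show "(\<lambda>x. x i) \<in> borel_measurable (Pi\<^sub>M {..<2 * n + 1} ?M)" by (rule measurable_component_rev_alpha_law)
        qed
        from measurable_space[OF this x] show ?thesis .
      qed
      have e: "char_pair (Suc n) (x(2 * n + 1 := v, 2 * n + 2 := c)) = step_coord n (v, c) (char_pair n x)" for v c
        using char_pair_cong[of n "x(2 * n + 1 := v, 2 * n + 2 := c)" x] by simp
      define h where "h w = H (step_coord n w (char_pair n x))" for w
      have hm[measurable]: "h \<in> borel_measurable ?L"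
      proof -
        have "(\<lambda>w. step_coord n w (char_pair n x)) \<in> ?L \<rightarrow>\<^sub>M pair_coords (Suc n)"
          by (rule measurable_step_coord[OF measurable_ident_sets[OF refl]]) (rule measurable_const[OF sn])
        from measurable_compose[OF this H] show ?thesis unfolding h_def .
      qed
      have hm2: "(\<lambda>c. h (v, c)) \<in> borel_measurable borel" for v
        using measurable_compose[OF measurable_Pair1' hm, of v] by simp
      have "(\<integral>\<^sup>+v. (\<integral>\<^sup>+c. h (v, c) \<partial>?M (2 * n + 2)) \<partial>?M (2 * n + 1))
        = (\<integral>\<^sup>+v. (\<integral>\<^sup>+c. ennreal (?b2 c) * h (v, c) \<partial>lborel) \<partial>?M (2 * n + 1))"
        unfolding rev_alpha_law_def[of _ _ _ "2 * n + 2"] by (intro nn_integral_cong nn_integral_density) (use hm2 in auto)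
      also have "\<dots> = (\<integral>\<^sup>+v. ennreal (?b1 v) * (\<integral>\<^sup>+c. ennreal (?b2 c) * h (v, c) \<partial>lborel) \<partial>lborel)"
        unfolding rev_alpha_law_def by (rule nn_integral_density) measurable
      also have "\<dots> = (\<integral>\<^sup>+v. (\<integral>\<^sup>+c. ennreal (?b1 v) * ennreal (?b2 c) * h (v, c) \<partial>lborel) \<partial>lborel)"
        unfolding mult.assoc by (intro nn_integral_cong nn_integral_cmult[symmetric]) (use hm2 in auto)
      also have "\<dots> = (\<integral>\<^sup>+w. ?b w * h w \<partial>?L)"
      proof -
        have "(\<lambda>w. ?b w * h w) \<in> borel_measurable ?L"
          by (intro borel_measurable_times_ennreal hm) measurable
        from sigma_finite_measure.nn_integral_fst[OF sigma_finite_lborel this]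
        show ?thesis by (simp only: fst_conv snd_conv)
      qed
      finally show "(\<integral>\<^sup>+v. (\<integral>\<^sup>+c. H (char_pair (Suc n) (x(2 * n + 1 := v, 2 * n + 2 := c))) \<partial>?M (2 * n + 2)) \<partial>?M (2 * n + 1)) = H' (char_pair n x)"
        unfolding e H'_def h_def .
    qed
    also have "\<dots> = ennreal K * (\<integral>\<^sup>+z. H' z * ennreal (pair_density n \<kappa> a b z) \<partial>pair_coords n)" by (rule IH[OF H'm])
    also have "(\<integral>\<^sup>+z. H' z * ennreal (pair_density n \<kappa> a b z) \<partial>pair_coords n)
      = (\<integral>\<^sup>+z. (\<integral>\<^sup>+w. ennreal C * (?i w * ?g w z) \<partial>?L) \<partial>pair_coords n)"
    proof (rule nn_integral_cong)
      fix z assume z: "z \<in> space (pair_coords n)"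
      have m: "(\<lambda>w. ?b w * H (step_coord n w z)) \<in> borel_measurable ?L"
        using measurable_compose[OF measurable_Pair1'[OF z] m1] by simp
      have "H' z * ennreal (pair_density n \<kappa> a b z)
        = (\<integral>\<^sup>+w. ?b w * H (step_coord n w z) * ennreal (pair_density n \<kappa> a b z) \<partial>?L)"
        unfolding H'_def by (rule nn_integral_multc[OF m, symmetric])
      also have "\<dots> = (\<integral>\<^sup>+w. ennreal C * (?i w * ?g w z) \<partial>?L)"
      proof (rule nn_integral_cong)
        fix w :: "real \<times> real"
        obtain v c where w: "w = (v, c)" by (cases w)
        have "ennreal (?b1 v) * ennreal (?b2 c) * ennreal (pair_density n \<kappa> a b z) = ennreal (?b1 v * ?b2 c * pair_density n \<kappa> a b z)"
          using b0 pair_density_nonneg by (simp add: ennreal_mult)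
        also have "\<dots> = ennreal C * (indicator {-1<..<1} v * indicator {-1<..<1} c * (ennreal (step_jacobian n v c) * ennreal (pair_density (Suc n) \<kappa> a b (step_coord n (v, c) z))))"
        proof (cases "v \<in> {-1<..<1} \<and> c \<in> {-1<..<1}")
          case True
          then have "0 \<le> step_jacobian n v c" unfolding step_jacobian_def by auto
          then show ?thesis unfolding jC using True C pair_density_nonneg by (simp add: ennreal_mult)
        next
          case False
          then have i0: "indicator {-1<..<1} v * indicator {-1<..<1} c = (0::real)" "indicator {-1<..<1} v * indicator {-1<..<1} c = (0::ennreal)"
            by (auto simp: indicator_def)
          show ?thesis unfolding jC i0 by simp
        qed
        finally have e: "ennreal (?b1 v) * ennreal (?b2 c) * ennreal (pair_density n \<kappa> a b z) = \<dots>" .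
        have "ennreal (?b1 v) * ennreal (?b2 c) * H (step_coord n (v, c) z) * ennreal (pair_density n \<kappa> a b z)
          = (ennreal (?b1 v) * ennreal (?b2 c) * ennreal (pair_density n \<kappa> a b z)) * H (step_coord n (v, c) z)" by (simp only: mult_ac)
        then show "?b w * H (step_coord n w z) * ennreal (pair_density n \<kappa> a b z)
          = ennreal C * (?i w * ?g w z)"
          unfolding e w F_def fst_conv snd_conv by (simp only: mult_ac)
      qed
      finally show "H' z * ennreal (pair_density n \<kappa> a b z) = (\<integral>\<^sup>+w. ennreal C * (?i w * ?g w z) \<partial>?L)" .
    qed
    also have "\<dots> = (\<integral>\<^sup>+w. (\<integral>\<^sup>+z. ennreal C * (?i w * ?g w z) \<partial>pair_coords n) \<partial>?L)"
      by (rule nn_integral_coords_swap[symmetric, OF _ sf]) measurable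
    also have "\<dots> = (\<integral>\<^sup>+w. ennreal C * (?i w * (\<integral>\<^sup>+z. ?g w z \<partial>pair_coords n)) \<partial>?L)"
    proof (rule nn_integral_cong)
      fix w :: "real \<times> real" assume w: "w \<in> space ?L"
      have "(\<lambda>z. step_coord n w z) \<in> pair_coords n \<rightarrow>\<^sub>M pair_coords (Suc n)"
        by (rule measurable_step_coord[OF measurable_const[OF w] measurable_ident_sets[OF refl]])
      then have m: "(\<lambda>z. ?g w z) \<in> borel_measurable (pair_coords n)"
        by (intro borel_measurable_times_ennreal borel_measurable_const measurable_compose[OF _ Fm])
      show "(\<integral>\<^sup>+z. ennreal C * (?i w * ?g w z) \<partial>pair_coords n)
        = ennreal C * (?i w * (\<integral>\<^sup>+z. ?g w z \<partial>pair_coords n))"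
        by (simp only: nn_integral_cmult[OF borel_measurable_times_ennreal[OF borel_measurable_const m]] nn_integral_cmult[OF m])
    qed
    also have "\<dots> = ennreal C * (\<integral>\<^sup>+w. ?i w * (\<integral>\<^sup>+z. ?g w z \<partial>pair_coords n) \<partial>?L)"
    proof (rule nn_integral_cmult, intro borel_measurable_times_ennreal sigma_finite_measure.borel_measurable_nn_integral[OF sf(1)])
      show "(\<lambda>(w, z). ?g w z)
        \<in> borel_measurable (?L \<Otimes>\<^sub>M pair_coords n)" by measurable
    qed measurable
    also have "(\<integral>\<^sup>+w. ?i w * (\<integral>\<^sup>+z. ?g w z \<partial>pair_coords n) \<partial>?L)
      = (\<integral>\<^sup>+z. F z \<partial>pair_coords (Suc n))"
      by (rule nn_integral_step[OF Fm]) (simp add: F_def pair_density_def)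
    finally show "(\<integral>\<^sup>+x. H (char_pair (Suc n) x) \<partial>Pi\<^sub>M {..<2 * Suc n + 1} (rev_alpha_law \<beta> a b))
      = ennreal (K * C) * (\<integral>\<^sup>+z. H z * ennreal (pair_density (Suc n) \<kappa> a b z) \<partial>pair_coords (Suc n))"
      using K C unfolding F_def by (simp add: ennreal_mult mult.assoc)
  qed
qed

section \<open>Characteristic polynomials of the Jacobi matrix\<close>

definition tridiag :: "(nat \<Rightarrow> real) \<Rightarrow> (nat \<Rightarrow> real) \<Rightarrow> nat \<Rightarrow> nat \<Rightarrow> real poly mat" where
  "tridiag d e k m = mat m m (\<lambda>(i, j). if i = j then [:- d (k + i), 1:] else if j = Suc i then [:- e (k + i):]
     else if i = Suc j then [:- e (k + j):] else 0)"

fun tri_poly :: "(nat \<Rightarrow> real) \<Rightarrow> (nat \<Rightarrow> real) \<Rightarrow> nat \<Rightarrow> nat \<Rightarrow> real poly" where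
  "tri_poly d e k 0 = 1"
| "tri_poly d e k (Suc 0) = [:- d k, 1:]"
| "tri_poly d e k (Suc (Suc m)) = [:- d k, 1:] * tri_poly d e (Suc k) (Suc m) - smult ((e k)\<^sup>2) (tri_poly d e (Suc (Suc k)) m)"

text \<open>Expansion along the first row, and of the second minor along its first column.\<close>

lemma det_tridiag: "det (tridiag d e k m) = tri_poly d e k m"
proof (induction d e k m rule: tri_poly.induct)
  case (1 d e k)
  then show ?case by (simp add: tridiag_def)
next
  case (2 d e k)
  have "det (tridiag d e k (Suc 0)) = (\<Sum>j<Suc 0. tridiag d e k (Suc 0) $$ (0, j) * cofactor (tridiag d e k (Suc 0)) 0 j)"
    by (rule laplace_expansion_row) (auto simp: tridiag_def)
  also have "\<dots> = [:- d k, 1:]"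
  proof -
    have "det (mat_delete (tridiag d e k (Suc 0)) 0 0) = 1"
      by (rule det_dim_zero) (auto simp: tridiag_def mat_delete_def)
    then show ?thesis by (simp add: tridiag_def cofactor_def)
  qed
  finally show ?case by simp
next
  case (3 d e k m)
  let ?A = "tridiag d e k (Suc (Suc m))"
  let ?B = "mat_delete ?A 0 1"
  have A: "?A \<in> carrier_mat (Suc (Suc m)) (Suc (Suc m))" by (simp add: tridiag_def)
  have B: "?B \<in> carrier_mat (Suc m) (Suc m)" by (simp add: tridiag_def mat_delete_def)
  have A00: "mat_delete ?A 0 0 = tridiag d e (Suc k) (Suc m)"
    by (rule eq_matI) (auto simp: tridiag_def mat_delete_def)
  have B00: "mat_delete ?B 0 0 = tridiag d e (Suc (Suc k)) m"
    by (rule eq_matI) (auto simp: tridiag_def mat_delete_def)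
  have "det ?B = (\<Sum>i<Suc m. ?B $$ (i, 0) * cofactor ?B i 0)"
    by (rule laplace_expansion_column[OF B]) simp
  also have "\<dots> = (\<Sum>i<Suc m. if i = 0 then [:- e k:] * cofactor ?B 0 0 else 0)"
    by (rule sum.cong) (auto simp: tridiag_def mat_delete_def)
  also have "\<dots> = [:- e k:] * tri_poly d e (Suc (Suc k)) m"
    using 3(2) by (simp add: cofactor_def B00[unfolded One_nat_def] del: sum.lessThan_Suc)
  finally have dB: "det ?B = [:- e k:] * tri_poly d e (Suc (Suc k)) m" .
  have "det ?A = (\<Sum>j<Suc (Suc m). ?A $$ (0, j) * cofactor ?A 0 j)"
    by (rule laplace_expansion_row[OF A]) simp
  also have "\<dots> = (\<Sum>j<Suc (Suc m). (if j = 0 then [:- d k, 1:] * cofactor ?A 0 0 else 0) + (if j = 1 then [:- e k:] * cofactor ?A 0 1 else 0))"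
    by (rule sum.cong) (auto simp: tridiag_def)
  also have "\<dots> = [:- d k, 1:] * cofactor ?A 0 0 + [:- e k:] * cofactor ?A 0 1"
    by (simp add: sum.distrib del: sum.lessThan_Suc)
  also have "cofactor ?A 0 0 = tri_poly d e (Suc k) (Suc m)" using 3(1) by (simp add: cofactor_def A00)
  also have "cofactor ?A 0 1 = - ([:- e k:] * tri_poly d e (Suc (Suc k)) m)" by (simp add: cofactor_def dB[unfolded One_nat_def])
  finally show ?case by (simp add: power2_eq_square)
qed

lemma char_poly_jacobi_matrix:
  "char_poly (jacobi_matrix n \<alpha>) = tri_poly (jacobi_diag n \<alpha>) (jacobi_offdiag n \<alpha>) 0 n"
proof -
  have "char_poly_matrix (jacobi_matrix n \<alpha>) = tridiag (jacobi_diag n \<alpha>) (jacobi_offdiag n \<alpha>) 0 n"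
    by (rule eq_matI) (auto simp: char_poly_matrix_def jacobi_matrix_def tridiag_def)
  then show ?thesis unfolding char_poly_def by (simp add: det_tridiag)
qed

lemma tri_poly_shift:
  "(\<And>i. k \<le> i \<Longrightarrow> d' (Suc i) = d i) \<Longrightarrow> (\<And>i. k \<le> i \<Longrightarrow> e' (Suc i) = e i) \<Longrightarrow>
   tri_poly d' e' (Suc k) m = tri_poly d e k m"
proof (induction d e k m rule: tri_poly.induct)
  case (3 d e k m)
  then show ?case by simp
qed auto

definition reversed :: "nat \<Rightarrow> (nat \<Rightarrow> real) \<Rightarrow> nat \<Rightarrow> real" where
  "reversed n x k = x (2 * n - k)"

lemma alpha_ext_reversed_Suc:
  "0 \<le> k \<Longrightarrow> alpha_ext (Suc (Suc n)) (reversed (Suc n) x) (k + 2) = alpha_ext (Suc n) (reversed n x) k"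
  by (auto simp: alpha_ext_def reversed_def nat_add_distrib intro!: arg_cong[where f=x])

lemma alpha_ext_nat:
  "k \<le> 2 * n \<Longrightarrow> alpha_ext (Suc n) (reversed n x) (int k) = x (2 * n - k)"
  by (auto simp: alpha_ext_def reversed_def)

lemma alpha_ext_minus1: "alpha_ext (Suc n) \<alpha> (- 1) = - 1"
  by (simp add: alpha_ext_def)

text \<open>Putting two parameters in front shifts the entries of the Jacobi matrix by one place, except that the entries \<open>b\<^sub>1\<close> and \<open>a\<^sub>1\<close>
  of the smaller matrix, which are formed with \<open>\<alpha>\<^bsub>-1\<^esub> = -1\<close>, are replaced by new ones. The three-term
  recurrences of both matrices then combine to the two step formulas.\<close>

lemma cpoly_char_pair:
  assumes "\<And>i. i \<le> 2 * n \<Longrightarrow> \<bar>x i\<bar> < 1"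
  shows "cpoly 1 (Suc n) (fst (char_pair n x)) = tri_poly (jacobi_diag (Suc n) (reversed n x)) (jacobi_offdiag (Suc n) (reversed n x)) 0 (Suc n)
    \<and> cpoly 1 n (snd (char_pair n x)) = tri_poly (jacobi_diag (Suc n) (reversed n x)) (jacobi_offdiag (Suc n) (reversed n x)) 1 n"
  using assms
proof (induction n)
  case 0
  have "alpha_ext (Suc 0) (reversed 0 x) 0 = x 0" using alpha_ext_nat[of 0 0 x] by simp
  then show ?case by (simp add: jacobi_diag_def Let_def alpha_ext_minus1)
next
  case (Suc n)
  define A where "A = alpha_ext (Suc n) (reversed n x)"
  define A' where "A' = alpha_ext (Suc (Suc n)) (reversed (Suc n) x)"
  define d where "d = jacobi_diag (Suc n) (reversed n x)"
  define e where "e = jacobi_offdiag (Suc n) (reversed n x)"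
  define d' where "d' = jacobi_diag (Suc (Suc n)) (reversed (Suc n) x)"
  define e' where "e' = jacobi_offdiag (Suc (Suc n)) (reversed (Suc n) x)"
  define v where "v = x (2 * n + 1)"
  define c where "c = x (2 * n + 2)"
  define u where "u = (1 - v) / 2"
  have A'A: "A' (k + 2) = A k" if "0 \<le> k" for k
    unfolding A_def A'_def by (rule alpha_ext_reversed_Suc[OF that])
  have A'0: "A' 0 = c" "A' 1 = v" "A' (-1) = -1"
    using alpha_ext_nat[of 0 "Suc n" x] alpha_ext_nat[of 1 "Suc n" x]
    by (auto simp: A'_def c_def v_def alpha_ext_minus1)
  have Am1: "A (-1) = -1" by (simp add: A_def alpha_ext_minus1)
  have Ab: "\<bar>A (int k)\<bar> \<le> 1" if "k \<le> Suc (2 * n)" for k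
  proof (cases "k \<le> 2 * n")
    case True
    have "\<bar>x (2 * n - k)\<bar> < 1" using Suc.prems by simp
    then show ?thesis using alpha_ext_nat[OF True, of x] by (simp add: A_def)
  next
    case False
    then have "k = Suc (2 * n)" using that by simp
    then have "A (int k) = -1" by (simp add: A_def alpha_ext_def)
    then show ?thesis by simp
  qed
  have sq: "t\<^sup>2 \<le> 1" if "\<bar>t\<bar> \<le> 1" for t :: real using that by (simp add: abs_square_le_1)
  have vc: "\<bar>v\<bar> < 1" "\<bar>c\<bar> < 1" using Suc.prems by (auto simp: v_def c_def)
  have ds: "d' (Suc i) = d i" if "1 \<le> i" for i
    using A'A[of "2 * int i - 1"] A'A[of "2 * int i"] A'A[of "2 * int i - 2"] that
    unfolding d_def d'_def jacobi_diag_def Let_def A_def[symmetric] A'_def[symmetric] by (simp add: algebra_simps)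
  have es: "e' (Suc i) = e i" if "1 \<le> i" for i
    using A'A[of "2 * int i - 1"] A'A[of "2 * int i"] A'A[of "2 * int i + 1"] that
    unfolding e_def e'_def jacobi_offdiag_def Let_def A_def[symmetric] A'_def[symmetric] by (simp add: algebra_simps)
  have shift: "tri_poly d' e' (Suc k) m = tri_poly d e k m" if "1 \<le> k" for k m
    using that by (intro tri_poly_shift ds es) auto
  let ?p = "cpoly 1 (Suc n) (fst (char_pair n x))" and ?q = "cpoly 1 n (snd (char_pair n x))"
  have IH: "?p = tri_poly d e 0 (Suc n)" "?q = tri_poly d e 1 n"
    using Suc.IH Suc.prems unfolding d_def e_def by auto
  have d'0: "d' 0 = 2 * c"
    unfolding d'_def jacobi_diag_def Let_def A'_def[symmetric] by (simp add: A'0)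
  have e'0: "(e' 0)\<^sup>2 = offdiag_sq v c"
  proof -
    have "0 \<le> 2 * (1 - c\<^sup>2) * (1 + v)" using vc sq[of c] by simp
    then have "(e' 0)\<^sup>2 = 2 * (1 - c\<^sup>2) * (1 + v)"
      unfolding e'_def jacobi_offdiag_def Let_def A'_def[symmetric] by (simp add: A'0)
    then show ?thesis by (simp add: offdiag_sq_def algebra_simps)
  qed
  have A'23: "A' 2 = A 0" "A' 3 = A 1" using A'A[of 0] A'A[of 1] by simp_all
  have d0: "d 0 = 2 * A 0"
    unfolding d_def jacobi_diag_def Let_def A_def[symmetric] by (simp add: Am1)
  have d'1: "d' 1 = (1 - v) * A 0 - (1 + v) * c"
    unfolding d'_def jacobi_diag_def Let_def A'_def[symmetric] by (simp add: A'0 A'23)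
  have lin: "[:- d' 1, 1:] = smult u [:- d 0, 1:] + smult (1 - u) [:2 * c, 1:]"
    unfolding d'1 d0 by (simp add: u_def field_simps)
  have e'1: "(e' 1)\<^sup>2 = u * (e 0)\<^sup>2"
  proof -
    have r: "0 \<le> (1 - (A 0)\<^sup>2) * (1 + A 1)"
      using sq[OF Ab[of 0]] Ab[of 1] by (intro mult_nonneg_nonneg) (auto simp: abs_le_iff)
    have "e 0 = sqrt (2 * ((1 - (A 0)\<^sup>2) * (1 + A 1)))"
      unfolding e_def jacobi_offdiag_def Let_def A_def[symmetric] by (simp add: Am1 algebra_simps)
    then have "(e 0)\<^sup>2 = 2 * ((1 - (A 0)\<^sup>2) * (1 + A 1))"
      using r by (simp only: real_sqrt_pow2 mult_nonneg_nonneg zero_le_numeral)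
    moreover have "(e' 1)\<^sup>2 = (1 - v) * ((1 - (A 0)\<^sup>2) * (1 + A 1))"
    proof -
      have "0 \<le> (1 - v) * ((1 - (A 0)\<^sup>2) * (1 + A 1))" by (rule mult_nonneg_nonneg[OF _ r]) (use vc in simp)
      moreover have "e' 1 = sqrt ((1 - v) * ((1 - (A 0)\<^sup>2) * (1 + A 1)))"
        unfolding e'_def jacobi_offdiag_def Let_def A'_def[symmetric] by (simp add: A'0 A'23 mult.assoc)
      ultimately show ?thesis by (simp only: real_sqrt_pow2)
    qed
    ultimately show ?thesis by (simp add: u_def)
  qed
  have Q: "stepQ u c ?p ?q = tri_poly d' e' 1 (Suc n)"
  proof (cases n)
    case 0
    then show ?thesis unfolding IH stepQ_def using lin by simp
  next
    case (Suc m)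
    have s: "tri_poly d' e' (Suc (Suc 0)) (Suc m) = tri_poly d e 1 (Suc m)" "tri_poly d' e' (Suc (Suc (Suc 0))) m = tri_poly d e (Suc (Suc 0)) m"
      using shift[of 1 "Suc m"] shift[of "Suc (Suc 0)" m] by simp_all
    have "tri_poly d' e' 1 (Suc n) = [:- d' 1, 1:] * tri_poly d e 1 (Suc m) - smult ((e' 1)\<^sup>2) (tri_poly d e (Suc (Suc 0)) m)"
      using s by (simp only: Suc One_nat_def tri_poly.simps)
    also have "\<dots> = smult u ([:- d 0, 1:] * tri_poly d e 1 (Suc m) - smult ((e 0)\<^sup>2) (tri_poly d e (Suc (Suc 0)) m))
        + smult (1 - u) ([:2 * c, 1:] * tri_poly d e 1 (Suc m))"
    proof -
      have "(smult u L1 + smult (1 - u) L2) * t - smult (u * h) r = smult u (L1 * t - smult h r) + smult (1 - u) (L2 * t)"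
        for L1 L2 t r :: "real poly" and h by (simp add: algebra_simps smult_diff_right)
      then show ?thesis unfolding lin e'1 .
    qed
    also have "\<dots> = stepQ u c ?p ?q"
      unfolding IH stepQ_def by (simp only: Suc One_nat_def tri_poly.simps)
    finally show ?thesis by simp
  qed
  have st: "char_pair (Suc n) x = step_coord n (v, c) (fst (char_pair n x), snd (char_pair n x))" by (simp add: v_def c_def)
  have sQ: "cpoly 1 (Suc n) (snd (char_pair (Suc n) x)) = tri_poly d' e' 1 (Suc n)"
    unfolding st cpoly_step_coord u_def[symmetric] by (rule Q)
  have k: "4 * (1 - u) * (1 - c\<^sup>2) = offdiag_sq v c" by (simp add: offdiag_sq_def u_def field_simps)
  have "cpoly 1 (Suc (Suc n)) (fst (char_pair (Suc n) x)) = stepP u c ?p ?q"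
    unfolding st cpoly_step_coord u_def[symmetric] ..
  also have "\<dots> = [:- d' 0, 1:] * tri_poly d' e' 1 (Suc n) - smult ((e' 0)\<^sup>2) (tri_poly d' e' 2 n)"
    unfolding stepP_def Q k d'0 e'0 using shift[of 1 n] IH(2) by (simp add: numeral_2_eq_2)
  also have "\<dots> = tri_poly d' e' 0 (Suc (Suc n))" by (simp add: numeral_2_eq_2)
  finally show ?case using sQ unfolding d'_def e'_def by simp
qed

lemma borel_measurable_coeff_tri_poly:
  assumes "\<And>i. (\<lambda>z. d z i) \<in> borel_measurable N" "\<And>i. (\<lambda>z. e z i) \<in> borel_measurable N"
  shows "(\<lambda>z. coeff (tri_poly (d z) (e z) k m) j) \<in> borel_measurable N"
proof (induction m arbitrary: k j rule: less_induct)
  case (less m)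
  consider "m = 0" | "m = Suc 0" | m' where "m = Suc (Suc m')" by (metis not0_implies_Suc)
  then show ?case
  proof cases
    case 3
    then show ?thesis unfolding 3 tri_poly.simps coeff_diff coeff_smult
      by (intro borel_measurable_diff borel_measurable_coeff_mult borel_measurable_coeff_linear
          borel_measurable_times borel_measurable_power assms less.IH) (auto simp: 3)
  next
    case 2
    then show ?thesis unfolding 2 tri_poly.simps by (intro borel_measurable_coeff_linear assms)
  qed simp
qed

section \<open>From coefficients to eigenvalues\<close>

definition root_vec :: "nat \<Rightarrow> (nat \<Rightarrow> real) \<Rightarrow> nat \<Rightarrow> real" where
  "root_vec n c = (\<lambda>i\<in>{..<n}. sorted_root (cpoly 1 n c) i)"

lemma measurable_root_vec: "root_vec n \<in> coords n \<rightarrow>\<^sub>M coords n"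
  unfolding root_vec_def by (rule measurable_restrict) simp

text \<open>By \<open>prod_differences\<close> the square is a symmetric product over ordered pairs of indices.\<close>

lemma vandermonde_permute:
  assumes p: "p permutes {..<n}" and x: "\<And>i. i < n \<Longrightarrow> x i = r (p i)"
  shows "\<bar>vandermonde n x\<bar> = \<bar>vandermonde n r\<bar>"
proof -
  define g where "g i = (\<Prod>j\<in>{..<n} - {i}. \<bar>r i - r j\<bar>)" for i
  have "(\<Prod>j\<in>{..<n} - {i}. \<bar>x i - x j\<bar>) = g (p i)" if i: "i < n" for i
  proof -
    have b: "bij_betw p ({..<n} - {i}) ({..<n} - {p i})"
      using bij_betw_DiffI[OF permutes_imp_bij[OF p], of "{i}" "{p i}"] i permutes_in_image[OF p, of i] by simp
    have "(\<Prod>j\<in>{..<n} - {i}. \<bar>x i - x j\<bar>) = (\<Prod>j\<in>{..<n} - {i}. \<bar>r (p i) - r (p j)\<bar>)"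
      by (rule prod.cong) (use x i in auto)
    also have "\<dots> = g (p i)" unfolding g_def by (rule prod.reindex_bij_betw[OF b])
    finally show ?thesis .
  qed
  then have "(vandermonde n x)\<^sup>2 = (\<Prod>i<n. g (p i))" unfolding prod_differences[symmetric] by simp
  also have "\<dots> = (\<Prod>i<n. g i)" using prod.permute[OF p, of g] by (simp add: comp_def)
  also have "\<dots> = (vandermonde n r)\<^sup>2" unfolding g_def by (rule prod_differences)
  finally show ?thesis by (metis real_sqrt_abs)
qed

lemma root_poly_permutation:
  assumes "root_poly n x = root_poly n r"
  obtains p where "p permutes {..<n}" "\<And>i. i < n \<Longrightarrow> x i = r (p i)"
proof -
  have "mset (map x [0..<n]) = mset (map r [0..<n])" unfolding proots_root_poly[symmetric] assms ..
  then obtain p where p: "p permutes {..<length (map r [0..<n])}" "permute_list p (map r [0..<n]) = map x [0..<n]"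
    by (rule mset_eq_permutation)
  have pn: "p permutes {..<n}" using p(1) by simp
  show ?thesis
  proof (rule that[OF pn])
    fix i assume i: "i < n"
    have "p i < n" using permutes_in_image[OF pn, of i] i by simp
    have "map x [0..<n] ! i = map r [0..<n] ! p i"
      unfolding p(2)[symmetric] using i by (intro permute_list_nth[OF p(1)]) simp
    then show "x i = r (p i)" using i \<open>p i < n\<close> by simp
  qed
qed

lemma real_split_of_vandermonde:
  assumes "vandermonde n x \<noteq> 0" shows "real_split n (root_poly n x)"
  using assms
proof (induction n)
  case 0
  then show ?case by (auto simp: real_split_def strict_mono_on_def)
next
  case (Suc n)
  then have "vandermonde n x \<noteq> 0" "poly (root_poly n x) (x n) \<noteq> 0" by (auto simp: vandermonde_Suc)
  then show ?case unfolding root_poly_Suc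
    using real_split_linear_mult[OF degree_root_poly coeff_root_poly] Suc.IH by blast
qed

text \<open>The density of \<open>P\<close> alone, up to the constant \<open>dirichlet_mass n \<kappa>\<close>.\<close>

definition marginal :: "nat \<Rightarrow> real \<Rightarrow> real \<Rightarrow> real \<Rightarrow> (nat \<Rightarrow> real) \<Rightarrow> real" where
  "marginal n \<kappa> a b P = (let r = sorted_root (cpoly 1 (Suc n) P) in
     if real_split (Suc n) (cpoly 1 (Suc n) P) \<and> (\<forall>i\<in>{..n}. \<bar>r i\<bar> < 2)
     then \<bar>poly (cpoly 1 (Suc n) P) 2\<bar> powr a * \<bar>poly (cpoly 1 (Suc n) P) (-2)\<bar> powr b * \<bar>vandermonde (Suc n) r\<bar> powr (1 + 2 * \<kappa>) else 0)"

lemma marginal_nonneg: "0 \<le> marginal n \<kappa> a b P"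
  unfolding marginal_def Let_def by auto

lemma measurable_marginal: "marginal n \<kappa> a b \<in> borel_measurable (coords (Suc n))"
proof -
  have r: "(\<lambda>c. sorted_root (cpoly 1 (Suc n) c) i) \<in> borel_measurable (coords (Suc n))" for i by measurable
  have v: "(\<lambda>c. vandermonde (Suc n) (sorted_root (cpoly 1 (Suc n) c))) \<in> borel_measurable (coords (Suc n))"
    unfolding vandermonde_def by (intro borel_measurable_prod borel_measurable_diff r)
  have p: "(\<lambda>c. poly (cpoly 1 (Suc n) c) t) \<in> borel_measurable (coords (Suc n))" for t
    by (rule measurable_poly_cpoly) auto
  have 1: "Measurable.pred (coords (Suc n)) (\<lambda>c. \<bar>sorted_root (cpoly 1 (Suc n) c) i\<bar> < 2)" for i
    using r by (intro borel_measurable_pred_less borel_measurable_abs borel_measurable_const)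
  have "Measurable.pred (coords (Suc n)) (\<lambda>c. real_split (Suc n) (cpoly 1 (Suc n) c) \<and> (\<forall>i\<in>{..n}. \<bar>sorted_root (cpoly 1 (Suc n) c) i\<bar> < 2))"
    by (intro pred_intros_logic measurable_real_split pred_intros_finite 1) simp
  then show ?thesis unfolding marginal_def Let_def
    by (intro measurable_If borel_measurable_times powr_real_measurable borel_measurable_abs p v borel_measurable_const)
      (simp only: pred_def)
qed

lemma nn_integral_marginal:
  assumes F[measurable]: "F \<in> borel_measurable (coords (Suc n))"
  shows "(\<integral>\<^sup>+z. F (fst z) * ennreal (pair_density n \<kappa> a b z) \<partial>pair_coords n)
    = dirichlet_mass n \<kappa> * (\<integral>\<^sup>+P. F P * ennreal (marginal n \<kappa> a b P) \<partial>coords (Suc n))"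
proof -
  note [measurable] = measurable_pair_density measurable_marginal
  have "(\<integral>\<^sup>+z. F (fst z) * ennreal (pair_density n \<kappa> a b z) \<partial>pair_coords n)
    = (\<integral>\<^sup>+P. (\<integral>\<^sup>+Q. F P * ennreal (pair_density n \<kappa> a b (P, Q)) \<partial>coords n) \<partial>coords (Suc n))"
  proof -
    have "(\<lambda>z. F (fst z) * ennreal (pair_density n \<kappa> a b z)) \<in> borel_measurable (pair_coords n)"
      by (intro borel_measurable_times_ennreal measurable_compose[OF measurable_fst F] measurable_compose[OF measurable_pair_density]) simp
    from sigma_finite_measure.nn_integral_fst[OF sigma_finite_coords this]
    show ?thesis by (simp only: fst_conv)
  qed
  also have "\<dots> = (\<integral>\<^sup>+P. dirichlet_mass n \<kappa> * (F P * ennreal (marginal n \<kappa> a b P)) \<partial>coords (Suc n))"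
  proof (rule nn_integral_cong)
    fix P assume P: "P \<in> space (coords (Suc n))"
    let ?p = "cpoly 1 (Suc n) P" let ?r = "sorted_root ?p"
    let ?S = "{Q. \<forall>i<Suc n. 0 < (-1) ^ (n - i) * poly (cpoly 1 n Q) (?r i)}"
    let ?W = "\<lambda>Q. \<Prod>i<Suc n. \<bar>poly (cpoly 1 n Q) (?r i)\<bar> powr \<kappa>"
    have jm: "(\<lambda>Q. ennreal (pair_density n \<kappa> a b (P, Q))) \<in> borel_measurable (coords n)"
      using P by measurable
    have i: "(\<integral>\<^sup>+Q. ennreal (pair_density n \<kappa> a b (P, Q)) \<partial>coords n) = ennreal (marginal n \<kappa> a b P) * dirichlet_mass n \<kappa>"
    proof (cases "real_split (Suc n) ?p \<and> (\<forall>i\<in>{..n}. \<bar>?r i\<bar> < 2)")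
      case False
      have "\<not> pair_admissible n (P, Q)" for Q
        using False unfolding pair_admissible_def admissible_def fst_conv real_split_def lessThan_Suc_atMost by (metis atMost_iff)
      then have "pair_density n \<kappa> a b (P, Q) = 0" for Q by (simp add: pair_density_def)
      moreover have "marginal n \<kappa> a b P = 0" using False unfolding marginal_def Let_def by (rule if_not_P)
      ultimately show ?thesis by simp
    next
      case True
      then have sm: "strict_mono_on {..n} ?r" and pr: "?p = root_poly (Suc n) ?r" and r2: "\<And>i. i \<le> n \<Longrightarrow> \<bar>?r i\<bar> < 2"
        using real_splitD[of "Suc n" ?p] unfolding lessThan_Suc_atMost by auto
      define A where "A = \<bar>poly ?p 2\<bar> powr a * \<bar>poly ?p (-2)\<bar> powr b"
      define I where "I = (\<lambda>Q. ennreal (?W Q) *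
         indicator ?S Q)"
      have ad: "pair_admissible n (P, Q) \<longleftrightarrow> (\<forall>i<Suc n. 0 < (-1) ^ (n - i) * poly (cpoly 1 n Q) (?r i))" for Q
        unfolding pair_admissible_def admissible_def fst_conv snd_conv less_Suc_eq_le using sm pr r2 by blast
      have A0: "0 \<le> A" by (simp add: A_def)
      have j: "ennreal (pair_density n \<kappa> a b (P, Q)) = ennreal A * I Q" for Q
      proof (cases "pair_admissible n (P, Q)")
        case True
        have "indicator ?S Q = (1::ennreal)"
          using True ad by (simp del: cpoly.simps)
        moreover have "0 \<le> (?W Q)" by (intro prod_nonneg) simp
        ultimately show ?thesis using True A0 unfolding I_def pair_density_def A_def fst_conv snd_conv
          by (simp only: if_True ennreal_mult mult_1_right)
      next
        case False
        then have "indicator ?S Q = (0::ennreal)"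
          using ad by (simp del: cpoly.simps)
        then show ?thesis using False unfolding I_def pair_density_def by (simp only: if_False mult_zero_right ennreal_0)
      qed
      have Im: "I \<in> borel_measurable (coords n)"
      proof -
        have 1: "(\<lambda>Q. poly (cpoly 1 n Q) t) \<in> borel_measurable (coords n)" for t
          by (rule measurable_poly_cpoly) auto
        have 2: "Measurable.pred (coords n) (\<lambda>Q. \<forall>i\<in>{..<Suc n}. 0 < (-1) ^ (n - i) * poly (cpoly 1 n Q) (?r i))"
          by (intro pred_intros_finite borel_measurable_pred_less borel_measurable_times borel_measurable_const 1) simp
        have 3: "(\<lambda>Q. \<Prod>i<Suc n. \<bar>poly (cpoly 1 n Q) (?r i)\<bar> powr \<kappa>) \<in> borel_measurable (coords n)"
          by (intro borel_measurable_prod powr_real_measurable borel_measurable_abs borel_measurable_const 1)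
        show ?thesis unfolding I_def
        proof (rule borel_measurable_times_ennreal)
          show "(\<lambda>Q. ennreal (?W Q)) \<in> borel_measurable (coords n)"
            using 3 by (rule measurable_compose) simp
          show "indicator ?S \<in> borel_measurable (coords n)"
            by (rule borel_measurable_indicator') (use 2 in \<open>simp only: pred_def mem_Collect_eq Ball_def lessThan_iff\<close>)
        qed
      qed
      have "(\<integral>\<^sup>+Q. ennreal (pair_density n \<kappa> a b (P, Q)) \<partial>coords n) = ennreal A * (\<integral>\<^sup>+Q. I Q \<partial>coords n)"
        unfolding j by (rule nn_integral_cmult[OF Im])
      also have "(\<integral>\<^sup>+Q. I Q \<partial>coords n) = ennreal (\<bar>vandermonde (Suc n) ?r\<bar> powr (1 + 2 * \<kappa>)) * dirichlet_mass n \<kappa>"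
        unfolding I_def by (rule nn_integral_second_poly[OF sm])
      also have "ennreal A * \<dots> = ennreal (marginal n \<kappa> a b P) * dirichlet_mass n \<kappa>"
        unfolding marginal_def Let_def if_P[OF True] A_def[symmetric]
        using A0 by (simp only: ennreal_mult mult.assoc powr_ge_zero)
      finally show ?thesis .
    qed
    show "(\<integral>\<^sup>+Q. F P * ennreal (pair_density n \<kappa> a b (P, Q)) \<partial>coords n) = dirichlet_mass n \<kappa> * (F P * ennreal (marginal n \<kappa> a b P))"
      unfolding nn_integral_cmult[OF jm] i by (simp only: mult_ac)
  qed
  also have "\<dots> = dirichlet_mass n \<kappa> * (\<integral>\<^sup>+P. F P * ennreal (marginal n \<kappa> a b P) \<partial>coords (Suc n))"
    by (rule nn_integral_cmult) measurable
  finally show ?thesis .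
qed

text \<open>The Vieta Jacobian raises the exponent of \<open>\<bar>\<Delta>\<bar>\<close> from \<open>1 + 2\<kappa> = \<beta> - 1\<close> to \<open>\<beta>\<close>. On the boundary of the cube, where
  the marginal vanishes by definition, the Jacobi weight vanishes because \<open>0 powr a = 0\<close> for every \<open>a\<close>.\<close>

lemma marginal_vieta:
  assumes \<beta>: "\<beta> > 0" and \<kappa>: "\<kappa> = \<beta> / 2 - 1" and x: "x \<in> space (coords (Suc n))"
  shows "marginal n \<kappa> a b (vieta (Suc n) x) * \<bar>vandermonde (Suc n) x\<bar> = jacobi_weight (Suc n) \<beta> a b x"
proof (cases "vandermonde (Suc n) x = 0")
  case True
  then show ?thesis using \<beta> by (simp add: jacobi_weight_def)
next
  case V: False
  let ?q = "root_poly (Suc n) x" and ?V = "\<bar>vandermonde (Suc n) x\<bar>"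
  let ?r = "sorted_root ?q"
  have rs: "real_split (Suc n) ?q" using V by (rule real_split_of_vandermonde)
  obtain p where p: "p permutes {..<Suc n}" "\<And>i. i < Suc n \<Longrightarrow> x i = ?r (p i)"
    using root_poly_permutation[OF real_splitD(2)[OF rs]] by blast
  have all: "(\<forall>i\<in>{..n}. \<bar>?r i\<bar> < 2) \<longleftrightarrow> (\<forall>i<Suc n. \<bar>x i\<bar> < 2)"
  proof
    assume a: "\<forall>i\<in>{..n}. \<bar>?r i\<bar> < 2"
    show "\<forall>i<Suc n. \<bar>x i\<bar> < 2"
    proof (intro allI impI)
      fix i assume i: "i < Suc n"
      then have "p i \<in> {..n}" using permutes_in_image[OF p(1), of i] by (simp add: lessThan_Suc_atMost)
      then show "\<bar>x i\<bar> < 2" using a p(2)[OF i] by simp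
    qed
  next
    assume a: "\<forall>i<Suc n. \<bar>x i\<bar> < 2"
    show "\<forall>i\<in>{..n}. \<bar>?r i\<bar> < 2"
    proof
      fix i assume "i \<in> {..n}"
      then have "i \<in> p ` {..<Suc n}" unfolding permutes_image[OF p(1)] by (simp add: lessThan_Suc_atMost)
      then obtain j where j: "j < Suc n" "i = p j" by auto
      show "\<bar>?r i\<bar> < 2" unfolding j(2) p(2)[OF j(1), symmetric] using a j(1) by blast
    qed
  qed
  have Vr: "\<bar>vandermonde (Suc n) ?r\<bar> = ?V" using vandermonde_permute[where x=x and r="?r", OF p] by simp
  have m: "marginal n \<kappa> a b (vieta (Suc n) x) = (if \<forall>i<Suc n. \<bar>x i\<bar> < 2 then
     \<bar>poly ?q 2\<bar> powr a * \<bar>poly ?q (-2)\<bar> powr b * ?V powr (1 + 2 * \<kappa>) else 0)"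
    unfolding marginal_def cpoly_vieta Let_def all Vr using rs by simp
  show ?thesis
  proof (cases "\<forall>i<Suc n. \<bar>x i\<bar> < 2")
    case True
    have i: "indicator ({..<Suc n} \<rightarrow>\<^sub>E {-2..2}) x = (1::real)"
      using True x by (auto simp: space_PiM PiE_def abs_less_iff indicator_def less_imp_le Pi_def minus_less_iff)
    have "\<bar>poly ?q 2\<bar> powr a = (\<Prod>j<Suc n. \<bar>2 - x j\<bar> powr a)"
      unfolding poly_root_poly abs_prod by (rule prod_powr_distrib)
    also have "\<dots> = (\<Prod>j<Suc n. (2 - x j) powr a)"
      by (rule prod.cong) (use True in auto)
    finally have 1: "\<bar>poly ?q 2\<bar> powr a = (\<Prod>j<Suc n. (2 - x j) powr a)" .
    have "\<bar>poly ?q (-2)\<bar> powr b = (\<Prod>j<Suc n. \<bar>-2 - x j\<bar> powr b)"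
      unfolding poly_root_poly abs_prod by (rule prod_powr_distrib)
    also have "\<dots> = (\<Prod>j<Suc n. (2 + x j) powr b)"
    proof (rule prod.cong)
      fix j assume "j \<in> {..<Suc n}"
      then have "\<bar>x j\<bar> < 2" using True by simp
      then have "\<bar>-2 - x j\<bar> = 2 + x j" by linarith
      then show "\<bar>-2 - x j\<bar> powr b = (2 + x j) powr b" by simp
    qed simp
    finally have 2: "\<bar>poly ?q (-2)\<bar> powr b = (\<Prod>j<Suc n. (2 + x j) powr b)" .
    have 3: "?V powr (1 + 2 * \<kappa>) * ?V = ?V powr \<beta>"
    proof -
      have "?V powr \<beta> = ?V powr ((1 + 2 * \<kappa>) + 1)" by (simp add: \<kappa>)
      also have "\<dots> = ?V powr (1 + 2 * \<kappa>) * ?V"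
        unfolding powr_add using V by simp
      finally show ?thesis by simp
    qed
    show ?thesis unfolding m if_P[OF True] jacobi_weight_def i prod.distrib 1 2 3[symmetric] by (simp only: mult_ac mult_1_right)
  next
    case False
    then obtain i where i: "i < Suc n" "\<not> \<bar>x i\<bar> < 2" by blast
    have "jacobi_weight (Suc n) \<beta> a b x = 0"
    proof (cases "\<bar>x i\<bar> = 2")
      case True
      then have "x i = 2 \<or> x i = -2" by linarith
      then have "(2 - x i) powr a * (2 + x i) powr b = 0" by auto
      then have "(\<Prod>j<Suc n. (2 - x j) powr a * (2 + x j) powr b) = 0" using i(1) by (intro prod_zero) auto
      then show ?thesis unfolding jacobi_weight_def by simp
    next
      case False
      then have "x \<notin> {..<Suc n} \<rightarrow>\<^sub>E {-2..2}" using i by (auto dest!: PiE_mem[of _ _ _ i])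
      then show ?thesis unfolding jacobi_weight_def by simp
    qed
    then show ?thesis unfolding m using False by auto
  qed
qed

lemma measurable_jacobi_weight: "jacobi_weight n \<beta> a b \<in> borel_measurable (coords n)"
proof -
  have c: "(\<lambda>x. x j) \<in> borel_measurable (coords n)" if "j < n" for j using that by simp
  have 1: "(\<lambda>x. \<Prod>j<n. (2 - x j) powr a * (2 + x j) powr b) \<in> borel_measurable (coords n)"
    by (intro borel_measurable_prod borel_measurable_times powr_real_measurable borel_measurable_diff borel_measurable_add borel_measurable_const c) auto
  have 2: "{..<n} \<rightarrow>\<^sub>E {-2..2} \<in> sets (coords n)"
    by (rule sets_PiM_I_finite) auto
  have 3: "(\<lambda>x. vandermonde n x) \<in> borel_measurable (coords n)" by (rule measurable_vandermonde) (rule measurable_ident_sets[OF refl])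
  show ?thesis unfolding jacobi_weight_def
    by (intro borel_measurable_times powr_real_measurable borel_measurable_abs borel_measurable_const 1 3 borel_measurable_indicator 2)
qed

lemma symmetric_root_vec:
  assumes sym: "\<And>p y. p permutes {..<n} \<Longrightarrow> y \<in> {..<n} \<rightarrow>\<^sub>E UNIV \<Longrightarrow> f (y \<circ> p) = f y"
    and x: "x \<in> space (coords n)" and V: "vandermonde n x \<noteq> 0"
  shows "f (root_vec n (vieta n x)) = f x"
proof -
  let ?r = "sorted_root (root_poly n x)"
  have rs: "real_split n (root_poly n x)" using V by (rule real_split_of_vandermonde)
  obtain p where p: "p permutes {..<n}" "\<And>i. i < n \<Longrightarrow> x i = ?r (p i)"
    using root_poly_permutation[OF real_splitD(2)[OF rs]] by blast
  let ?y = "root_vec n (vieta n x)"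
  have y: "?y = (\<lambda>i\<in>{..<n}. ?r i)" unfolding root_vec_def cpoly_vieta ..
  have "x = ?y \<circ> p"
  proof
    fix i
    show "x i = (?y \<circ> p) i"
    proof (cases "i < n")
      case True
      then have "p i < n" using permutes_in_image[OF p(1), of i] by simp
      then show ?thesis using p(2)[OF True] by (simp add: y)
    next
      case False
      then have "p i = i" using permutes_not_in[OF p(1), of i] by simp
      moreover have "x i = undefined" using x False by (auto simp: space_PiM PiE_def extensional_def)
      ultimately show ?thesis using False by (simp add: y)
    qed
  qed
  moreover have "?y \<in> {..<n} \<rightarrow>\<^sub>E UNIV" by (auto simp: y)
  ultimately show ?thesis using sym[OF p(1), of ?y] by simp
qed

text \<open>Symmetry of \<open>f\<close> is what allows the sorted roots of the polynomial with roots \<open>x\<close> to be replaced by \<open>x\<close> itself.\<close>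

theorem root_law:
  assumes par: "\<beta> > 0" "a > -1" "b > -1"
  shows "\<exists>K. \<forall>f\<in>borel_measurable (coords (Suc n)).
    (\<forall>p y. p permutes {..<Suc n} \<longrightarrow> y \<in> {..<Suc n} \<rightarrow>\<^sub>E UNIV \<longrightarrow> f (y \<circ> p) = f y) \<longrightarrow>
    of_nat (fact (Suc n)) * (\<integral>\<^sup>+x. f (root_vec (Suc n) (fst (char_pair n x))) \<partial>Pi\<^sub>M {..<2 * n + 1} (rev_alpha_law \<beta> a b))
      = K * (\<integral>\<^sup>+x. f x * ennreal (jacobi_weight (Suc n) \<beta> a b x) \<partial>coords (Suc n))"
proof -
  let ?C = "coords (Suc n)" and ?N = "of_nat (fact (Suc n)) :: ennreal" and ?w = "\<lambda>x. ennreal (jacobi_weight (Suc n) \<beta> a b x)"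
  let ?E = "\<lambda>f. \<integral>\<^sup>+x. f (root_vec (Suc n) (fst (char_pair n x))) \<partial>Pi\<^sub>M {..<2 * n + 1} (rev_alpha_law \<beta> a b)"
  define \<kappa> where "\<kappa> = \<beta> / 2 - 1"
  obtain K where K: "\<And>H. H \<in> borel_measurable (pair_coords n) \<Longrightarrow>
     (\<integral>\<^sup>+x. H (char_pair n x) \<partial>Pi\<^sub>M {..<2 * n + 1} (rev_alpha_law \<beta> a b)) = ennreal K * (\<integral>\<^sup>+z. H z * ennreal (pair_density n \<kappa> a b z) \<partial>pair_coords n)"
    using char_pair_law[OF par \<kappa>_def, of n] by blast
  show ?thesis
  proof (intro exI[of _ "ennreal K * dirichlet_mass n \<kappa>"] ballI impI)
    fix f :: "(nat \<Rightarrow> real) \<Rightarrow> ennreal"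
    assume f: "f \<in> borel_measurable (?C)"
      and sym: "\<forall>p y. p permutes {..<Suc n} \<longrightarrow> y \<in> {..<Suc n} \<rightarrow>\<^sub>E UNIV \<longrightarrow> f (y \<circ> p) = f y"
    define F where "F P = f (root_vec (Suc n) P)" for P
    have F: "F \<in> borel_measurable (?C)"
      unfolding F_def by (rule measurable_compose[OF measurable_root_vec f])
    have Ff: "(\<lambda>z. F (fst z)) \<in> borel_measurable (pair_coords n)"
      by (rule measurable_compose[OF measurable_fst F])
    define G where "G P = F P * ennreal (marginal n \<kappa> a b P)" for P
    have G: "G \<in> borel_measurable (?C)" unfolding G_def
      by (intro borel_measurable_times_ennreal F measurable_compose[OF measurable_marginal]) simp
    have "?N * (\<integral>\<^sup>+P. G P \<partial>?C)
      = ?N * (\<integral>\<^sup>+P. G P * indicator {c. real_split (Suc n) (cpoly 1 (Suc n) c)} P \<partial>?C)"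
      by (intro arg_cong[where f="\<lambda>t. ?N * t"] nn_integral_cong)
        (auto simp: G_def marginal_def Let_def indicator_def simp del: cpoly.simps)
    also have "\<dots> = (\<integral>\<^sup>+x. G (vieta (Suc n) x) * ennreal \<bar>vandermonde (Suc n) x\<bar> \<partial>?C)"
      by (rule nn_integral_vieta[OF G, symmetric])
    also have "\<dots> = (\<integral>\<^sup>+x. f x * ?w x \<partial>?C)"
    proof (rule nn_integral_cong)
      fix x assume x: "x \<in> space (?C)"
      have "ennreal (marginal n \<kappa> a b (vieta (Suc n) x)) * ennreal \<bar>vandermonde (Suc n) x\<bar> = ?w x"
        unfolding marginal_vieta[OF par(1) \<kappa>_def x, symmetric] by (rule ennreal_mult[symmetric]) (auto simp: marginal_nonneg)
      then have e: "G (vieta (Suc n) x) * ennreal \<bar>vandermonde (Suc n) x\<bar> = F (vieta (Suc n) x) * ?w x"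
        unfolding G_def by (simp only: mult.assoc)
      show "G (vieta (Suc n) x) * ennreal \<bar>vandermonde (Suc n) x\<bar> = f x * ?w x"
      proof (cases "vandermonde (Suc n) x = 0")
        case True
        then have "jacobi_weight (Suc n) \<beta> a b x = 0" using par by (simp add: jacobi_weight_def)
        then show ?thesis unfolding e by simp
      next
        case False
        have "F (vieta (Suc n) x) = f x" unfolding F_def by (rule symmetric_root_vec[OF _ x False]) (use sym in blast)
        then show ?thesis unfolding e by simp
      qed
    qed
    finally have main: "?N * (\<integral>\<^sup>+P. G P \<partial>?C) = (\<integral>\<^sup>+x. f x * ?w x \<partial>?C)" .
    have "?E f = ennreal K * (\<integral>\<^sup>+z. F (fst z) * ennreal (pair_density n \<kappa> a b z) \<partial>pair_coords n)"
      using K[OF Ff] unfolding F_def .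
    also have "\<dots> = ennreal K * (dirichlet_mass n \<kappa> * (\<integral>\<^sup>+P. G P \<partial>?C))"
      unfolding nn_integral_marginal[OF F] G_def ..
    finally have "?N * ?E f
      = ennreal K * dirichlet_mass n \<kappa> * (?N * (\<integral>\<^sup>+P. G P \<partial>?C))"
      by (simp only: mult_ac)
    then show "?N * ?E f
      = ennreal K * dirichlet_mass n \<kappa> * (\<integral>\<^sup>+x. f x * ?w x \<partial>?C)"
      unfolding main .
  qed
qed

section \<open>The Jacobi ensemble\<close>

lemma jacobi_ensemble_eq:
  "jacobi_ensemble n \<beta> a b = density (coords n) (\<lambda>x. ennreal (jacobi_weight n \<beta> a b x) /
     (\<integral>\<^sup>+x. ennreal (jacobi_weight n \<beta> a b x) \<partial>coords n))"
  unfolding jacobi_ensemble_def Let_def ..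

lemma sets_jacobi_ensemble [simp]: "sets (jacobi_ensemble n \<beta> a b) = sets (coords n)"
  by (simp add: jacobi_ensemble_eq)

lemma nn_integral_jacobi_ensemble:
  assumes f: "f \<in> borel_measurable (coords n)"
  shows "(\<integral>\<^sup>+x. f x \<partial>jacobi_ensemble n \<beta> a b) =
    (\<integral>\<^sup>+x. f x * ennreal (jacobi_weight n \<beta> a b x) \<partial>coords n) / (\<integral>\<^sup>+x. ennreal (jacobi_weight n \<beta> a b x) \<partial>coords n)"
proof -
  let ?Z = "\<integral>\<^sup>+x. ennreal (jacobi_weight n \<beta> a b x) \<partial>coords n"
  have w: "(\<lambda>x. ennreal (jacobi_weight n \<beta> a b x)) \<in> borel_measurable (coords n)"
    by (rule measurable_compose[OF measurable_jacobi_weight]) simp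
  have "(\<integral>\<^sup>+x. f x \<partial>jacobi_ensemble n \<beta> a b) = (\<integral>\<^sup>+x. ennreal (jacobi_weight n \<beta> a b x) / ?Z * f x \<partial>coords n)"
    unfolding jacobi_ensemble_eq by (rule nn_integral_density) (use w f in auto)
  also have "\<dots> = (\<integral>\<^sup>+x. (f x * ennreal (jacobi_weight n \<beta> a b x)) / ?Z \<partial>coords n)"
    by (intro nn_integral_cong) (simp only: divide_ennreal_def mult_ac)
  also have "\<dots> = (\<integral>\<^sup>+x. f x * ennreal (jacobi_weight n \<beta> a b x) \<partial>coords n) / ?Z"
    by (rule nn_integral_divide) (intro borel_measurable_times_ennreal f w)
  finally show ?thesis .
qed

text \<open>For \<open>f = 1\<close> the left-hand side of \<open>root_law\<close> is \<open>(n + 1)!\<close>, which is neither \<open>0\<close> nor infinite. Hence the same holds for the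
  total mass of the Jacobi weight, and the constant is the quotient.\<close>

lemma symmetric_root_law:
  assumes par: "\<beta> > 0" "a > -1" "b > -1" and pr: "prob_space (Pi\<^sub>M {..<2 * n + 1} (rev_alpha_law \<beta> a b))"
  shows "prob_space (jacobi_ensemble (Suc n) \<beta> a b)"
    and "\<And>f. f \<in> borel_measurable (coords (Suc n)) \<Longrightarrow>
      (\<And>p y. p permutes {..<Suc n} \<Longrightarrow> y \<in> {..<Suc n} \<rightarrow>\<^sub>E UNIV \<Longrightarrow> f (y \<circ> p) = f y) \<Longrightarrow>
      (\<integral>\<^sup>+x. f (root_vec (Suc n) (fst (char_pair n x))) \<partial>Pi\<^sub>M {..<2 * n + 1} (rev_alpha_law \<beta> a b))
        = (\<integral>\<^sup>+x. f x \<partial>jacobi_ensemble (Suc n) \<beta> a b)"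
proof -
  let ?W = "\<lambda>x. ennreal (jacobi_weight (Suc n) \<beta> a b x)"
  define Z where "Z = (\<integral>\<^sup>+x. ?W x \<partial>coords (Suc n))"
  define c where "c = (of_nat (fact (Suc n)) :: ennreal)"
  have c: "c \<noteq> 0" "c \<noteq> \<infinity>" unfolding c_def by (simp_all del: fact_Suc)
  obtain K where K: "\<And>f. f \<in> borel_measurable (coords (Suc n)) \<Longrightarrow>
    (\<And>p y. p permutes {..<Suc n} \<Longrightarrow> y \<in> {..<Suc n} \<rightarrow>\<^sub>E UNIV \<Longrightarrow> f (y \<circ> p) = f y) \<Longrightarrow>
    c * (\<integral>\<^sup>+x. f (root_vec (Suc n) (fst (char_pair n x))) \<partial>Pi\<^sub>M {..<2 * n + 1} (rev_alpha_law \<beta> a b))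
      = K * (\<integral>\<^sup>+x. f x * ?W x \<partial>coords (Suc n))"
    using root_law[OF par, of n] unfolding c_def by blast
  \<comment> \<open>The case \<open>f = 1\<close>.\<close>
  have KZ: "c = K * Z"
    using K[of "\<lambda>_. 1"] prob_space.emeasure_space_1[OF pr] by (simp add: Z_def)
  then have Z0: "Z \<noteq> 0" using c by auto
  have ZI: "Z \<noteq> \<infinity>"
  proof
    assume "Z = \<infinity>"
    then show False using KZ c by (cases "K = 0") (auto simp: ennreal_mult_top)
  qed
  have nn: "(\<integral>\<^sup>+x. f (root_vec (Suc n) (fst (char_pair n x))) \<partial>Pi\<^sub>M {..<2 * n + 1} (rev_alpha_law \<beta> a b))
        = (\<integral>\<^sup>+x. f x \<partial>jacobi_ensemble (Suc n) \<beta> a b)" (is "?E = _")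
    if f: "f \<in> borel_measurable (coords (Suc n))"
      and sym: "\<And>p y. p permutes {..<Suc n} \<Longrightarrow> y \<in> {..<Suc n} \<rightarrow>\<^sub>E UNIV \<Longrightarrow> f (y \<circ> p) = f y" for f
  proof -
    let ?I = "\<integral>\<^sup>+x. f x * ?W x \<partial>coords (Suc n)"
    have "c * ?E = K * ?I" by (rule K[OF f sym])
    also have "K = c / Z" unfolding KZ using Z0 ZI by (simp add: ennreal_mult_divide_eq)
    also have "c / Z * ?I = c * (?I / Z)" by (simp only: divide_ennreal_def mult_ac)
    finally have "c * ?E / c = c * (?I / Z) / c" by simp
    then have "?E = ?I / Z" using c by (simp add: ennreal_mult_divide_eq mult.commute[of c])
    then show ?thesis unfolding nn_integral_jacobi_ensemble[OF f] Z_def .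
  qed
  then show "\<And>f. f \<in> borel_measurable (coords (Suc n)) \<Longrightarrow>
      (\<And>p y. p permutes {..<Suc n} \<Longrightarrow> y \<in> {..<Suc n} \<rightarrow>\<^sub>E UNIV \<Longrightarrow> f (y \<circ> p) = f y) \<Longrightarrow>
      (\<integral>\<^sup>+x. f (root_vec (Suc n) (fst (char_pair n x))) \<partial>Pi\<^sub>M {..<2 * n + 1} (rev_alpha_law \<beta> a b))
        = (\<integral>\<^sup>+x. f x \<partial>jacobi_ensemble (Suc n) \<beta> a b)" .
  show "prob_space (jacobi_ensemble (Suc n) \<beta> a b)"
  proof (rule prob_spaceI)
    show "emeasure (jacobi_ensemble (Suc n) \<beta> a b) (space (jacobi_ensemble (Suc n) \<beta> a b)) = 1"
      using nn[of "\<lambda>_. 1"] prob_space.emeasure_space_1[OF pr] by simp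
  qed
qed

lemma alpha_params_reversed:
  assumes "m \<le> 2 * n"
  shows "alpha_param1 (Suc n) \<beta> a b (2 * n - m) = rev_param1 \<beta> a b m" "alpha_param2 (Suc n) \<beta> a b (2 * n - m) = rev_param2 \<beta> a b m"
proof -
  have e: "even (2 * n - m) \<longleftrightarrow> even m" using assms by presburger
  have r: "real (2 * n - m) = 2 * real n - real m" using assms by (simp add: of_nat_diff)
  show "alpha_param1 (Suc n) \<beta> a b (2 * n - m) = rev_param1 \<beta> a b m" "alpha_param2 (Suc n) \<beta> a b (2 * n - m) = rev_param2 \<beta> a b m"
    unfolding alpha_param1_def alpha_param2_def rev_param1_def rev_param2_def e r by simp_all
qed

lemma jacobi_matrix_cong:
  assumes "\<And>k. k \<le> 2 * n \<Longrightarrow> \<alpha> k = \<alpha>' k"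
  shows "jacobi_matrix (Suc n) \<alpha> = jacobi_matrix (Suc n) \<alpha>'"
proof -
  have e: "alpha_ext (Suc n) \<alpha> = alpha_ext (Suc n) \<alpha>'"
    by (rule ext) (auto simp: alpha_ext_def intro!: assms)
  show ?thesis by (simp only: jacobi_matrix_def jacobi_diag_def jacobi_offdiag_def e)
qed

lemma jacobi_matrix_carrier: "jacobi_matrix n \<alpha> \<in> carrier_mat n n"
  by (simp add: jacobi_matrix_def)

text \<open>Working with coefficients makes the eigenvalue vector measurable on the whole probability space, including
  the null set where some \<open>\<alpha>\<^sub>k\<close> lies outside \<open>(-1, 1)\<close>.\<close>

definition char_coord :: "nat \<Rightarrow> (nat \<Rightarrow> real) \<Rightarrow> nat \<Rightarrow> real" where
  "char_coord n \<alpha> = (\<lambda>i\<in>{..<n}. coeff (char_poly (jacobi_matrix n \<alpha>)) (n - 1 - i))"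

lemma cpoly_char_coord: "cpoly 1 n (char_coord n \<alpha>) = char_poly (jacobi_matrix n \<alpha>)"
proof -
  have d: "degree (char_poly (jacobi_matrix n \<alpha>)) = n" "coeff (char_poly (jacobi_matrix n \<alpha>)) n = 1"
    using degree_monic_char_poly[OF jacobi_matrix_carrier] by blast+
  have "cpoly 1 n (char_coord n \<alpha>) = cpoly 1 n (\<lambda>i. coeff (char_poly (jacobi_matrix n \<alpha>)) (n - 1 - i))"
    by (rule cpoly_cong) (simp add: char_coord_def)
  then show ?thesis using cpoly_of_coeff[of "char_poly (jacobi_matrix n \<alpha>)" n] d by simp
qed

lemma eigenvalue_vector_eq: "eigenvalue_vector n (jacobi_matrix n \<alpha>) = root_vec n (char_coord n \<alpha>)"
  unfolding eigenvalue_vector_def root_vec_def cpoly_char_coord sorted_root_def ..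

lemma measurable_char_coord:
  assumes a: "\<And>k. k \<le> 2 * n \<Longrightarrow> (\<lambda>\<omega>. \<alpha> k \<omega>) \<in> borel_measurable N"
  shows "(\<lambda>\<omega>. char_coord (Suc n) (\<lambda>k. \<alpha> k \<omega>)) \<in> N \<rightarrow>\<^sub>M coords (Suc n)"
proof -
  have A[measurable]: "(\<lambda>\<omega>. alpha_ext (Suc n) (\<lambda>k. \<alpha> k \<omega>) k) \<in> borel_measurable N" for k
  proof (cases "0 \<le> k \<and> k \<le> 2 * int (Suc n) - 2")
    case True
    then have "nat k \<le> 2 * n" by auto
    then show ?thesis using a[of "nat k"] True unfolding alpha_ext_def by simp
  next
    case False
    then show ?thesis unfolding alpha_ext_def if_not_P[OF False] by simp
  qed
  have 1: "(\<lambda>\<omega>. jacobi_diag (Suc n) (\<lambda>k. \<alpha> k \<omega>) i) \<in> borel_measurable N" for i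
    unfolding jacobi_diag_def Let_def by measurable
  have 2: "(\<lambda>\<omega>. jacobi_offdiag (Suc n) (\<lambda>k. \<alpha> k \<omega>) i) \<in> borel_measurable N" for i
    unfolding jacobi_offdiag_def Let_def by measurable
  show ?thesis
  proof (rule coordsI)
    fix i assume i: "i < Suc n"
    have "(\<lambda>\<omega>. coeff (char_poly (jacobi_matrix (Suc n) (\<lambda>k. \<alpha> k \<omega>))) (Suc n - 1 - i)) \<in> borel_measurable N"
      unfolding char_poly_jacobi_matrix by (rule borel_measurable_coeff_tri_poly[OF 1 2])
    then show "(\<lambda>\<omega>. char_coord (Suc n) (\<lambda>k. \<alpha> k \<omega>) i) \<in> borel_measurable N" using i by (simp add: char_coord_def)
  qed (simp add: char_coord_def)
qed

lemma AE_beta_distributed: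
  assumes "beta_distributed M X s t"
  shows "AE \<omega> in M. \<bar>X \<omega>\<bar> < 1"
proof -
  have D: "distributed M lborel X (\<lambda>x. ennreal (beta_density s t x))" using assms by (simp add: beta_distributed_def)
  have X: "X \<in> M \<rightarrow>\<^sub>M lborel" and d: "distr M lborel X = density lborel (\<lambda>x. ennreal (beta_density s t x))"
    using D by (auto simp: distributed_def)
  have "AE x in distr M lborel X. \<bar>x\<bar> < 1"
    unfolding d by (subst AE_density) (auto simp: beta_density_eq)
  then show ?thesis using X by (subst (asm) AE_distr_iff) auto
qed

text \<open>Independence turns the joint law into a product measure, and reversing the indices permutes its factors.\<close>

lemma distr_reversed:
  fixes \<alpha> :: "nat \<Rightarrow> 'w \<Rightarrow> real"
  assumes M: "prob_space M" and ind: "prob_space.indep_vars M (\<lambda>_. borel) \<alpha> {..2 * n}"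
    and beta: "\<And>k. k \<le> 2 * n \<Longrightarrow> beta_distributed M (\<alpha> k) (alpha_param1 (Suc n) \<beta> a b k) (alpha_param2 (Suc n) \<beta> a b k)"
  shows "distr M (Pi\<^sub>M {..<2 * n + 1} (rev_alpha_law \<beta> a b)) (\<lambda>\<omega>. \<lambda>i\<in>{..<2 * n + 1}. \<alpha> (2 * n - i) \<omega>) = Pi\<^sub>M {..<2 * n + 1} (rev_alpha_law \<beta> a b)"
    and "prob_space (Pi\<^sub>M {..<2 * n + 1} (rev_alpha_law \<beta> a b))"
proof -
  interpret prob_space M by (rule M)
  have am: "\<alpha> k \<in> borel_measurable M" if "k \<le> 2 * n" for k
    using beta[OF that] unfolding beta_distributed_def distributed_def by simp
  have bmd: "distr M borel (\<alpha> (2 * n - i)) = rev_alpha_law \<beta> a b i" if "i \<le> 2 * n" for i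
  proof -
    have "distr M borel (\<alpha> (2 * n - i)) = distr M lborel (\<alpha> (2 * n - i))" by (rule distr_cong) auto
    also have "\<dots> = rev_alpha_law \<beta> a b i"
      using beta[of "2 * n - i"] unfolding beta_distributed_def distributed_def rev_alpha_law_def
      by (simp add: alpha_params_reversed[OF that])
    finally show ?thesis .
  qed
  let ?K = "{..2 * n}" and ?I = "{..<2 * n + 1}" and ?f = "\<lambda>i. 2 * n - i"
  let ?N = "\<lambda>k. distr M borel (\<alpha> k)"
  have D: "distr M (Pi\<^sub>M ?K (\<lambda>_. borel)) (\<lambda>\<omega>. \<lambda>k\<in>?K. \<alpha> k \<omega>) = Pi\<^sub>M ?K ?N"
    using ind by (subst (asm) indep_vars_iff_distr_eq_PiM') (auto intro: am)
  have PN: "prob_space (?N k)" if "k \<in> ?K" for k using that by (intro prob_space_distr am) simp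
  have I: "Pi\<^sub>M ?I (\<lambda>i. ?N (?f i)) = Pi\<^sub>M ?I (rev_alpha_law \<beta> a b)"
    by (rule PiM_cong) (auto simp: bmd)
  have R: "distr (Pi\<^sub>M ?K ?N) (Pi\<^sub>M ?I (\<lambda>i. ?N (?f i))) (\<lambda>\<omega>. \<lambda>i\<in>?I. \<omega> (?f i)) = Pi\<^sub>M ?I (\<lambda>i. ?N (?f i))"
  proof (rule distr_PiM_reindex[OF PN])
    show "inj_on ?f ?I" by (rule inj_onI) auto
  qed auto
  have m1: "(\<lambda>\<omega>. \<lambda>k\<in>?K. \<alpha> k \<omega>) \<in> M \<rightarrow>\<^sub>M Pi\<^sub>M ?K (\<lambda>_. borel)"
    by (rule measurable_restrict) (simp add: am)
  have m2: "(\<lambda>\<omega>. \<lambda>i\<in>?I. \<omega> (?f i)) \<in> Pi\<^sub>M ?K (\<lambda>_. borel) \<rightarrow>\<^sub>M Pi\<^sub>M ?I (rev_alpha_law \<beta> a b)"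
  proof (rule measurable_restrict)
    fix i assume "i \<in> ?I"
    have "(\<lambda>\<omega>. \<omega> (?f i)) \<in> Pi\<^sub>M ?K (\<lambda>_. borel) \<rightarrow>\<^sub>M (borel :: real measure)"
      by (rule measurable_component_singleton) auto
    then show "(\<lambda>\<omega>. \<omega> (?f i)) \<in> Pi\<^sub>M ?K (\<lambda>_. borel) \<rightarrow>\<^sub>M rev_alpha_law \<beta> a b i"
      using measurable_cong_sets[OF refl sets_rev_alpha_law] by blast
  qed
  have "Pi\<^sub>M ?I (rev_alpha_law \<beta> a b) = distr (distr M (Pi\<^sub>M ?K (\<lambda>_. borel)) (\<lambda>\<omega>. \<lambda>k\<in>?K. \<alpha> k \<omega>)) (Pi\<^sub>M ?I (rev_alpha_law \<beta> a b)) (\<lambda>\<omega>. \<lambda>i\<in>?I. \<omega> (?f i))"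
    unfolding D using R unfolding I ..
  also have "\<dots> = distr M (Pi\<^sub>M ?I (rev_alpha_law \<beta> a b)) ((\<lambda>\<omega>. \<lambda>i\<in>?I. \<omega> (?f i)) \<circ> (\<lambda>\<omega>. \<lambda>k\<in>?K. \<alpha> k \<omega>))"
    by (rule distr_distr[OF m2 m1])
  also have "((\<lambda>\<omega>. \<lambda>i\<in>?I. \<omega> (?f i)) \<circ> (\<lambda>\<omega>. \<lambda>k\<in>?K. \<alpha> k \<omega>)) = (\<lambda>\<omega>. \<lambda>i\<in>?I. \<alpha> (?f i) \<omega>)"
    by (auto simp: fun_eq_iff)
  finally show "distr M (Pi\<^sub>M ?I (rev_alpha_law \<beta> a b)) (\<lambda>\<omega>. \<lambda>i\<in>?I. \<alpha> (?f i) \<omega>) = Pi\<^sub>M ?I (rev_alpha_law \<beta> a b)" by (rule sym)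
  show "prob_space (Pi\<^sub>M ?I (rev_alpha_law \<beta> a b))"
  proof (rule prob_space_PiM)
    fix i assume "i \<in> ?I"
    then have "i \<le> 2 * n" by simp
    then show "prob_space (rev_alpha_law \<beta> a b i)" using PN[of "?f i"] bmd[of i] by simp
  qed
qed

text \<open>Shifting a bounded function by its bound reduces its expectation to a nonnegative integral.\<close>

lemma integral_bounded_eq:
  fixes f :: "'a \<Rightarrow> real"
  assumes "prob_space N" "f \<in> borel_measurable N" "\<And>x. x \<in> space N \<Longrightarrow> \<bar>f x\<bar> \<le> B"
  shows "(\<integral>x. f x \<partial>N) = enn2real (\<integral>\<^sup>+x. ennreal (f x + B) \<partial>N) - B"
proof -
  interpret prob_space N by (rule assms)
  have i: "integrable N f" using assms by (intro integrable_const_bound[of _ B]) auto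
  have "0 \<le> f x + B" if "x \<in> space N" for x using assms(3)[OF that] by linarith
  then have "(\<integral>x. f x + B \<partial>N) = enn2real (\<integral>\<^sup>+x. ennreal (f x + B) \<partial>N)"
    using assms(2) by (intro integral_eq_nn_integral AE_I2) auto
  moreover have "(\<integral>x. f x + B \<partial>N) = (\<integral>x. f x \<partial>N) + B" using i by (simp add: prob_space)
  ultimately show ?thesis by simp
qed

theorem theorem2:
  fixes n :: nat and \<beta> a b :: real
    and M :: "'w measure" and \<alpha> :: "nat \<Rightarrow> 'w \<Rightarrow> real"
  assumes "n \<ge> 1" and "\<beta> > 0" and "a > -1" and "b > -1"
    and "prob_space M"
    and "prob_space.indep_vars M (\<lambda>_. borel) \<alpha> {..2 * n - 2}"
    and "\<And>k. k \<le> 2 * n - 2 \<Longrightarrow>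
           beta_distributed M (\<alpha> k) (alpha_param1 n \<beta> a b k) (alpha_param2 n \<beta> a b k)"
  shows "prob_space (jacobi_ensemble n \<beta> a b) \<and>
    (\<forall>f :: (nat \<Rightarrow> real) \<Rightarrow> real.
       f \<in> borel_measurable (Pi\<^sub>M {..<n} (\<lambda>_. borel)) \<longrightarrow>
       bounded (f ` ({..<n} \<rightarrow>\<^sub>E UNIV)) \<longrightarrow>
       symmetric_fun n f \<longrightarrow>
       (\<integral>\<omega>. f (eigenvalue_vector n (jacobi_matrix n (\<lambda>k. \<alpha> k \<omega>))) \<partial>M)
         = (\<integral>x. f x \<partial>(jacobi_ensemble n \<beta> a b)))"
proof -
  obtain m where n: "n = Suc m" using \<open>n \<ge> 1\<close> by (cases n) auto
  have nm: "2 * n - 2 = 2 * m" by (simp add: n)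
  have ind: "prob_space.indep_vars M (\<lambda>_. borel) \<alpha> {..2 * m}" using assms(6) unfolding nm .
  have beta: "beta_distributed M (\<alpha> k) (alpha_param1 (Suc m) \<beta> a b k) (alpha_param2 (Suc m) \<beta> a b k)" if "k \<le> 2 * m" for k
  proof -
    have "k \<le> 2 * n - 2" using that nm by simp
    from assms(7)[OF this] show ?thesis unfolding n .
  qed
  let ?P = "Pi\<^sub>M {..<2 * m + 1} (rev_alpha_law \<beta> a b)"
  let ?y = "\<lambda>\<omega>. \<lambda>i\<in>{..<2 * m + 1}. \<alpha> (2 * m - i) \<omega>"
  have D: "distr M ?P ?y = ?P" "prob_space ?P"
    by (rule distr_reversed[OF \<open>prob_space M\<close> ind beta], assumption)+
  note law = symmetric_root_law[OF assms(2-4) D(2)]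
  have am: "(\<lambda>\<omega>. \<alpha> k \<omega>) \<in> borel_measurable M" if "k \<le> 2 * m" for k
    using beta[OF that] unfolding beta_distributed_def distributed_def by simp
  let ?ev = "\<lambda>\<omega>. eigenvalue_vector n (jacobi_matrix n (\<lambda>k. \<alpha> k \<omega>))"
  have evm: "?ev \<in> M \<rightarrow>\<^sub>M coords (Suc m)"
    unfolding n eigenvalue_vector_eq by (rule measurable_compose[OF measurable_char_coord measurable_root_vec]) (rule am)
  have AE: "AE \<omega> in M. ?ev \<omega> = root_vec (Suc m) (fst (char_pair m (?y \<omega>)))"
  proof -
    have "AE \<omega> in M. \<forall>k\<in>{..2 * m}. \<bar>\<alpha> k \<omega>\<bar> < 1"
      by (rule AE_finite_allI) (auto intro: AE_beta_distributed beta)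
    then show ?thesis
    proof eventually_elim
      case (elim \<omega>)
      have J: "jacobi_matrix (Suc m) (\<lambda>k. \<alpha> k \<omega>) = jacobi_matrix (Suc m) (reversed m (?y \<omega>))"
        by (rule jacobi_matrix_cong) (auto simp: reversed_def)
      have "\<bar>?y \<omega> i\<bar> < 1" if "i \<le> 2 * m" for i using elim that by simp
      then have "cpoly 1 (Suc m) (fst (char_pair m (?y \<omega>))) = char_poly (jacobi_matrix (Suc m) (\<lambda>k. \<alpha> k \<omega>))"
        unfolding J char_poly_jacobi_matrix using cpoly_char_pair[of m "?y \<omega>"] by blast
      then show ?case unfolding n eigenvalue_vector_eq root_vec_def cpoly_char_coord by simp
    qed
  qed
  have ym: "?y \<in> M \<rightarrow>\<^sub>M ?P"
  proof (rule measurable_restrict)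
    fix i assume "i \<in> {..<2 * m + 1}"
    have "\<alpha> (2 * m - i) \<in> borel_measurable M" using am[of "2 * m - i"] by simp
    then show "\<alpha> (2 * m - i) \<in> M \<rightarrow>\<^sub>M rev_alpha_law \<beta> a b i" by (simp only: measurable_cong_sets[OF refl sets_rev_alpha_law])
  qed
  have sm: "(\<lambda>x. root_vec (Suc m) (fst (char_pair m x))) \<in> ?P \<rightarrow>\<^sub>M coords (Suc m)"
  proof -
    have "char_pair m \<in> ?P \<rightarrow>\<^sub>M pair_coords m"
      by (rule measurable_char_pair) (simp add: measurable_component_rev_alpha_law)
    from measurable_compose[OF measurable_compose[OF this measurable_fst] measurable_root_vec] show ?thesis .
  qed
  have nn: "(\<integral>\<^sup>+\<omega>. F (?ev \<omega>) \<partial>M) = (\<integral>\<^sup>+x. F x \<partial>jacobi_ensemble n \<beta> a b)"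
    if F: "F \<in> borel_measurable (coords (Suc m))"
      and sym: "\<And>p y. p permutes {..<Suc m} \<Longrightarrow> y \<in> {..<Suc m} \<rightarrow>\<^sub>E UNIV \<Longrightarrow> F (y \<circ> p) = F y" for F
  proof -
    have "(\<integral>\<^sup>+\<omega>. F (?ev \<omega>) \<partial>M) = (\<integral>\<^sup>+\<omega>. F (root_vec (Suc m) (fst (char_pair m (?y \<omega>)))) \<partial>M)"
      by (rule nn_integral_cong_AE) (use AE in eventually_elim, simp)
    also have "\<dots> = (\<integral>\<^sup>+x. F (root_vec (Suc m) (fst (char_pair m x))) \<partial>distr M ?P ?y)"
      by (rule nn_integral_distr[symmetric, OF ym]) (simp only: measurable_distr_eq1 measurable_compose[OF sm F])
    also have "\<dots> = (\<integral>\<^sup>+x. F x \<partial>jacobi_ensemble n \<beta> a b)"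
      unfolding D(1) n by (rule law(2)[OF F sym])
    finally show ?thesis .
  qed
  show ?thesis
  proof (intro conjI allI impI)
    show "prob_space (jacobi_ensemble n \<beta> a b)" unfolding n by (rule law(1))
    fix f :: "(nat \<Rightarrow> real) \<Rightarrow> real"
    assume f: "f \<in> borel_measurable (Pi\<^sub>M {..<n} (\<lambda>_. borel))" and bd: "bounded (f ` ({..<n} \<rightarrow>\<^sub>E UNIV))"
      and sym: "symmetric_fun n f"
    have "sets (Pi\<^sub>M {..<n} (\<lambda>_. borel :: real measure)) = sets (coords n)" by (rule sets_PiM_cong) auto
    then have fm: "f \<in> borel_measurable (coords n)" using f measurable_cong_sets by blast
    obtain B where B: "\<And>x. x \<in> {..<n} \<rightarrow>\<^sub>E UNIV \<Longrightarrow> \<bar>f x\<bar> \<le> B"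
      using bd unfolding bounded_iff by (auto simp: image_iff)
    have Fm: "(\<lambda>x. ennreal (f x + B)) \<in> borel_measurable (coords (Suc m))" using fm unfolding n by measurable
    have Fs: "ennreal (f (y \<circ> p) + B) = ennreal (f y + B)"
      if "p permutes {..<Suc m}" "y \<in> {..<Suc m} \<rightarrow>\<^sub>E UNIV" for p y
      using sym that unfolding symmetric_fun_def n by auto
    have 1: "(\<integral>\<omega>. f (?ev \<omega>) \<partial>M) = enn2real (\<integral>\<^sup>+\<omega>. ennreal (f (?ev \<omega>) + B) \<partial>M) - B"
    proof (rule integral_bounded_eq[OF \<open>prob_space M\<close>])
      show "(\<lambda>\<omega>. f (?ev \<omega>)) \<in> borel_measurable M"
        using measurable_compose[OF evm fm[unfolded n]] .
      fix \<omega> show "\<bar>f (?ev \<omega>)\<bar> \<le> B" by (rule B) (auto simp: eigenvalue_vector_def)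
    qed
    have 2: "(\<integral>x. f x \<partial>jacobi_ensemble n \<beta> a b) = enn2real (\<integral>\<^sup>+x. ennreal (f x + B) \<partial>jacobi_ensemble n \<beta> a b) - B"
    proof (rule integral_bounded_eq)
      show "prob_space (jacobi_ensemble n \<beta> a b)" unfolding n by (rule law(1))
      show "f \<in> borel_measurable (jacobi_ensemble n \<beta> a b)"
        using fm measurable_cong_sets[OF sets_jacobi_ensemble refl] by blast
      fix x assume "x \<in> space (jacobi_ensemble n \<beta> a b)"
      then have "x \<in> space (coords n)" using sets_eq_imp_space_eq[OF sets_jacobi_ensemble] by blast
      then show "\<bar>f x\<bar> \<le> B" by (intro B) (simp add: space_PiM)
    qed
    show "(\<integral>\<omega>. f (?ev \<omega>) \<partial>M) = (\<integral>x. f x \<partial>jacobi_ensemble n \<beta> a b)"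
    proof -
      have "(\<integral>\<^sup>+\<omega>. ennreal (f (?ev \<omega>) + B) \<partial>M) = (\<integral>\<^sup>+x. ennreal (f x + B) \<partial>jacobi_ensemble n \<beta> a b)"
        by (rule nn[OF Fm]) (rule Fs)
      then show ?thesis unfolding 1 2 by (simp only:)
    qed
  qed
qed

end
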